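(* Let $k=2\ell+1\ge3$ be odd and let $f_\lambda(x)=\lambda x-Q(x)$, $(x,\lambda)\in H_{k-1}\times\mathbb{R}$, where $Q$ is the standard quadratic equivariant on $H_{k-1}$. Let $\eta_0>0$ and define $\rho=4\sqrt{\eta_0}$, $\delta_1=\rho/2$, $\delta_2=\sqrt{k/3}\,\rho$ and $$W=\big([-\delta_1,\delta_1]\times\overline{D}_{\delta_2}(0)\big)\times[-\rho,\rho]\subset(L_1\oplus L_1^\perp)\times\mathbb{R}=H_{k-1}\times\mathbb{R}.$$ There exist $C>0$, depending only on $\eta_0$ and $k$, and $\eta_1\in(0,\eta_0]$, such that for every $\eta\in(0,\eta_1]$ there is a smooth ($C^\infty$) $S_{k-1}$-equivariant family $\hat f^\eta_\lambda$ on $H_{k-1}$ ($\lambda\in\mathbb{R}$) satisfying: (1) $\hat f^\eta_\lambda(x)=f_\lambda(x)$ if $(x,\lambda)\notin W$. (2) $\|\hat f^\eta-f\|_{W,2}<C\eta$. (3) The only bifurcations of the family $\hat f^\eta_\lambda$ are saddle-node bifurcations, and $\hat f^\eta_\lambda$ is stable under $C^2$-small perturbations supported on a compact neighbourhood of $(0,0)\in H_{k-1}\times\mathbb{R}$ (no assumption of equivariance on the perturbation). (4) The family $\hat f^\eta_\lambda$ has exactly $2^{2\ell}-\binom{2\ell}{\ell}$ saddle-node bifurcations, and all of the branches of solutions of index $\ne\ell$ end or start with a saddle-node bifurcation that occurs in $W$. (5) There are exactly $\binom{2\ell}{\ell}$ crossing curves $(x,\lambda):\mathbb{R}\to H_{k-1}\times\mathbb{R}$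 of solutions to $\hat f^\eta_\lambda=0$; each of these curves consists of hyperbolic equilibria of index $\ell$.
   Context: $H_{k-1}=\{x\in\mathbb{R}^k:\sum_i x_i=0\}$ with the Euclidean inner product; $S_k$ acts on it by permuting coordinates. $S_{k-1}$ denotes the subgroup $S_1\times S_{k-1}\subset S_k$ fixing the first coordinate index; it acts trivially on the parameter $\lambda$. The standard quadratic equivariant is the gradient on $H_{k-1}$ of $C(x)=\frac13\sum_{i=1}^k x_i^3$ restricted to $H_{k-1}$, i.e. $Q(x)=\big(x_1^2-\frac1k\sum_i x_i^2,\dots,x_k^2-\frac1k\sum_i x_i^2\big)$. $L_1=\mathbb{R}\varepsilon_1$, where $\varepsilon_1=\frac{1}{\sqrt{k(k-1)}}(k-1,-1,\dots,-1)$ is a unit vector; $L_1$ is identified with $\mathbb{R}$ by $t\mapsto t\varepsilon_1$, and $\overline{D}_{\delta_2}(0)$ is the closed disc of radius $\delta_2$ centred at $0$ in $L_1^\perp\subset H_{k-1}$. For a smooth map $g$ on $H_{k-1}\times\mathbb{R}$, $\|g\|_{W,2}=\max_{0\le s\le2}\sup_{(x,\lambda)\in W}\|D^sg_{(x,\lambda)}\|$. The index of a hyperbolic zero (equilibrium) is the number of eigenvalues of the linearization with strictly negative real part, with multiplicity. A branch of solutions of $\hat f^\eta$ means a connected curve of hyperbolic zeros in $H_{k-1}\times\mathbb{R}$. Saying that the only bifurcations are saddle-node bifurcations means that every zero $(x,\lambda)$ of the family at which $x$ is not hyperbolic is a (generic) saddle-node bifurcation point. A crossing curve is a curve $(x,\lambda):\mathbb{R}\to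 H_{k-1}\times\mathbb{R}$ of zeros such that $\lambda(t)$ takes all values in $\mathbb{R}$ and $x(t)$ is a hyperbolic zero of the family at parameter $\lambda(t)$ for all $t\in\mathbb{R}$. Stability in (3) means that every sufficiently $C^2$-small perturbation of the family, supported in a fixed compact neighbourhood of $(0,0)$, again has only saddle-node bifurcations, with the same number of saddle-node bifurcations and of crossing curves. *)

theory Defs
  imports "HOL-Analysis.Analysis"
begin

section \<open>The phase space, the symmetries and the standard quadratic equivariant\<close>

text \<open>
  The type \<^typ>\<open>'k\<close> indexes the coordinates, so that k is \<^term>\<open>CARD('k)\<close>.  Maps on the
  hyperplane H and on its product with the parameter line are HOL functions on the ambient
  spaces; every notion below only looks at their restrictions to \<open>H\<close> and \<open>HR\<close>.
\<close>

definition H :: "(real ^ 'k) set" where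
  "H = {x. (\<Sum>i\<in>UNIV. x $ i) = 0}"

definition HR :: "((real ^ 'k) \<times> real) set" where
  "HR = H \<times> UNIV"

definition permute_coords :: "('k \<Rightarrow> 'k) \<Rightarrow> real ^ 'k \<Rightarrow> real ^ 'k" where
  "permute_coords \<sigma> x = (\<chi> i. x $ inv \<sigma> i)"

text \<open>Equivariance under the stabiliser of the coordinate index \<open>i0\<close> in the symmetric group;
  the group acts trivially on the parameter.\<close>

definition stabilizer_equivariant ::
    "'k \<Rightarrow> ((real ^ 'k) \<times> real \<Rightarrow> real ^ 'k) \<Rightarrow> bool" where
  "stabilizer_equivariant i0 g \<longleftrightarrow>
     (\<forall>\<sigma>. bij \<sigma> \<and> \<sigma> i0 = i0 \<longrightarrow>
        (\<forall>x\<in>H. \<forall>lam. g (permute_coords \<sigma> x, lam) = permute_coords \<sigma> (g (x, lam))))"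

definition Q :: "real ^ 'k \<Rightarrow> real ^ 'k" where
  "Q x = (\<chi> i. (x $ i)\<^sup>2 - (1 / real CARD('k)) * (\<Sum>j\<in>UNIV. (x $ j)\<^sup>2))"

lemma Q_in_H: "Q x \<in> H"
  by (simp add: Q_def H_def sum_subtractf)

lemma Q_is_gradient:
  fixes x :: "real ^ 'k"
  assumes "x \<in> H"
  shows "((\<lambda>x. (1/3) * (\<Sum>i\<in>UNIV. (x $ i) ^ 3)) has_derivative (\<lambda>h. (\<Sum>i\<in>UNIV. (x $ i)\<^sup>2 * h $ i)))
           (at x within H)"
    and "h \<in> H \<Longrightarrow> (\<Sum>i\<in>UNIV. (x $ i)\<^sup>2 * h $ i) = Q x \<bullet> h"
proof -
  show "((\<lambda>x. (1/3) * (\<Sum>i\<in>UNIV. (x $ i) ^ 3)) has_derivative (\<lambda>h. (\<Sum>i\<in>UNIV. (x $ i)\<^sup>2 * h $ i)))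
           (at x within H)"
    by (auto intro!: derivative_eq_intros bounded_linear.has_derivative[OF bounded_linear_vec_nth]
        simp: sum_distrib_left power2_eq_square algebra_simps)
  show "(\<Sum>i\<in>UNIV. (x $ i)\<^sup>2 * h $ i) = Q x \<bullet> h" if "h \<in> H"
    using that by (simp add: Q_def H_def inner_vec_def left_diff_distrib sum_subtractf
        flip: sum_distrib_left sum_divide_distrib)
qed

definition f_std :: "(real ^ 'k) \<times> real \<Rightarrow> real ^ 'k" where
  "f_std = (\<lambda>(x, lam). lam *\<^sub>R x - Q x)"

definition eps1 :: "'k \<Rightarrow> real ^ 'k" where
  "eps1 i0 = (1 / sqrt (real CARD('k) * (real CARD('k) - 1))) *\<^sub>R
     (\<chi> i. if i = i0 then real CARD('k) - 1 else - 1)"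

definition W_box :: "'k \<Rightarrow> real \<Rightarrow> real \<Rightarrow> real \<Rightarrow> ((real ^ 'k) \<times> real) set" where
  "W_box i0 \<delta>1 \<delta>2 \<rho> =
     {(t *\<^sub>R eps1 i0 + y, lam) | t y lam.
        t \<in> {-\<delta>1..\<delta>1} \<and> y \<in> H \<and> y \<bullet> eps1 i0 = 0 \<and> norm y \<le> \<delta>2 \<and> lam \<in> {-\<rho>..\<rho>}}"


section \<open>Higher derivatives on a linear subspace\<close>

text \<open>
  \<open>deriv_on E g [v1, \<dots>, vs] p\<close> is the value of the s-th derivative of \<open>g\<close> (as a map on the
  subspace \<open>E\<close>) at \<open>p\<close> on the vectors \<open>v1, \<dots>, vs\<close> of \<open>E\<close>.  A Frechet derivative at a point of
  \<open>E\<close> within \<open>E\<close> is only determined on \<open>E\<close>, so only directions in \<open>E\<close> are ever used.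
\<close>

primrec deriv_on ::
    "'a::real_normed_vector set \<Rightarrow> ('a \<Rightarrow> 'b::real_normed_vector) \<Rightarrow> 'a list \<Rightarrow> 'a \<Rightarrow> 'b" where
  "deriv_on E g [] = g"
| "deriv_on E g (v # vs) = (\<lambda>p. frechet_derivative (deriv_on E g vs) (at p within E) v)"

lemma frechet_derivative_within_subspace:
  fixes f :: "'a::real_normed_vector \<Rightarrow> 'b::real_normed_vector"
  assumes E: "subspace E" "p \<in> E" "v \<in> E" and f: "(f has_derivative f') (at p within E)"
  shows "frechet_derivative f (at p within E) v = f' v"
proof -
  have *: "((\<lambda>t. f (p + t *\<^sub>R v)) has_derivative (\<lambda>t. d (t *\<^sub>R v))) (at 0)"
    if d: "(f has_derivative d) (at p within E)" for d
  proof -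
    have line: "((\<lambda>t. p + t *\<^sub>R v) has_derivative (\<lambda>t. t *\<^sub>R v)) (at 0)"
      by (auto intro!: derivative_eq_intros)
    have "range (\<lambda>t. p + t *\<^sub>R v) \<subseteq> E"
      using E by (auto intro: subspace_add subspace_scale)
    then have "(f has_derivative d) (at (p + 0 *\<^sub>R v) within range (\<lambda>t. p + t *\<^sub>R v))"
      using d by (auto intro: has_derivative_subset)
    from has_derivative_in_compose[OF line this] show ?thesis by simp
  qed
  have "(f has_derivative frechet_derivative f (at p within E)) (at p within E)"
    using f by (auto simp: frechet_derivative_works[symmetric] differentiable_def)
  from has_derivative_unique[OF *[OF this] *[OF f]] show ?thesis
    by (metis scaleR_one)
qed

definition smooth_on_subspace ::
    "'a::real_normed_vector set \<Rightarrow> ('a \<Rightarrow> 'b::real_normed_vector) \<Rightarrow> bool" where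
  "smooth_on_subspace E g \<longleftrightarrow> (\<forall>vs\<in>lists E. deriv_on E g vs differentiable_on E)"

definition multilinear_norm ::
    "'a::real_normed_vector set \<Rightarrow> nat \<Rightarrow> ('a list \<Rightarrow> 'b::real_normed_vector) \<Rightarrow> real" where
  "multilinear_norm E s T =
     (SUP vs\<in>{vs. length vs = s \<and> (\<forall>v\<in>set vs. v \<in> E \<and> norm v \<le> 1)}. norm (T vs))"

definition C2_norm ::
    "((real ^ 'k) \<times> real) set \<Rightarrow> ((real ^ 'k) \<times> real \<Rightarrow> real ^ 'k) \<Rightarrow> real" where
  "C2_norm W g =
     Max ((\<lambda>s. SUP p\<in>W. multilinear_norm HR s (\<lambda>vs. deriv_on HR g vs p)) ` {0..2})"

definition smooth_family :: "((real ^ 'k) \<times> real \<Rightarrow> real ^ 'k) \<Rightarrow> bool" where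
  "smooth_family g \<longleftrightarrow> smooth_on_subspace HR g \<and> g ` HR \<subseteq> H"


section \<open>Eigenvalues, hyperbolic zeros and their index\<close>

text \<open>The complexification of a linear map of \<open>H\<close>, acting on the complexification \<open>HC\<close> of \<open>H\<close>.\<close>

definition HC :: "(complex ^ 'k) set" where
  "HC = {w. (\<Sum>i\<in>UNIV. w $ i) = 0}"

definition complexify :: "(real ^ 'k \<Rightarrow> real ^ 'k) \<Rightarrow> complex ^ 'k \<Rightarrow> complex ^ 'k" where
  "complexify A w = (\<chi> i. Complex (A (\<chi> j. Re (w $ j)) $ i) (A (\<chi> j. Im (w $ j)) $ i))"

definition eigenvalues :: "(real ^ 'k \<Rightarrow> real ^ 'k) \<Rightarrow> complex set" where
  "eigenvalues A = {\<mu>. \<exists>w\<in>HC. w \<noteq> 0 \<and> complexify A w = \<mu> *s w}"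

text \<open>Algebraic multiplicity: the complex dimension of the generalised eigenspace.\<close>

definition alg_mult :: "(real ^ 'k \<Rightarrow> real ^ 'k) \<Rightarrow> complex \<Rightarrow> nat" where
  "alg_mult A \<mu> = vec.dim {w\<in>HC. \<exists>n. ((\<lambda>u. complexify A u - \<mu> *s u) ^^ n) w = 0}"

definition linearization ::
    "((real ^ 'k) \<times> real \<Rightarrow> real ^ 'k) \<Rightarrow> (real ^ 'k) \<times> real \<Rightarrow> real ^ 'k \<Rightarrow> real ^ 'k" where
  "linearization g = (\<lambda>(x, lam). frechet_derivative (\<lambda>y. g (y, lam)) (at x within H))"

definition zeros :: "((real ^ 'k) \<times> real \<Rightarrow> real ^ 'k) \<Rightarrow> ((real ^ 'k) \<times> real) set" where
  "zeros g = {p\<in>HR. g p = 0}"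

definition hyperbolic_zeros ::
    "((real ^ 'k) \<times> real \<Rightarrow> real ^ 'k) \<Rightarrow> ((real ^ 'k) \<times> real) set" where
  "hyperbolic_zeros g = {p\<in>zeros g. \<forall>\<mu>\<in>eigenvalues (linearization g p). Re \<mu> \<noteq> 0}"

definition index :: "((real ^ 'k) \<times> real \<Rightarrow> real ^ 'k) \<Rightarrow> (real ^ 'k) \<times> real \<Rightarrow> nat" where
  "index g p =
     (\<Sum>\<mu> | \<mu> \<in> eigenvalues (linearization g p) \<and> Re \<mu> < 0. alg_mult (linearization g p) \<mu>)"


section \<open>Saddle-node bifurcations, branches and crossing curves\<close>

text \<open>
  The generic saddle-node: 0 is a simple eigenvalue of the linearization and the only one on the
  imaginary axis; with \<open>v\<close> spanning the kernel and \<open>w\<close> the orthogonal complement (in \<open>H\<close>) of the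
  range, the family crosses with nonzero speed in \<open>lam\<close> and nonzero quadratic term along \<open>v\<close>.
\<close>

definition saddle_node :: "((real ^ 'k) \<times> real \<Rightarrow> real ^ 'k) \<Rightarrow> (real ^ 'k) \<times> real \<Rightarrow> bool" where
  "saddle_node g = (\<lambda>(x, lam).
     (x, lam) \<in> zeros g \<and>
     (let A = linearization g (x, lam) in
       0 \<in> eigenvalues A \<and> alg_mult A 0 = 1 \<and>
       (\<forall>\<mu>\<in>eigenvalues A. \<mu> \<noteq> 0 \<longrightarrow> Re \<mu> \<noteq> 0) \<and>
       (\<exists>v\<in>H. \<exists>w\<in>H. v \<noteq> 0 \<and> w \<noteq> 0 \<and> A v = 0 \<and> (\<forall>u\<in>H. w \<bullet> A u = 0) \<and>
          w \<bullet> vector_derivative (\<lambda>\<mu>. g (x, \<mu>)) (at lam) \<noteq> 0 \<and>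
          w \<bullet> deriv_on H (\<lambda>y. g (y, lam)) [v, v] x \<noteq> 0)))"

definition saddle_nodes ::
    "((real ^ 'k) \<times> real \<Rightarrow> real ^ 'k) \<Rightarrow> ((real ^ 'k) \<times> real) set" where
  "saddle_nodes g = {p. saddle_node g p}"

definition only_saddle_nodes :: "((real ^ 'k) \<times> real \<Rightarrow> real ^ 'k) \<Rightarrow> bool" where
  "only_saddle_nodes g \<longleftrightarrow> zeros g - hyperbolic_zeros g \<subseteq> saddle_nodes g"

text \<open>
  Branches are taken maximal, i.e. they are the connected components of the set of hyperbolic
  zeros (a proper piece of a branch has no reason to reach a bifurcation point).
\<close>

definition branches ::
    "((real ^ 'k) \<times> real \<Rightarrow> real ^ 'k) \<Rightarrow> ((real ^ 'k) \<times> real) set set" where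
  "branches g = components (hyperbolic_zeros g)"

definition curve_starts_or_ends_at ::
    "'a::topological_space set \<Rightarrow> 'a \<Rightarrow> bool" where
  "curve_starts_or_ends_at B p \<longleftrightarrow>
     (\<exists>\<gamma> :: real \<Rightarrow> 'a. continuous_on {0<..<1} \<gamma> \<and> inj_on \<gamma> {0<..<1} \<and> \<gamma> ` {0<..<1} = B \<and>
        ((\<gamma> \<longlongrightarrow> p) (at_right 0) \<or> (\<gamma> \<longlongrightarrow> p) (at_left 1)))"

definition crossing_curve ::
    "((real ^ 'k) \<times> real \<Rightarrow> real ^ 'k) \<Rightarrow> (real \<Rightarrow> (real ^ 'k) \<times> real) \<Rightarrow> bool" where
  "crossing_curve g \<gamma> \<longleftrightarrow>
     continuous_on UNIV \<gamma> \<and> (\<forall>t. \<gamma> t \<in> hyperbolic_zeros g) \<and> range (\<lambda>t. snd (\<gamma> t)) = UNIV"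

text \<open>Crossing curves are counted up to reparametrization, i.e. as subsets of \<open>HR\<close>.\<close>

definition crossing_sets ::
    "((real ^ 'k) \<times> real \<Rightarrow> real ^ 'k) \<Rightarrow> ((real ^ 'k) \<times> real) set set" where
  "crossing_sets g = {range \<gamma> | \<gamma>. crossing_curve g \<gamma>}"

definition compact_nhd_of_origin :: "((real ^ 'k) \<times> real) set \<Rightarrow> bool" where
  "compact_nhd_of_origin K \<longleftrightarrow>
     compact K \<and> K \<subseteq> HR \<and> (\<exists>U. openin (top_of_set HR) U \<and> (0, 0) \<in> U \<and> U \<subseteq> K)"

definition C2_stable :: "((real ^ 'k) \<times> real \<Rightarrow> real ^ 'k) \<Rightarrow> bool" where
  "C2_stable g \<longleftrightarrow>
     (\<forall>K. compact_nhd_of_origin K \<longrightarrow>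
       (\<exists>\<epsilon>>0. \<forall>h. smooth_family h \<and> (\<forall>p\<in>HR - K. h p = g p) \<and> C2_norm K (\<lambda>p. h p - g p) < \<epsilon> \<longrightarrow>
          only_saddle_nodes h \<and>
          finite (saddle_nodes h) \<and> card (saddle_nodes h) = card (saddle_nodes g) \<and>
          finite (crossing_sets h) \<and> card (crossing_sets h) = card (crossing_sets g)))"

end

theory Submission
  imports Defs
begin

text \<open>
  The family is perturbed in the \<open>S\<^sub>k\<^sub>-\<^sub>1\<close>-invariant direction \<open>E = (1 - k, 1, \<dots>, 1)\<close>: let
  \<open>g = f + \<eta> \<phi>(\<lambda>\<^sup>2) \<psi>(|x|\<^sup>2) E\<close> with cutoff functions \<open>\<phi>\<close>, \<open>\<psi>\<close>, where \<open>\<psi>\<close> is 1 near every zero.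
  Put \<open>d\<^sub>j = x\<^sub>j - \<lambda>/2\<close>.  A zero satisfies \<open>d\<^sub>j = \<plusminus>s\<close> with one \<open>s > 0\<close> for all coordinates other than the
  distinguished one, and \<open>(k\<lambda>/2 + ms)\<^sup>2 = s\<^sup>2 - k\<eta>\<phi>\<close>, where \<open>m\<close> is the sum of the signs.  So the zeros split
  into \<open>2\<^sup>2\<^sup>l\<close> curves lying in disjoint open orthants, one for each sign vector: for \<open>m = 0\<close> the curve is a graph over
  \<open>\<lambda>\<close>, for \<open>m \<noteq> 0\<close> it has exactly one fold.

  Stability is shown by compactness: a sequence of \<open>C\<^sup>2\<close> perturbations tending to \<open>g\<close> and violating one
  of the claims yields, in the limit, a zero of \<open>g\<close> whose linearization, which is symmetric, contradicts the
  explicit description.  Curves of zeros of the perturbation are continued by an implicit function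
  argument, and its folds are found where \<open>|\<lambda>|\<close> is minimal on the orthant.
\<close>


section \<open>Smooth cutoff functions\<close>

text \<open>The sign of the perturbation carries the count. Up to a negative factor \<open>E\<close>
  is \<epsilon>1, the direction of \<open>H\<close> fixed by the stabiliser. Its large negative
  entry lowers the squared deviation at the distinguished coordinate by k\<eta>\<phi> below the
  common value s^2 of the others, so s^2 >= k\<eta>\<phi> and no zero reaches the boundary of its
  orthant, not even at \<lambda> = 0, where the curves of the original family all meet. With the
  opposite sign a balanced curve would obey s^2 = (k\<lambda>/2)^2 - k\<eta>\<phi> and break up
  around \<lambda> = 0. Oddness of k enters through parity: m is a sum of 2l signs, hence even, so
  either m = 0 or m^2 - 1 >= 3, and m^2 - 1 is the quantity by which the fold formulas divide. The
  folds satisfy k\<lambda>^2 = 4(m^2 - 1)\<eta>, a scale set by \<eta>, while the cutoffs act at a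
  scale set by \<eta>0; a small \<eta>1 keeps the two apart. The obstacle in the stability claim is
  that the perturbed linearizations need not be symmetric: eigenvalues may turn complex and kernels
  differ from cokernels. Symmetry is recovered only in the limit, which is why the degeneracies are
  phrased as closed conditions.\<close>

text \<open>The functions \<open>P(1/x) exp(-1/x)\<close> on the positive axis, extended by 0, are closed under
  differentiation, which gives smooth cutoff functions.\<close>

definition flat :: "real poly \<Rightarrow> real \<Rightarrow> real" where
  "flat P x = (if x > 0 then poly P (1 / x) * exp (- (1 / x)) else 0)"

text \<open>Chain rule in t = 1/x: dt/dx = -t^2 and the derivative of P(t) exp(-t) is (P' - P)(t)
  exp(-t).\<close>

definition flat_pderiv :: "real poly \<Rightarrow> real poly" where
  "flat_pderiv P = [:0, 0, 1:] * (P - pderiv P)"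

lemma tendsto_poly_times_exp_minus:
  fixes P :: "real poly"
  shows "((\<lambda>t. poly P t * exp (- t)) \<longlongrightarrow> 0) at_top"
proof -
  have "((\<lambda>t. \<Sum>i\<le>degree P. coeff P i * (t ^ i / exp t)) \<longlongrightarrow> (\<Sum>i\<le>degree P. coeff P i * 0)) at_top"
    by (intro tendsto_intros tendsto_power_div_exp_0)
  then show ?thesis
    by (simp add: poly_altdef exp_minus sum_distrib_right divide_inverse mult.assoc)
qed

lemma flat_has_field_derivative:
  "(flat P has_field_derivative flat (flat_pderiv P) x) (at x)"
proof -
  consider "x < 0" | "x > 0" | "x = 0" by linarith
  then show ?thesis
  proof cases
    case 1
    have "((\<lambda>_. 0) has_field_derivative 0) (at x)" by simp
    then have "(flat P has_field_derivative 0) (at x)"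
      by (rule has_field_derivative_transform_within_open[of _ _ _ "{..<0}"]) (use 1 in \<open>auto simp: flat_def\<close>)
    then show ?thesis using 1 by (simp add: flat_def)
  next
    case 2
    have "((\<lambda>x. poly P (1 / x) * exp (- (1 / x))) has_field_derivative
        flat (flat_pderiv P) x) (at x)"
      using 2 by (auto intro!: derivative_eq_intros DERIV_chain2[OF poly_DERIV]
          simp: flat_def flat_pderiv_def field_simps power2_eq_square)
    then show ?thesis
      by (rule has_field_derivative_transform_within_open[of _ _ _ "{0<..}"]) (use 2 in \<open>auto simp: flat_def\<close>)
  next
    case 3
    \<comment> \<open>With t = 1/h the right difference quotient at 0 is t P(t) exp(-t), so one more
      power of t is absorbed by the exponential.\<close>
    have "((\<lambda>t. poly ([:0, 1:] * P) t * exp (- t)) \<longlongrightarrow> 0) at_top"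
      by (rule tendsto_poly_times_exp_minus)
    then have "((\<lambda>h. poly ([:0, 1:] * P) (inverse h) * exp (- inverse h)) \<longlongrightarrow> 0) (at_right 0)"
      by (rule filterlim_compose[OF _ filterlim_inverse_at_top_right])
    then have "((\<lambda>h. (flat P (0 + h) - flat P 0) / h) \<longlongrightarrow> 0) (at_right 0)"
      by (rule Lim_transform_eventually)
         (auto simp: flat_def eventually_at_filter field_simps intro!: always_eventually)
    moreover have "((\<lambda>h. (flat P (0 + h) - flat P 0) / h) \<longlongrightarrow> 0) (at_left 0)"
      by (rule Lim_transform_eventually[OF tendsto_const])
         (auto simp: flat_def eventually_at_filter intro!: always_eventually)
    ultimately show ?thesis
      unfolding DERIV_def 3 by (simp add: flat_def filterlim_at_split)
  qed
qed

inductive_set smooth_fns :: "('a::real_inner \<Rightarrow> real) set" where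
  const: "(\<lambda>_. c) \<in> smooth_fns"
| inner: "(\<lambda>x. x \<bullet> b) \<in> smooth_fns"
| add: "f \<in> smooth_fns \<Longrightarrow> g \<in> smooth_fns \<Longrightarrow> (\<lambda>x. f x + g x) \<in> smooth_fns"
| mult: "f \<in> smooth_fns \<Longrightarrow> g \<in> smooth_fns \<Longrightarrow> (\<lambda>x. f x * g x) \<in> smooth_fns"
| flat: "f \<in> smooth_fns \<Longrightarrow> (\<lambda>x. flat P (f x)) \<in> smooth_fns"
| inverse: "f \<in> smooth_fns \<Longrightarrow> (\<And>x. f x \<noteq> 0) \<Longrightarrow> (\<lambda>x. inverse (f x)) \<in> smooth_fns"

lemma smooth_fns_uminus: "f \<in> smooth_fns \<Longrightarrow> (\<lambda>x. - f x) \<in> smooth_fns"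
  using smooth_fns.mult[OF smooth_fns.const[of "-1"]] by fastforce

lemma smooth_fns_diff: "f \<in> smooth_fns \<Longrightarrow> g \<in> smooth_fns \<Longrightarrow> (\<lambda>x. f x - g x) \<in> smooth_fns"
  using smooth_fns.add[of f "\<lambda>x. - g x"] smooth_fns_uminus by force

lemma smooth_fns_sum:
  "finite A \<Longrightarrow> (\<And>i. i \<in> A \<Longrightarrow> f i \<in> smooth_fns) \<Longrightarrow> (\<lambda>x. \<Sum>i\<in>A. f i x) \<in> smooth_fns"
  by (induction A rule: finite_induct) (auto intro: smooth_fns.intros)

lemma smooth_fns_has_derivative:
  fixes f :: "'a::real_inner \<Rightarrow> real"
  assumes "f \<in> smooth_fns"
  shows "\<exists>D. (\<forall>x. (f has_derivative D x) (at x)) \<and> (\<forall>v. (\<lambda>x. D x v) \<in> smooth_fns)"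
  using assms
proof (induction rule: smooth_fns.induct)
  case (const c)
  show ?case by (rule exI[of _ "\<lambda>_ _. 0"]) (auto intro: smooth_fns.const)
next
  case (inner b)
  show ?case
    by (rule exI[of _ "\<lambda>_ v. v \<bullet> b"]) (auto intro: smooth_fns.const intro!: derivative_eq_intros)
next
  case (add f g)
  then obtain D E where "\<And>x. (f has_derivative D x) (at x)" "\<And>v. (\<lambda>x. D x v) \<in> smooth_fns"
    "\<And>x. (g has_derivative E x) (at x)" "\<And>v. (\<lambda>x. E x v) \<in> smooth_fns" by blast
  then show ?case
    by (intro exI[of _ "\<lambda>x v. D x v + E x v"]) (auto intro!: smooth_fns.add derivative_eq_intros)
next
  case (mult f g)
  then obtain D E where "\<And>x. (f has_derivative D x) (at x)" "\<And>v. (\<lambda>x. D x v) \<in> smooth_fns"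
    "\<And>x. (g has_derivative E x) (at x)" "\<And>v. (\<lambda>x. E x v) \<in> smooth_fns" by blast
  with mult.hyps show ?case
    by (intro exI[of _ "\<lambda>x v. f x * E x v + D x v * g x"])
       (auto intro!: smooth_fns.add smooth_fns.mult derivative_eq_intros)
next
  case (flat f P)
  then obtain D where D: "\<And>x. (f has_derivative D x) (at x)" "\<And>v. (\<lambda>x. D x v) \<in> smooth_fns" by blast
  have "((\<lambda>x. flat P (f x)) has_derivative (\<lambda>v. flat (flat_pderiv P) (f x) * D x v)) (at x)" for x
    using has_derivative_compose[OF D(1) flat_has_field_derivative[unfolded has_field_derivative_def]]
    by simp
  with flat.hyps D show ?case
    by (intro exI[of _ "\<lambda>x v. flat (flat_pderiv P) (f x) * D x v"])
       (auto intro!: smooth_fns.mult smooth_fns.flat)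
next
  case (inverse f)
  then obtain D where D: "\<And>x. (f has_derivative D x) (at x)" "\<And>v. (\<lambda>x. D x v) \<in> smooth_fns" by blast
  with inverse.hyps show ?case
    by (intro exI[of _ "\<lambda>x v. - (inverse (f x) * D x v * inverse (f x))"])
       (auto intro!: smooth_fns_uminus smooth_fns.mult smooth_fns.inverse derivative_eq_intros)
qed

text \<open>\<open>frechet_derivative\<close> is a choice among all candidates for the derivative.
  Maps agreeing on \<open>E\<close> have the same candidates, hence the same choice, whether or not
  a derivative exists or is unique.\<close>

lemma frechet_derivative_within_cong:
  assumes "\<And>x. x \<in> E \<Longrightarrow> f x = g x" "p \<in> E"
  shows "frechet_derivative f (at p within E) = frechet_derivative g (at p within E)"
proof -
  have "(f has_derivative D) (at p within E) \<longleftrightarrow> (g has_derivative D) (at p within E)" for D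
    using assms has_derivative_transform[of p E f g D] has_derivative_transform[of p E g f D] by auto
  then show ?thesis by (simp add: frechet_derivative_def)
qed

text \<open>Induction on the list of directions: on \<open>E\<close> each iterated derivative
  coincides with a map whose coordinates lie in \<open>smooth_fns\<close>. Agreement is asserted on
  \<open>E\<close> alone because \<open>deriv_on\<close> differentiates within
  \<open>E\<close>.\<close>

lemma smooth_on_subspace_smooth_fns:
  fixes f :: "'a::euclidean_space \<Rightarrow> real ^ 'k::finite"
  assumes E: "subspace E" and f: "\<And>i. (\<lambda>x. f x $ i) \<in> smooth_fns"
  shows "smooth_on_subspace E f"
proof -
  have *: "\<exists>D. (\<forall>x. (F has_derivative D x) (at x)) \<and> (\<forall>v i. (\<lambda>x. D x v $ i) \<in> smooth_fns)"
    if F: "\<And>i. (\<lambda>x. F x $ i) \<in> smooth_fns" for F :: "'a \<Rightarrow> real ^ 'k"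
  proof -
    obtain D where D: "\<And>i x. ((\<lambda>x. F x $ i) has_derivative D i x) (at x)"
      "\<And>i v. (\<lambda>x. D i x v) \<in> smooth_fns"
      using smooth_fns_has_derivative[OF F] by metis
    have "(F has_derivative (\<lambda>v. \<chi> i. D i x v)) (at x)" for x
      by (subst has_derivative_componentwise_within)
         (auto simp: Basis_vec_def inner_axis intro: D)
    with D(2) show ?thesis by (intro exI[of _ "\<lambda>x v. \<chi> i. D i x v"]) auto
  qed
  have "\<exists>F. (\<forall>i. (\<lambda>x. F x $ i) \<in> smooth_fns) \<and> (\<forall>p\<in>E. deriv_on E f vs p = F p)"
    if "vs \<in> lists E" for vs
    using that
  proof (induction vs)
    case Nil
    then show ?case using f by (intro exI[of _ f]) auto
  next
    case (Cons v vs)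
    then obtain F where F: "\<And>i. (\<lambda>x. F x $ i) \<in> smooth_fns" "\<And>p. p \<in> E \<Longrightarrow> deriv_on E f vs p = F p"
      by auto
    from *[OF F(1)] obtain D where D: "\<And>x. (F has_derivative D x) (at x)"
      "\<And>v i. (\<lambda>x. D x v $ i) \<in> smooth_fns" by blast
    have "deriv_on E f (v # vs) p = D p v" if "p \<in> E" for p
      using frechet_derivative_within_cong[of E "deriv_on E f vs" F p] F(2) that Cons.hyps
        frechet_derivative_within_subspace[OF E that _ has_derivative_at_withinI[OF D(1)]]
      by auto
    with D(2) show ?case by (intro exI[of _ "\<lambda>x. D x v"]) auto
  qed note main = this
  show ?thesis
    unfolding smooth_on_subspace_def differentiable_on_def
  proof (intro ballI)
    fix vs p assume vs: "vs \<in> lists E" and p: "p \<in> E"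
    from main[OF vs] obtain F where F: "\<And>i. (\<lambda>x. F x $ i) \<in> smooth_fns"
      "\<And>p. p \<in> E \<Longrightarrow> deriv_on E f vs p = F p" by blast
    from *[OF F(1)] obtain D where "(F has_derivative D p) (at p)" by blast
    then have "(F has_derivative D p) (at p within E)" by (rule has_derivative_at_withinI)
    then have "(deriv_on E f vs has_derivative D p) (at p within E)"
      using F(2) p has_derivative_transform[of p E "deriv_on E f vs" F] by auto
    then show "deriv_on E f vs differentiable (at p within E)"
      by (auto simp: differentiable_def)
  qed
qed

text \<open>The usual smooth step built from the flat function: 1 up to \<open>a\<close>, 0 from
  \<open>b\<close> on. A one-sided step suffices because it is applied to \<lambda>^2 and to
  |x|^2.\<close>

definition bump :: "real \<Rightarrow> real \<Rightarrow> real \<Rightarrow> real" where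
  "bump a b r = flat 1 (b - r) * inverse (flat 1 (b - r) + flat 1 (r - a))"

lemma flat_1_nonneg: "flat 1 x \<ge> 0"
  by (simp add: flat_def)

lemma flat_1_pos: "flat 1 x > 0 \<longleftrightarrow> x > 0"
  by (simp add: flat_def)

lemma flat_1_eq_0: "x \<le> 0 \<Longrightarrow> flat 1 x = 0"
  by (simp add: flat_def)

lemma bump_denominator_pos:
  assumes "a < b"
  shows "flat 1 (b - r) + flat 1 (r - a) > 0"
proof -
  have "b - r > 0 \<or> r - a > 0" using assms by linarith
  then show ?thesis using flat_1_pos[of "b - r"] flat_1_pos[of "r - a"]
      flat_1_nonneg[of "b - r"] flat_1_nonneg[of "r - a"] by linarith
qed

lemma bump_bounds:
  assumes "a < b"
  shows "0 \<le> bump a b r" "bump a b r \<le> 1"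
  using bump_denominator_pos[OF assms, of r] flat_1_nonneg[of "b - r"] flat_1_nonneg[of "r - a"]
  by (auto simp: bump_def field_simps)

lemma bump_eq_1: "a < b \<Longrightarrow> r \<le> a \<Longrightarrow> bump a b r = 1"
  using bump_denominator_pos[of a b r] by (simp add: bump_def flat_1_eq_0)

lemma bump_eq_0: "b \<le> r \<Longrightarrow> bump a b r = 0"
  by (simp add: bump_def flat_1_eq_0)

lemma bump_smooth_fns:
  assumes "a < b" "f \<in> smooth_fns"
  shows "(\<lambda>x. bump a b (f x)) \<in> smooth_fns"
  unfolding bump_def using assms bump_denominator_pos[OF assms(1)]
  by (intro smooth_fns.mult smooth_fns.flat smooth_fns.inverse smooth_fns.add smooth_fns_diff
      smooth_fns.const) (auto simp: less_imp_neq[symmetric])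

lemma smooth_fns_continuous: "f \<in> smooth_fns \<Longrightarrow> continuous_on A f"
  by (metis smooth_fns_has_derivative has_derivative_continuous continuous_at_imp_continuous_on)

section \<open>Higher derivatives and the $C^2$ norm\<close>

lemma smooth_has_derivative:
  assumes "smooth_on_subspace E h" "vs \<in> lists E" "p \<in> E"
  shows "(deriv_on E h vs has_derivative (\<lambda>u. deriv_on E h (u # vs) p)) (at p within E)"
proof -
  have "deriv_on E h vs differentiable (at p within E)"
    using assms by (auto simp: smooth_on_subspace_def differentiable_on_def)
  then show ?thesis by (simp add: frechet_derivative_works)
qed

text \<open>Computation rule: the next derivative may be read off from any \<open>F\<close> that
  agrees with the previous one on \<open>E\<close>.\<close>

lemma deriv_on_Cons_eq:
  fixes h :: "'a::euclidean_space \<Rightarrow> 'b::real_normed_vector"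
  assumes "subspace E" "p \<in> E" "v \<in> E" "\<And>q. q \<in> E \<Longrightarrow> deriv_on E h vs q = F q"
    and "(F has_derivative F') (at p within E)"
  shows "deriv_on E h (v # vs) p = F' v"
  using frechet_derivative_within_cong[of E "deriv_on E h vs" F p]
    frechet_derivative_within_subspace[OF assms(1-3,5)] assms(2,4) by auto

lemma deriv_on_diff:
  fixes h :: "'a::euclidean_space \<Rightarrow> 'b::real_normed_vector"
  assumes E: "subspace E" and hg: "smooth_on_subspace E h" "smooth_on_subspace E g"
  shows "vs \<in> lists E \<Longrightarrow> p \<in> E \<Longrightarrow>
    deriv_on E (\<lambda>p. h p - g p) vs p = deriv_on E h vs p - deriv_on E g vs p"
proof (induction vs arbitrary: p)
  case (Cons v vs)
  show ?case
    using Cons by (intro deriv_on_Cons_eq[OF E _ _ Cons.IH])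
      (auto intro!: has_derivative_diff smooth_has_derivative hg simp del: deriv_on.simps)
qed simp

lemma smooth_on_subspace_diff:
  fixes h :: "'a::euclidean_space \<Rightarrow> 'b::real_normed_vector"
  assumes E: "subspace E" and hg: "smooth_on_subspace E h" "smooth_on_subspace E g"
  shows "smooth_on_subspace E (\<lambda>p. h p - g p)"
  unfolding smooth_on_subspace_def differentiable_on_def
proof (intro ballI)
  fix vs p assume *: "vs \<in> lists E" "p \<in> E"
  have "((\<lambda>p. deriv_on E h vs p - deriv_on E g vs p) has_derivative
      (\<lambda>u. deriv_on E h (u # vs) p - deriv_on E g (u # vs) p)) (at p within E)"
    using * hg by (intro has_derivative_diff smooth_has_derivative)
  from has_derivative_transform[OF *(2) _ this] show
    "deriv_on E (\<lambda>p. h p - g p) vs differentiable (at p within E)"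
    using deriv_on_diff[OF E hg *(1)] by (auto simp: differentiable_def)
qed

lemma deriv_on_scaleR:
  fixes h :: "'a::euclidean_space \<Rightarrow> 'b::real_normed_vector"
  assumes E: "subspace E" and h: "smooth_on_subspace E h"
  shows "vs \<in> lists E \<Longrightarrow> p \<in> E \<Longrightarrow> deriv_on E (\<lambda>p. c *\<^sub>R h p) vs p = c *\<^sub>R deriv_on E h vs p"
proof (induction vs arbitrary: p)
  case (Cons v vs)
  show ?case
    using Cons by (intro deriv_on_Cons_eq[OF E _ _ Cons.IH])
      (auto intro!: has_derivative_scaleR_right smooth_has_derivative h simp del: deriv_on.simps)
qed simp

lemma deriv_on_local_cong:
  fixes h :: "'a::euclidean_space \<Rightarrow> 'b::real_normed_vector"
  assumes U: "open U" and eq: "\<And>p. p \<in> E \<Longrightarrow> p \<in> U \<Longrightarrow> h p = g p"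
  shows "p \<in> E \<Longrightarrow> p \<in> U \<Longrightarrow> deriv_on E h vs p = deriv_on E g vs p"
proof (induction vs arbitrary: p)
  case (Cons v vs)
  obtain d where d: "d > 0" "ball p d \<subseteq> U" using U Cons.prems by (auto simp: open_contains_ball)
  have "(deriv_on E h vs has_derivative D) (at p within E) \<longleftrightarrow>
      (deriv_on E g vs has_derivative D) (at p within E)" for D
    using has_derivative_transform_within[OF _ d(1) Cons.prems(1), of _ D] d(2) Cons.IH
    by (smt (verit) dist_commute mem_ball subsetD)
  then show ?case by (simp add: frechet_derivative_def)
qed (simp add: eq)

lemma bounded_linear_deriv_on:
  assumes "smooth_on_subspace E h" "vs \<in> lists E" "p \<in> E"
  shows "bounded_linear (\<lambda>u. deriv_on E h (u # vs) p)"
  using smooth_has_derivative[OF assms] by (rule has_derivative_bounded_linear)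

text \<open>The head of the list is the outermost differentiation, so linearity there is that of a
  derivative. Linearity in the inner direction comes from differentiating the identity that
  expresses linearity of the first derivative; symmetry of second derivatives is avoided.\<close>

lemma deriv_on_2_sum:
  fixes h :: "'a::euclidean_space \<Rightarrow> 'b::real_normed_vector"
  assumes E: "subspace E" and h: "smooth_on_subspace E h" and p: "p \<in> E" and u: "u \<in> E"
    and B: "finite B" "B \<subseteq> E"
  shows "deriv_on E h [u, \<Sum>b\<in>B. c b *\<^sub>R b] p = (\<Sum>b\<in>B. c b *\<^sub>R deriv_on E h [u, b] p)"
proof (rule deriv_on_Cons_eq[OF E p u])
  show "deriv_on E h [\<Sum>b\<in>B. c b *\<^sub>R b] q = (\<Sum>b\<in>B. c b *\<^sub>R deriv_on E h [b] q)" if "q \<in> E" for q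
  proof -
    interpret bounded_linear "\<lambda>u. deriv_on E h [u] q"
      using bounded_linear_deriv_on[OF h, of "[]"] that by simp
    show ?thesis by (simp add: sum scale del: deriv_on.simps)
  qed
  show "((\<lambda>q. \<Sum>b\<in>B. c b *\<^sub>R deriv_on E h [b] q) has_derivative
      (\<lambda>u. \<Sum>b\<in>B. c b *\<^sub>R deriv_on E h [u, b] p)) (at p within E)"
    using B by (intro has_derivative_sum has_derivative_scaleR_right smooth_has_derivative[OF h _ p]) auto
qed

lemma deriv_on_2_scaleR:
  fixes h :: "'a::euclidean_space \<Rightarrow> 'b::real_normed_vector"
  assumes "subspace E" "smooth_on_subspace E h" "p \<in> E" "u \<in> E" "v \<in> E"
  shows "deriv_on E h [u, a *\<^sub>R v] p = a *\<^sub>R deriv_on E h [u, v] p"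
  using deriv_on_2_sum[OF assms(1-4), of "{v}" "\<lambda>_. a"] assms(5) by simp

lemma deriv_on_scaleR_arg:
  fixes h :: "'a::euclidean_space \<Rightarrow> 'b::real_normed_vector"
  assumes "smooth_on_subspace E h" "vs \<in> lists E" "p \<in> E"
  shows "deriv_on E h (a *\<^sub>R v # vs) p = a *\<^sub>R deriv_on E h (v # vs) p"
proof -
  interpret bounded_linear "\<lambda>u. deriv_on E h (u # vs) p" by (rule bounded_linear_deriv_on[OF assms])
  show ?thesis by (rule scale)
qed

lemma subspace_orthonormal_expansion:
  fixes E :: "'a::euclidean_space set"
  assumes "subspace E"
  obtains B where "finite B" "B \<subseteq> E" "\<And>b. b \<in> B \<Longrightarrow> norm b = 1"
    "\<And>v. v \<in> E \<Longrightarrow> (\<Sum>b\<in>B. (v \<bullet> b) *\<^sub>R b) = v"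
proof -
  obtain B where B: "B \<subseteq> E" "pairwise orthogonal B" "\<And>x. x \<in> B \<Longrightarrow> norm x = 1"
    "independent B" "span B = E"
    using orthonormal_basis_subspace[OF assms] by metis
  have "finite B" using B(4) independent_imp_finite by blast
  then show thesis
    using that[of B] B orthonormal_basis_expand[of B] by auto
qed

text \<open>Expanding the directions in an orthonormal basis bounds every derivative by a finite sum
  of continuous functions, which is bounded on a compact set. The bound is what makes the
  real-valued suprema in \<open>C2_norm\<close> meaningful.\<close>

lemma deriv_on_bounded:
  fixes h :: "'a::euclidean_space \<Rightarrow> 'b::real_normed_vector"
  assumes E: "subspace E" and h: "smooth_on_subspace E h" and K: "compact K" "K \<subseteq> E"
  obtains M where "\<And>p vs. p \<in> K \<Longrightarrow> vs \<in> lists E \<Longrightarrow> length vs \<le> 2 \<Longrightarrow>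
    (\<And>v. v \<in> set vs \<Longrightarrow> norm v \<le> 1) \<Longrightarrow> norm (deriv_on E h vs p) \<le> M"
proof -
  obtain B where B: "finite B" "B \<subseteq> E" "\<And>b. b \<in> B \<Longrightarrow> norm b = 1"
    "\<And>v. v \<in> E \<Longrightarrow> (\<Sum>b\<in>B. (v \<bullet> b) *\<^sub>R b) = v"
    using subspace_orthonormal_expansion[OF E] by metis
  define F where "F p = norm (h p) + (\<Sum>b\<in>B. norm (deriv_on E h [b] p)) +
    (\<Sum>b\<in>B. \<Sum>c\<in>B. norm (deriv_on E h [c, b] p))" for p
  have cont: "continuous_on K (deriv_on E h vs)" if "vs \<in> lists E" for vs
    using h that K(2) unfolding smooth_on_subspace_def
    by (meson continuous_on_subset differentiable_imp_continuous_on)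
  have "continuous_on K F"
    unfolding F_def using B(2) cont[of "[]"]
    by (intro continuous_intros cont) (auto simp del: deriv_on.simps(2))
  then have "bounded (F ` K)" by (intro compact_imp_bounded compact_continuous_image K)
  then obtain M where M: "\<And>p. p \<in> K \<Longrightarrow> F p \<le> M"
    unfolding bounded_iff by (force simp: abs_le_iff)
  have inner_le: "\<bar>v \<bullet> b\<bar> \<le> 1" if "b \<in> B" "norm v \<le> 1" for v b
    using Cauchy_Schwarz_ineq2[of v b] B(3)[OF that(1)] that(2) by simp
  show thesis
  proof (rule that)
    fix p vs assume p: "p \<in> K" and vs: "vs \<in> lists E" "length vs \<le> 2" "\<And>v. v \<in> set vs \<Longrightarrow> norm v \<le> 1"
    have pE: "p \<in> E" using p K(2) by blast
    have nn: "0 \<le> (\<Sum>b\<in>B. norm (deriv_on E h [b] p))" "0 \<le> (\<Sum>b\<in>B. \<Sum>c\<in>B. norm (deriv_on E h [c, b] p))"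
      by (intro sum_nonneg norm_ge_zero)+
    have lin: "norm (deriv_on E h (v # ws) p) \<le> (\<Sum>b\<in>B. norm (deriv_on E h (b # ws) p))"
      if v: "v \<in> E" "norm v \<le> 1" and ws: "ws \<in> lists E" for v ws
    proof -
      interpret bounded_linear "\<lambda>u. deriv_on E h (u # ws) p" by (rule bounded_linear_deriv_on[OF h ws pE])
      have "deriv_on E h (v # ws) p = deriv_on E h ((\<Sum>b\<in>B. (v \<bullet> b) *\<^sub>R b) # ws) p"
        using B(4)[OF v(1)] by simp
      also have "\<dots> = (\<Sum>b\<in>B. (v \<bullet> b) *\<^sub>R deriv_on E h (b # ws) p)"
        by (simp add: sum scale del: deriv_on.simps)
      also have "norm \<dots> \<le> (\<Sum>b\<in>B. norm (deriv_on E h (b # ws) p))"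
        using inner_le[OF _ v(2)] by (intro sum_norm_le) (auto intro!: mult_left_le_one_le simp del: deriv_on.simps)
      finally show ?thesis .
    qed
    consider "vs = []" | u where "vs = [u]" | u v where "vs = [u, v]"
      using vs(2) by (cases vs; cases "tl vs") (auto simp: Suc_le_eq numeral_2_eq_2)
    then have "norm (deriv_on E h vs p) \<le> F p"
    proof cases
      case 1
      then show ?thesis using nn unfolding F_def by (simp del: deriv_on.simps(2))
    next
      case 2
      then have "norm (deriv_on E h vs p) \<le> (\<Sum>b\<in>B. norm (deriv_on E h [b] p))"
        using lin[of u "[]"] vs by (simp del: deriv_on.simps(2))
      then show ?thesis using nn norm_ge_zero[of "h p"] unfolding F_def by linarith
    next
      case 3
      have uv: "u \<in> E" "v \<in> E" "norm u \<le> 1" "norm v \<le> 1" using vs 3 by auto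
      have "deriv_on E h [u, v] p = deriv_on E h [u, \<Sum>b\<in>B. (v \<bullet> b) *\<^sub>R b] p"
        using B(4)[OF uv(2)] by simp
      also have "\<dots> = (\<Sum>b\<in>B. (v \<bullet> b) *\<^sub>R deriv_on E h [u, b] p)"
        by (rule deriv_on_2_sum[OF E h pE uv(1) B(1,2)])
      also have "norm \<dots> \<le> (\<Sum>b\<in>B. \<Sum>c\<in>B. norm (deriv_on E h [c, b] p))"
      proof (rule sum_norm_le)
        fix b assume b: "b \<in> B"
        have "norm ((v \<bullet> b) *\<^sub>R deriv_on E h [u, b] p) \<le> norm (deriv_on E h [u, b] p)"
          using inner_le[OF b uv(4)] by (auto intro!: mult_left_le_one_le simp del: deriv_on.simps)
        also have "\<dots> \<le> (\<Sum>c\<in>B. norm (deriv_on E h [c, b] p))"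
          using lin[of u "[b]"] uv b B(2) by auto
        finally show "norm ((v \<bullet> b) *\<^sub>R deriv_on E h [u, b] p) \<le> (\<Sum>c\<in>B. norm (deriv_on E h [c, b] p))" .
      qed
      finally show ?thesis using nn norm_ge_zero[of "h p"] unfolding F_def 3 by linarith
    qed
    with M[OF p] show "norm (deriv_on E h vs p) \<le> M" by simp
  qed
qed

text \<open>Mean value inequality along the segment from \<open>q\<close> to \<open>p\<close>, which
  stays in the subspace.\<close>

lemma deriv_on_lipschitz:
  fixes h :: "'a::euclidean_space \<Rightarrow> 'b::real_normed_vector"
  assumes E: "subspace E" and h: "smooth_on_subspace E h" and vs: "vs \<in> lists E"
    and B: "\<And>p u. p \<in> E \<Longrightarrow> u \<in> E \<Longrightarrow> norm (deriv_on E h (u # vs) p) \<le> B * norm u"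
    and pq: "p \<in> E" "q \<in> E"
  shows "norm (deriv_on E h vs p - deriv_on E h vs q) \<le> B * norm (p - q)"
proof -
  define \<phi> where "\<phi> t = q + t *\<^sub>R (p - q)" for t :: real
  have \<phi>: "\<phi> t \<in> E" for t
    unfolding \<phi>_def using E pq by (intro subspace_add subspace_scale subspace_diff)
  have der: "((\<lambda>t. deriv_on E h vs (\<phi> t)) has_derivative
      (\<lambda>t'. deriv_on E h (t' *\<^sub>R (p - q) # vs) (\<phi> t))) (at t within {0..1})" for t
  proof -
    have line: "(\<phi> has_derivative (\<lambda>t. t *\<^sub>R (p - q))) (at t within {0..1})"
      unfolding \<phi>_def by (auto intro!: derivative_eq_intros)
    have "(deriv_on E h vs has_derivative (\<lambda>u. deriv_on E h (u # vs) (\<phi> t))) (at (\<phi> t) within \<phi> ` {0..1})"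
      using smooth_has_derivative[OF h vs \<phi>] by (rule has_derivative_subset) (use \<phi> in auto)
    from has_derivative_in_compose[OF line this] show ?thesis .
  qed
  have "onorm (\<lambda>t'. deriv_on E h (t' *\<^sub>R (p - q) # vs) (\<phi> t)) \<le> B * norm (p - q)" for t
  proof (rule onorm_le)
    fix x :: real
    show "norm (deriv_on E h (x *\<^sub>R (p - q) # vs) (\<phi> t)) \<le> B * norm (p - q) * norm x"
      using B[OF \<phi>, of "x *\<^sub>R (p - q)" t] E pq
      by (simp add: subspace_scale subspace_diff mult.commute mult.left_commute del: deriv_on.simps)
  qed
  from differentiable_bound[OF convex_real_interval(5) der this, of 1 0 ]
  show ?thesis by (simp add: \<phi>_def del: deriv_on.simps)
qed

section \<open>The spaces H and HR and estimates for the C2 norm\<close>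

lemma subspace_H: "subspace H"
  by (auto simp: H_def subspace_def sum.distrib simp flip: sum_distrib_left)

lemma subspace_HR: "subspace HR"
  using subspace_H unfolding HR_def by (auto simp: subspace_def zero_prod_def)

lemma closed_H: "closed H"
  by (rule closed_subspace[OF subspace_H])

lemma closed_HR: "closed HR"
  by (rule closed_subspace[OF subspace_HR])

lemma HR_iff: "(x, lam) \<in> HR \<longleftrightarrow> x \<in> H"
  by (simp add: HR_def)

lemma C2_norm_le:
  fixes e :: "(real ^ 'k::finite) \<times> real \<Rightarrow> real ^ 'k"
  assumes K: "K \<noteq> {}"
    and M: "\<And>p vs. p \<in> K \<Longrightarrow> vs \<in> lists HR \<Longrightarrow> length vs \<le> 2 \<Longrightarrow>
      (\<And>v. v \<in> set vs \<Longrightarrow> norm v \<le> 1) \<Longrightarrow> norm (deriv_on HR e vs p) \<le> M"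
  shows "C2_norm K e \<le> M"
proof -
  have "multilinear_norm HR s (\<lambda>vs. deriv_on HR e vs p) \<le> M" if "p \<in> K" "s \<le> 2" for p s
    unfolding multilinear_norm_def
  proof (rule cSUP_least)
    have "replicate s 0 \<in> {vs. length vs = s \<and> (\<forall>v\<in>set vs. v \<in> (HR :: ((real ^ 'k) \<times> real) set) \<and> norm v \<le> 1)}"
      using subspace_0[OF subspace_HR] by auto
    then show "{vs. length vs = s \<and> (\<forall>v\<in>set vs. v \<in> (HR :: ((real ^ 'k) \<times> real) set) \<and> norm v \<le> 1)} \<noteq> {}"
      by blast
  qed (use that in \<open>auto intro!: M\<close>)
  then have "(SUP p\<in>K. multilinear_norm HR s (\<lambda>vs. deriv_on HR e vs p)) \<le> M" if "s \<le> 2" for s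
    using that K by (intro cSUP_least) auto
  then show ?thesis unfolding C2_norm_def by (subst Max_le_iff) auto
qed

lemma norm_deriv_le_C2_norm:
  fixes e :: "(real ^ 'k::finite) \<times> real \<Rightarrow> real ^ 'k"
  assumes e: "smooth_on_subspace HR e" and K: "compact K" "K \<subseteq> HR" "p \<in> K"
    and vs: "vs \<in> lists HR" "length vs \<le> 2" "\<And>v. v \<in> set vs \<Longrightarrow> norm v \<le> 1"
  shows "norm (deriv_on HR e vs p) \<le> C2_norm K e"
proof -
  obtain M where M: "\<And>p vs. p \<in> K \<Longrightarrow> vs \<in> lists HR \<Longrightarrow> length vs \<le> 2 \<Longrightarrow>
    (\<And>v. v \<in> set vs \<Longrightarrow> norm v \<le> 1) \<Longrightarrow> norm (deriv_on HR e vs p) \<le> M"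
    using deriv_on_bounded[OF subspace_HR e K(1,2)] by metis
  define s where "s = length vs"
  let ?V = "{vs. length vs = s \<and> (\<forall>v\<in>set vs. v \<in> (HR :: ((real ^ 'k) \<times> real) set) \<and> norm v \<le> 1)}"
  have "norm (deriv_on HR e vs p) \<le> multilinear_norm HR s (\<lambda>vs. deriv_on HR e vs p)"
    unfolding multilinear_norm_def
  proof (rule cSUP_upper)
    show "bdd_above ((\<lambda>vs. norm (deriv_on HR e vs p)) ` ?V)"
      using vs(2) by (intro bdd_aboveI2[of _ _ M] M K(3)) (auto simp: s_def)
  qed (use vs in \<open>auto simp: s_def\<close>)
  also have "\<dots> \<le> (SUP p\<in>K. multilinear_norm HR s (\<lambda>vs. deriv_on HR e vs p))"
  proof (rule cSUP_upper[OF K(3)])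
    have "multilinear_norm HR s (\<lambda>vs. deriv_on HR e vs q) \<le> M" if "q \<in> K" for q
      unfolding multilinear_norm_def
    proof (rule cSUP_least)
      have "replicate s 0 \<in> ?V" using subspace_0[OF subspace_HR] by auto
      then show "?V \<noteq> {}" by blast
    qed (use that vs(2) in \<open>auto simp: s_def intro!: M\<close>)
    then show "bdd_above ((\<lambda>p. multilinear_norm HR s (\<lambda>vs. deriv_on HR e vs p)) ` K)"
      by (intro bdd_aboveI2[of _ _ M]) auto
  qed
  also have "\<dots> \<le> C2_norm K e"
    unfolding C2_norm_def using vs(2) by (intro Max_ge) (auto simp: s_def)
  finally show ?thesis .
qed

section \<open>Slice and parameter derivatives as directional derivatives on HR\<close>

lemma linearization_eq_deriv_on:
  fixes h :: "(real ^ 'k::finite) \<times> real \<Rightarrow> real ^ 'k"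
  assumes h: "smooth_on_subspace HR h" and x: "x \<in> H" and u: "u \<in> H"
  shows "linearization h (x, lam) u = deriv_on HR h [(u, 0)] (x, lam)"
proof -
  have 1: "((\<lambda>y. (y, lam)) has_derivative (\<lambda>u. (u, 0))) (at x within H)"
    by (auto intro!: derivative_eq_intros)
  have "(h has_derivative (\<lambda>u. deriv_on HR h [u] (x, lam))) (at (x, lam) within (\<lambda>y. (y, lam)) ` H)"
    using smooth_has_derivative[OF h, of "[]" "(x, lam)"] x
    by (auto simp: HR_def simp del: deriv_on.simps(2) intro: has_derivative_subset)
  from has_derivative_in_compose[OF 1 this]
  have "((\<lambda>y. h (y, lam)) has_derivative (\<lambda>u. deriv_on HR h [(u, 0)] (x, lam))) (at x within H)" .
  from frechet_derivative_within_subspace[OF subspace_H x u this] show ?thesis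
    by (simp add: linearization_def)
qed

lemma deriv_on_H_2:
  fixes h :: "(real ^ 'k::finite) \<times> real \<Rightarrow> real ^ 'k"
  assumes h: "smooth_on_subspace HR h" and x: "x \<in> H" and uv: "u \<in> H" "v \<in> H"
  shows "deriv_on H (\<lambda>y. h (y, lam)) [u, v] x = deriv_on HR h [(u, 0), (v, 0)] (x, lam)"
proof (rule deriv_on_Cons_eq[OF subspace_H x uv(1)])
  show "deriv_on H (\<lambda>y. h (y, lam)) [v] q = deriv_on HR h [(v, 0)] (q, lam)" if "q \<in> H" for q
    using linearization_eq_deriv_on[OF h that uv(2)] by (simp add: linearization_def)
  have 1: "((\<lambda>y. (y, lam)) has_derivative (\<lambda>u. (u, 0))) (at x within H)"
    by (auto intro!: derivative_eq_intros)
  have "(deriv_on HR h [(v, 0)] has_derivative (\<lambda>u. deriv_on HR h [u, (v, 0)] (x, lam)))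
      (at (x, lam) within (\<lambda>y. (y, lam)) ` H)"
    using smooth_has_derivative[OF h, of "[(v, 0)]" "(x, lam)"] x uv
    by (auto simp: HR_def simp del: deriv_on.simps(2) intro: has_derivative_subset)
  from has_derivative_in_compose[OF 1 this]
  show "((\<lambda>q. deriv_on HR h [(v, 0)] (q, lam)) has_derivative
      (\<lambda>u. deriv_on HR h [(u, 0), (v, 0)] (x, lam))) (at x within H)" .
qed

lemma vector_derivative_param:
  fixes h :: "(real ^ 'k::finite) \<times> real \<Rightarrow> real ^ 'k"
  assumes h: "smooth_on_subspace HR h" and x: "x \<in> H"
  shows "vector_derivative (\<lambda>\<mu>. h (x, \<mu>)) (at lam) = deriv_on HR h [(0, 1)] (x, lam)"
proof (rule vector_derivative_at)
  have 1: "((\<lambda>\<mu>. (x, \<mu>)) has_derivative (\<lambda>u. (0, u))) (at lam)"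
    by (auto intro!: derivative_eq_intros)
  have "(h has_derivative (\<lambda>u. deriv_on HR h [u] (x, lam))) (at (x, lam) within range (\<lambda>\<mu>. (x, \<mu>)))"
    using smooth_has_derivative[OF h, of "[]" "(x, lam)"] x
    by (auto simp: HR_def simp del: deriv_on.simps(2) intro: has_derivative_subset)
  from has_derivative_in_compose[OF 1 this]
  have der: "((\<lambda>\<mu>. h (x, \<mu>)) has_derivative (\<lambda>u. deriv_on HR h [(0, u)] (x, lam))) (at lam)" .
  have eq: "(\<lambda>u. deriv_on HR h [(0, u)] (x, lam)) = (\<lambda>u. u *\<^sub>R deriv_on HR h [(0, 1)] (x, lam))"
  proof (rule ext)
    fix u :: real
    show "deriv_on HR h [(0, u)] (x, lam) = u *\<^sub>R deriv_on HR h [(0, 1)] (x, lam)"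
      using deriv_on_scaleR_arg[OF h, of "[]" "(x, lam)" u "(0, 1)"] x
      by (simp add: HR_def del: deriv_on.simps)
  qed
  show "((\<lambda>\<mu>. h (x, \<mu>)) has_vector_derivative deriv_on HR h [(0, 1)] (x, lam)) (at lam)"
    unfolding has_vector_derivative_def by (rule der[unfolded eq])
qed

text \<open>The coordinate sum of a family with values in \<open>H\<close> vanishes identically on
  \<open>HR\<close>, and therefore so do all its derivatives.\<close>

lemma deriv_on_in_H:
  fixes h :: "(real ^ 'k::finite) \<times> real \<Rightarrow> real ^ 'k"
  assumes "smooth_family h" "vs \<in> lists HR" "p \<in> HR"
  shows "deriv_on HR h vs p \<in> H"
  using assms(2,3)
proof (induction vs arbitrary: p rule: list.induct)
  case Nil
  then show ?case using assms(1) by (auto simp: smooth_family_def)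
next
  case (Cons v vs)
  have h: "smooth_on_subspace HR h" using assms(1) by (simp add: smooth_family_def)
  let ?s = "\<lambda>x :: real ^ 'k. \<Sum>i\<in>UNIV. x $ i"
  have "bounded_linear ?s" by (intro bounded_linear_sum bounded_linear_vec_nth)
  from bounded_linear.has_derivative[OF this smooth_has_derivative[OF h, of vs p]]
  have "((\<lambda>q. ?s (deriv_on HR h vs q)) has_derivative (\<lambda>u. ?s (deriv_on HR h (u # vs) p))) (at p within HR)"
    using Cons by auto
  from has_derivative_transform[OF Cons.prems(2) _ this, of "\<lambda>_. 0"]
  have "((\<lambda>_. 0) has_derivative (\<lambda>u. ?s (deriv_on HR h (u # vs) p))) (at p within HR)"
    using Cons by (auto simp: H_def)
  from frechet_derivative_within_subspace[OF subspace_HR Cons.prems(2) _ this, of v]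
    frechet_derivative_within_subspace[OF subspace_HR Cons.prems(2) _ has_derivative_const, of v "0 :: real"]
  have "?s (deriv_on HR h (v # vs) p) = 0" using Cons.prems by simp
  then show ?case by (simp add: H_def del: deriv_on.simps)
qed

section \<open>Eigenvalues and index\<close>

definition re_part :: "complex ^ 'k \<Rightarrow> real ^ 'k" where "re_part w = (\<chi> j. Re (w $ j))"
definition im_part :: "complex ^ 'k \<Rightarrow> real ^ 'k" where "im_part w = (\<chi> j. Im (w $ j))"
definition of_parts :: "real ^ 'k \<Rightarrow> real ^ 'k \<Rightarrow> complex ^ 'k" where
  "of_parts a b = (\<chi> j. Complex (a $ j) (b $ j))"

lemma parts_of_parts [simp]: "re_part (of_parts a b) = a" "im_part (of_parts a b) = b"
  by (simp_all add: re_part_def im_part_def of_parts_def vec_eq_iff)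

lemma of_parts_parts [simp]: "of_parts (re_part w) (im_part w) = w"
  by (simp add: re_part_def im_part_def of_parts_def vec_eq_iff)

lemma parts_eq_iff: "w = z \<longleftrightarrow> re_part w = re_part z \<and> im_part w = im_part z"
  by (metis of_parts_parts)

lemma parts_eq_0_iff: "w = 0 \<longleftrightarrow> re_part w = 0 \<and> im_part w = 0"
  by (auto simp: re_part_def im_part_def vec_eq_iff complex_eq_iff)

lemma HC_iff: "w \<in> HC \<longleftrightarrow> re_part w \<in> H \<and> im_part w \<in> H"
  by (auto simp: HC_def H_def re_part_def im_part_def complex_eq_iff)

lemma complexify_alt: "complexify A w = of_parts (A (re_part w)) (A (im_part w))"
  by (simp add: complexify_def of_parts_def re_part_def im_part_def)

lemma scale_parts:
  "re_part (\<mu> *s w) = Re \<mu> *\<^sub>R re_part w - Im \<mu> *\<^sub>R im_part w"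
  "im_part (\<mu> *s w) = Im \<mu> *\<^sub>R re_part w + Re \<mu> *\<^sub>R im_part w"
  by (simp_all add: re_part_def im_part_def vec_eq_iff)

text \<open>Real and imaginary parts of the complex eigenvector equation for the eigenvalue
  i\<beta>. The value \<beta> = 0 is included, so non-hyperbolicity becomes one real
  condition.\<close>

lemma imaginary_eigenvalue_iff:
  "(\<exists>\<mu>\<in>eigenvalues A. Re \<mu> = 0 \<and> Im \<mu> = \<beta>) \<longleftrightarrow>
   (\<exists>a\<in>H. \<exists>b\<in>H. (a \<noteq> 0 \<or> b \<noteq> 0) \<and> A a = - (\<beta> *\<^sub>R b) \<and> A b = \<beta> *\<^sub>R a)"
proof
  assume "\<exists>\<mu>\<in>eigenvalues A. Re \<mu> = 0 \<and> Im \<mu> = \<beta>"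
  then obtain \<mu> w where *: "w \<in> HC" "w \<noteq> 0" "complexify A w = \<mu> *s w" "Re \<mu> = 0" "Im \<mu> = \<beta>"
    by (auto simp: eigenvalues_def)
  then show "\<exists>a\<in>H. \<exists>b\<in>H. (a \<noteq> 0 \<or> b \<noteq> 0) \<and> A a = - (\<beta> *\<^sub>R b) \<and> A b = \<beta> *\<^sub>R a"
    by (intro bexI[of _ "re_part w"] bexI[of _ "im_part w"])
       (auto simp: complexify_alt parts_eq_iff[of _ "\<mu> *s w"] scale_parts parts_eq_0_iff HC_iff)
next
  assume "\<exists>a\<in>H. \<exists>b\<in>H. (a \<noteq> 0 \<or> b \<noteq> 0) \<and> A a = - (\<beta> *\<^sub>R b) \<and> A b = \<beta> *\<^sub>R a"
  then obtain a b where *: "a \<in> H" "b \<in> H" "a \<noteq> 0 \<or> b \<noteq> 0" "A a = - (\<beta> *\<^sub>R b)" "A b = \<beta> *\<^sub>R a"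
    by blast
  have "of_parts a b \<in> HC" "of_parts a b \<noteq> 0"
    "complexify A (of_parts a b) = Complex 0 \<beta> *s of_parts a b"
    using * by (auto simp: complexify_alt parts_eq_iff[of _ "Complex 0 \<beta> *s of_parts a b"] scale_parts
        parts_eq_0_iff HC_iff)
  then show "\<exists>\<mu>\<in>eigenvalues A. Re \<mu> = 0 \<and> Im \<mu> = \<beta>"
    by (intro bexI[of _ "Complex 0 \<beta>"]) (auto simp: eigenvalues_def)
qed

lemma eigenvalue_0_iff:
  assumes "linear A"
  shows "0 \<in> eigenvalues A \<longleftrightarrow> (\<exists>u\<in>H. u \<noteq> 0 \<and> A u = 0)"
proof -
  have "0 \<in> eigenvalues A \<longleftrightarrow> (\<exists>\<mu>\<in>eigenvalues A. Re \<mu> = 0 \<and> Im \<mu> = 0)"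
    by (metis complex_eq_iff zero_complex.sel)
  also have "\<dots> \<longleftrightarrow> (\<exists>u\<in>H. u \<noteq> 0 \<and> A u = 0)"
    unfolding imaginary_eigenvalue_iff using subspace_0[OF subspace_H] linear_0[OF assms] by fastforce
  finally show ?thesis .
qed

text \<open>Symmetry, applied to the pair \<open>a\<close>, \<open>b\<close>, reads \<beta> (|a|^2 +
  |b|^2) = 0.\<close>

lemma symmetric_imaginary_eigenvalue:
  assumes sym: "\<And>u v. u \<in> H \<Longrightarrow> v \<in> H \<Longrightarrow> u \<bullet> A v = A u \<bullet> v"
    and ab: "a \<in> H" "b \<in> H" "A a = - (\<beta> *\<^sub>R b)" "A b = \<beta> *\<^sub>R a"
  shows "A a = 0 \<and> A b = 0"
proof -
  have "a \<bullet> A b = A a \<bullet> b" using sym ab by blast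
  then have "\<beta> * (a \<bullet> a + b \<bullet> b) = 0" by (simp add: ab(3,4) algebra_simps)
  then have "\<beta> = 0 \<or> a \<bullet> a + b \<bullet> b = 0" by simp
  then show ?thesis
  proof
    assume "a \<bullet> a + b \<bullet> b = 0"
    then have "a = 0 \<and> b = 0"
      by (metis add_nonneg_eq_0_iff inner_eq_zero_iff inner_ge_zero)
    then show ?thesis using ab by simp
  qed (use ab in simp)
qed

text \<open>Since the kernel is spanned by \<open>v\<close> and \<open>v\<close> is not in the
  range, no Jordan chain of length 2 exists. The generalised eigenspace is then the complex line
  through \<open>v\<close>.\<close>

lemma alg_mult_0_eq_1:
  fixes A :: "real ^ 'k::finite \<Rightarrow> real ^ 'k"
  assumes A: "linear A" "\<And>u. u \<in> H \<Longrightarrow> A u \<in> H"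
    and v: "v \<in> H" "v \<noteq> 0" "A v = 0"
    and ker: "\<And>u. u \<in> H \<Longrightarrow> A u = 0 \<Longrightarrow> \<exists>c. u = c *\<^sub>R v"
    and ran: "\<And>u. u \<in> H \<Longrightarrow> A u \<noteq> v"
  shows "alg_mult A 0 = 1"
proof -
  have ran': "A u = 0" if "u \<in> H" "A u = c *\<^sub>R v" for u c
  proof (rule ccontr)
    assume "A u \<noteq> 0"
    then have "A ((1 / c) *\<^sub>R u) = v" using that by (auto simp: linear_scale[OF A(1)])
    then show False using ran[of "(1 / c) *\<^sub>R u"] that(1) subspace_scale[OF subspace_H] by blast
  qed
  have iter: "A u = 0" if "u \<in> H" "(A ^^ n) u = 0" for n u
    using that
  proof (induction n arbitrary: u)
    case 0
    then show ?case by (simp add: linear_0[OF A(1)])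
  next
    case (Suc n)
    then have "A (A u) = 0" by (simp add: A(2) funpow_swap1)
    with ker[of "A u"] A(2) Suc.prems obtain c where "A u = c *\<^sub>R v" by blast
    with ran' Suc.prems show ?case by blast
  qed
  have 0: "(\<lambda>u. complexify A u - 0 *s u) = complexify A" by simp
  have parts: "re_part ((complexify A ^^ n) w) = (A ^^ n) (re_part w)"
    "im_part ((complexify A ^^ n) w) = (A ^^ n) (im_part w)" for n w
    by (induction n) (simp_all add: complexify_alt)
  have "{w \<in> HC. \<exists>n. (complexify A ^^ n) w = 0} = vec.span {of_parts v 0}"
  proof (intro equalityI subsetI)
    fix w assume "w \<in> {w \<in> HC. \<exists>n. (complexify A ^^ n) w = 0}"
    then have "re_part w \<in> H" "im_part w \<in> H" "A (re_part w) = 0" "A (im_part w) = 0"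
      by (auto simp: HC_iff parts_eq_0_iff parts intro: iter)
    with ker obtain c d where "re_part w = c *\<^sub>R v" "im_part w = d *\<^sub>R v" by metis
    then have "w = Complex c d *s of_parts v 0"
      by (simp add: parts_eq_iff scale_parts)
    then show "w \<in> vec.span {of_parts v 0}" by (simp add: vec.span_base vec.span_scale)
  next
    fix w assume "w \<in> vec.span {of_parts v 0}"
    then obtain c where w: "w = c *s of_parts v 0" by (auto simp: vec.span_singleton)
    have "w \<in> HC" using v by (simp add: w HC_iff scale_parts subspace_scale[OF subspace_H])
    moreover have "(complexify A ^^ 1) w = 0"
      using v by (simp add: w complexify_alt parts_eq_0_iff scale_parts linear_scale[OF A(1)] linear_0[OF A(1)])
    ultimately show "w \<in> {w \<in> HC. \<exists>n. (complexify A ^^ n) w = 0}" by blast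
  qed
  then have "alg_mult A 0 = vec.dim {of_parts v 0}"
    by (simp add: alg_mult_def 0 vec.dim_span)
  also have "\<dots> = 1"
    using v by (subst vec.dim_eq_card_independent) (auto simp: parts_eq_0_iff vec.dependent_single)
  finally show ?thesis .
qed

lemma dim_H: "dim (H :: (real ^ 'k::finite) set) = CARD('k) - 1"
proof -
  let ?one = "(\<chi> i. 1) :: real ^ 'k"
  have "H = {x. ?one \<bullet> x = 0}" by (auto simp: H_def inner_vec_def)
  moreover have "?one \<noteq> 0" by (simp add: vec_eq_iff)
  ultimately show ?thesis using dim_hyperplane[of ?one] by simp
qed

text \<open>In an orthogonal eigenbasis \<open>A - \<mu>\<close> acts on coefficients by the factors
  \<open>e b - \<mu>\<close>. Hence the generalised eigenspace of \<mu> is spanned by the basis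
  vectors with \<open>e b = \<mu>\<close>, and multiplicities are counted by basis vectors.\<close>

lemma index_eq_card_negative:
  fixes A :: "real ^ 'k::finite \<Rightarrow> real ^ 'k"
  assumes A: "linear A" "\<And>u. u \<in> H \<Longrightarrow> A u \<in> H"
    and B: "finite B" "B \<subseteq> H" "0 \<notin> B" "pairwise orthogonal B" "card B = dim (H :: (real ^ 'k) set)"
    and e: "\<And>b. b \<in> B \<Longrightarrow> A b = e b *\<^sub>R b"
  shows "(\<Sum>\<mu> | \<mu> \<in> eigenvalues A \<and> Re \<mu> < 0. alg_mult A \<mu>) = card {b \<in> B. e b < 0}"
proof -
  have indep: "independent B" using B pairwise_orthogonal_independent by blast
  have span: "span B = H"
    using card_ge_dim_independent[OF B(2) indep] B span_minimal[OF B(2) subspace_H] by auto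
  have bb: "b \<bullet> c = (if b = c then b \<bullet> b else 0)" if "b \<in> B" "c \<in> B" for b c
    using B(4) that by (auto simp: pairwise_def orthogonal_def)
  have Ab: "A u \<bullet> b = e b * (u \<bullet> b)" if "u \<in> H" "b \<in> B" for u b
  proof -
    from that(1) span obtain c where u: "u = (\<Sum>b\<in>B. c b *\<^sub>R b)"
      using span_finite[OF B(1)] by auto
    have sum_b: "(\<Sum>x\<in>B. d x *\<^sub>R x) \<bullet> b = d b * (b \<bullet> b)" for d
    proof -
      have "(\<Sum>x\<in>B. d x *\<^sub>R x) \<bullet> b = (\<Sum>x\<in>B. if x = b then d b * (b \<bullet> b) else 0)"
        unfolding inner_sum_left using bb[OF _ that(2)] by (intro sum.cong) auto
      then show ?thesis using that(2) B(1) by simp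
    qed
    have "A u = (\<Sum>b\<in>B. (c b * e b) *\<^sub>R b)"
      by (simp add: u linear_sum[OF A(1)] linear_scale[OF A(1)] e)
    then show ?thesis unfolding u using sum_b[of c] sum_b[of "\<lambda>b. c b * e b"] by simp
  qed
  have zero: "u = 0" if "u \<in> H" "\<And>b. b \<in> B \<Longrightarrow> u \<bullet> b = 0" for u
  proof -
    have "orthogonal u u" using that span by (intro orthogonal_to_span[of u B u]) (auto simp: orthogonal_def)
    then show ?thesis by (simp add: orthogonal_def)
  qed
  \<comment> \<open>The complex coefficient of \<open>w\<close> along \<open>b\<close>, up to the
    factor \<open>b \<bullet> b\<close>. A vector of \<open>HC\<close> is determined by these
    numbers.\<close>
  define cd where "cd w b = Complex (re_part w \<bullet> b) (im_part w \<bullet> b)" for w :: "complex ^ 'k" and b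
  have cd_zero: "w = 0" if "w \<in> HC" "\<And>b. b \<in> B \<Longrightarrow> cd w b = 0" for w
    using that zero[of "re_part w"] zero[of "im_part w"]
    by (auto simp: HC_iff cd_def parts_eq_0_iff complex_eq_iff)
  have cd_A: "cd (complexify A w - \<mu> *s w) b = (of_real (e b) - \<mu>) * cd w b"
    if "w \<in> HC" "b \<in> B" for w b \<mu>
  proof -
    have parts: "re_part (complexify A w - \<mu> *s w) = A (re_part w) - re_part (\<mu> *s w)"
      "im_part (complexify A w - \<mu> *s w) = A (im_part w) - im_part (\<mu> *s w)"
      by (simp_all add: complexify_alt re_part_def im_part_def of_parts_def vec_eq_iff)
    show ?thesis
      unfolding cd_def parts using that
      by (simp add: HC_iff Ab scale_parts complex_eq_iff inner_diff_left inner_add_left left_diff_distrib)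
  qed
  have HC_A: "complexify A w - \<mu> *s w \<in> HC" if "w \<in> HC" for w \<mu>
  proof -
    have "re_part (complexify A w - \<mu> *s w) = A (re_part w) - re_part (\<mu> *s w)"
      "im_part (complexify A w - \<mu> *s w) = A (im_part w) - im_part (\<mu> *s w)"
      by (simp_all add: complexify_alt re_part_def im_part_def of_parts_def vec_eq_iff)
    then show ?thesis
      using that A(2) by (auto simp: HC_iff scale_parts
          intro!: subspace_diff[OF subspace_H] subspace_add[OF subspace_H] subspace_scale[OF subspace_H])
  qed
  have iter: "((\<lambda>u. complexify A u - \<mu> *s u) ^^ n) w \<in> HC \<and>
    (\<forall>b\<in>B. cd (((\<lambda>u. complexify A u - \<mu> *s u) ^^ n) w) b = (of_real (e b) - \<mu>) ^ n * cd w b)"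
    if "w \<in> HC" for w \<mu> n
    by (induction n) (use that HC_A cd_A in auto)
  have cd_sum: "cd (\<Sum>b\<in>B'. c b *s of_parts b 0) b' = (if b' \<in> B' then c b' * of_real (b' \<bullet> b') else 0)"
    if "B' \<subseteq> B" "b' \<in> B" for B' b' c
  proof -
    have re: "re_part (\<Sum>b\<in>B'. c b *s of_parts b 0) = (\<Sum>b\<in>B'. Re (c b) *\<^sub>R b)"
      "im_part (\<Sum>b\<in>B'. c b *s of_parts b 0) = (\<Sum>b\<in>B'. Im (c b) *\<^sub>R b)"
      by (simp_all add: re_part_def im_part_def of_parts_def vec_eq_iff)
    have "b \<bullet> b' = (if b = b' then b' \<bullet> b' else 0)" if "b \<in> B'" for b
      using bb[of b b'] that \<open>B' \<subseteq> B\<close> \<open>b' \<in> B\<close> by auto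
    then have "(\<Sum>b\<in>B'. d b *\<^sub>R b) \<bullet> b' = (\<Sum>b\<in>B'. if b = b' then d b * (b' \<bullet> b') else 0)" for d
      by (auto simp: inner_sum_left intro!: sum.cong)
    moreover have "finite B'" using that(1) B(1) finite_subset by blast
    ultimately show ?thesis
      by (simp add: cd_def re complex_eq_iff)
  qed
  have of_parts_HC: "of_parts b 0 \<in> HC" if "b \<in> B" for b
    using that B(2) subspace_0[OF subspace_H] by (auto simp: HC_iff)
  have inj: "inj_on (\<lambda>b. of_parts b 0) B'" for B' :: "(real ^ 'k) set"
    by (auto simp: inj_on_def parts_eq_iff)
  have HC_sum: "(\<Sum>b\<in>B'. c b *s of_parts b 0) \<in> HC" if "B' \<subseteq> B" for B' c
  proof -
    have "re_part (\<Sum>b\<in>B'. c b *s of_parts b 0) = (\<Sum>b\<in>B'. Re (c b) *\<^sub>R b)"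
      "im_part (\<Sum>b\<in>B'. c b *s of_parts b 0) = (\<Sum>b\<in>B'. Im (c b) *\<^sub>R b)"
      by (simp_all add: re_part_def im_part_def of_parts_def vec_eq_iff)
    then show ?thesis
      using that B(2) by (auto simp: HC_iff intro!: subspace_sum[OF subspace_H] subspace_scale[OF subspace_H])
  qed
  have mult: "alg_mult A \<mu> = card {b \<in> B. of_real (e b) = \<mu>}" for \<mu>
    unfolding alg_mult_def
  proof (rule vec.dim_unique)
    let ?B = "{b \<in> B. complex_of_real (e b) = \<mu>}"
    let ?V = "{w \<in> HC. \<exists>n. ((\<lambda>u. complexify A u - \<mu> *s u) ^^ n) w = 0}"
    show "(\<lambda>b. of_parts b 0) ` ?B \<subseteq> ?V"
    proof clarify
      fix b assume b: "b \<in> B" "\<mu> = complex_of_real (e b)"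
      have "complexify A (of_parts b 0) = \<mu> *s of_parts b 0"
        using b by (simp add: complexify_alt parts_eq_iff scale_parts e linear_0[OF A(1)])
      then have "((\<lambda>u. complexify A u - \<mu> *s u) ^^ 1) (of_parts b 0) = 0" by simp
      then show "of_parts b 0 \<in> HC \<and>
          (\<exists>n. ((\<lambda>u. complexify A u - complex_of_real (e b) *s u) ^^ n) (of_parts b 0) = 0)"
        using b of_parts_HC by blast
    qed
    show "?V \<subseteq> vec.span ((\<lambda>b. of_parts b 0) ` ?B)"
    proof clarify
      fix w n assume w: "w \<in> HC" "((\<lambda>u. complexify A u - \<mu> *s u) ^^ n) w = 0"
      define w' where "w' = (\<Sum>b\<in>?B. (cd w b / of_real (b \<bullet> b)) *s of_parts b 0)"
      have cd0: "cd w b = 0" if "b \<in> B" "of_real (e b) \<noteq> \<mu>" for b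
      proof -
        have "(of_real (e b) - \<mu>) ^ n * cd w b = cd 0 b" using iter[OF w(1), where \<mu> = \<mu> and n = n] w(2) that by auto
        moreover have "cd 0 b = 0" by (simp add: cd_def re_part_def im_part_def inner_vec_def complex_eq_iff)
        ultimately show ?thesis using that(2) by (simp del: complex_eq_iff)
      qed
      have "w - w' = 0"
      proof (rule cd_zero)
        have "w' \<in> HC" unfolding w'_def by (rule HC_sum) auto
        then show "w - w' \<in> HC" using w(1) by (simp add: HC_def sum_subtractf)
        fix b assume b: "b \<in> B"
        then have "b \<bullet> b \<noteq> 0" using B(3) by auto
        then have "cd w' b = cd w b"
          unfolding w'_def using cd_sum[of ?B b] b cd0[OF b] by auto
        moreover have "cd (w - w') b = cd w b - cd w' b"
          by (simp add: cd_def re_part_def im_part_def inner_vec_def complex_eq_iff sum_subtractf left_diff_distrib)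
        ultimately show "cd (w - w') b = 0" by simp
      qed
      moreover have "w' \<in> vec.span ((\<lambda>b. of_parts b 0) ` ?B)"
        unfolding w'_def by (intro vec.span_sum vec.span_scale vec.span_base) auto
      ultimately show "w \<in> vec.span ((\<lambda>b. of_parts b 0) ` ?B)" by simp
    qed
    show "vec.independent ((\<lambda>b. of_parts b 0) ` ?B)"
    proof (rule vec.independent_if_scalars_zero)
      show "finite ((\<lambda>b. of_parts b 0) ` ?B)" using B(1) by simp
      fix c x assume *: "(\<Sum>x\<in>(\<lambda>b. of_parts b 0) ` ?B. c x *s x) = 0" "x \<in> (\<lambda>b. of_parts b 0) ` ?B"
      then obtain b where b: "b \<in> ?B" "x = of_parts b 0" by blast
      have "(\<Sum>b\<in>?B. c (of_parts b 0) *s of_parts b 0) = 0"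
        using *(1) by (simp add: sum.reindex[OF inj])
      then have "cd 0 b = c x * of_real (b \<bullet> b)"
        using cd_sum[of ?B b "\<lambda>b. c (of_parts b 0)"] b by auto
      moreover have "b \<bullet> b \<noteq> 0" using b B(3) by auto
      ultimately show "c x = 0"
        by (auto simp: cd_def re_part_def im_part_def inner_vec_def complex_eq_iff)
    qed
    show "card ((\<lambda>b. of_parts b 0) ` ?B) = card ?B" by (rule card_image[OF inj])
  qed
  have ev: "eigenvalues A = (\<lambda>b. of_real (e b)) ` B"
  proof (intro equalityI subsetI)
    fix \<mu> assume "\<mu> \<in> eigenvalues A"
    then obtain w where w: "w \<in> HC" "w \<noteq> 0" "complexify A w - \<mu> *s w = 0" by (auto simp: eigenvalues_def)
    with cd_zero obtain b where b: "b \<in> B" "cd w b \<noteq> 0" by blast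
    have "cd 0 b = (of_real (e b) - \<mu>) * cd w b" using cd_A[OF w(1) b(1), of \<mu>] w(3) by simp
    moreover have "cd 0 b = 0" by (simp add: cd_def re_part_def im_part_def inner_vec_def complex_eq_iff)
    ultimately have "\<mu> = of_real (e b)" using b(2) by auto
    then show "\<mu> \<in> (\<lambda>b. of_real (e b)) ` B" using b by blast
  next
    fix \<mu> assume "\<mu> \<in> (\<lambda>b. complex_of_real (e b)) ` B"
    then obtain b where b: "b \<in> B" "\<mu> = of_real (e b)" by blast
    have "complexify A (of_parts b 0) = \<mu> *s of_parts b 0"
      using b by (simp add: complexify_alt parts_eq_iff scale_parts e linear_0[OF A(1)])
    moreover have "of_parts b 0 \<noteq> 0" using b B(3) by (auto simp: parts_eq_0_iff)
    ultimately show "\<mu> \<in> eigenvalues A" using of_parts_HC[OF b(1)] by (auto simp: eigenvalues_def)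
  qed
  let ?M = "{\<mu>. \<mu> \<in> eigenvalues A \<and> Re \<mu> < 0}"
  have fin: "finite ?M" using ev B(1) by simp
  \<comment> \<open>The basis vectors with negative eigenvalue are grouped by eigenvalue, which
    turns the cardinality into the sum defining the index.\<close>
  have "{b \<in> B. e b < 0} = (\<Union>\<mu>\<in>?M. {b \<in> B. of_real (e b) = \<mu>})" using ev by auto
  then have "card {b \<in> B. e b < 0} = (\<Sum>\<mu>\<in>?M. card {b \<in> B. of_real (e b) = \<mu>})"
    using fin B(1) by (simp only:) (rule card_UN_disjoint, auto)
  then show ?thesis by (simp add: mult)
qed

section \<open>The zeros of the perturbed quadratic family\<close>

definition proj_H :: "real ^ 'k \<Rightarrow> real ^ 'k" where
  "proj_H w = (\<chi> i. w $ i - (\<Sum>j\<in>UNIV. w $ j) / real CARD('k))"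

text \<open>The polarisation of \<open>Q\<close>; the product \<open>x * y\<close> is taken
  coordinatewise.\<close>

definition B_form :: "real ^ 'k \<Rightarrow> real ^ 'k \<Rightarrow> real ^ 'k" where
  "B_form x y = proj_H (x * y)"

lemma proj_H_in_H: "proj_H (w :: real ^ 'k::finite) \<in> H"
  by (simp add: proj_H_def H_def sum_subtractf)

lemma inner_proj_H: "u \<in> H \<Longrightarrow> u \<bullet> proj_H w = u \<bullet> w"
  by (simp add: proj_H_def H_def inner_vec_def right_diff_distrib sum_subtractf
      flip: sum_distrib_right sum_divide_distrib)

lemma Q_eq_B_form: "Q x = B_form x x"
  by (simp add: Q_def B_form_def proj_H_def vec_eq_iff power2_eq_square)

lemma bounded_bilinear_B_form: "bounded_bilinear (B_form :: real ^ 'k::finite \<Rightarrow> _)"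
proof -
  have "bilinear (B_form :: real ^ 'k \<Rightarrow> _)"
    by (auto simp: bilinear_def linear_iff B_form_def proj_H_def vec_eq_iff algebra_simps sum.distrib
        add_divide_distrib sum_distrib_left)
  then show ?thesis by (simp add: bilinear_conv_bounded_bilinear)
qed

interpretation B_form: bounded_bilinear B_form
  by (rule bounded_bilinear_B_form)

lemma B_form_commute: "B_form x y = B_form y x"
  by (simp add: B_form_def mult.commute)

lemma B_form_in_H: "B_form x y \<in> H"
  by (simp add: B_form_def proj_H_in_H)

text \<open>The derivative in \<open>x\<close> of \<open>pert i0 t x lam\<close>. The size
  \<open>t\<close> drops out, since the perturbation is constant in \<open>x\<close>.\<close>

definition lin :: "real ^ 'k \<Rightarrow> real \<Rightarrow> real ^ 'k \<Rightarrow> real ^ 'k" where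
  "lin x lam u = lam *\<^sub>R u - 2 *\<^sub>R B_form x u"

lemma linear_lin: "linear (lin x lam)"
  unfolding lin_def by (intro linearI) (simp_all add: B_form.add_right B_form.scaleR_right algebra_simps)

lemma lin_in_H: "u \<in> H \<Longrightarrow> lin x lam u \<in> H"
  unfolding lin_def by (intro subspace_diff[OF subspace_H] subspace_scale[OF subspace_H] B_form_in_H)

text \<open>Up to the factor -2 the linearization is the compression to \<open>H\<close> of the
  diagonal matrix with entries x_i - \<lambda>/2. Symmetry, the kernels and the index are all read
  off from this form.\<close>

lemma lin_eq_proj_H: "u \<in> H \<Longrightarrow> lin x lam u = - 2 *\<^sub>R proj_H (\<chi> i. (x $ i - lam / 2) * u $ i)"
  by (auto simp: lin_def B_form_def proj_H_def H_def vec_eq_iff algebra_simps sum_subtractf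
      simp flip: sum_distrib_left sum_divide_distrib)

lemma lin_symmetric: "u \<in> H \<Longrightarrow> v \<in> H \<Longrightarrow> u \<bullet> lin x lam v = lin x lam u \<bullet> v"
  by (simp add: lin_eq_proj_H inner_proj_H inner_commute[of "proj_H _"])
     (simp add: inner_vec_def algebra_simps)

definition pert_dir :: "'k \<Rightarrow> real ^ 'k" where
  "pert_dir i0 = (\<chi> i. if i = i0 then 1 - real CARD('k) else 1)"

definition pert :: "'k \<Rightarrow> real \<Rightarrow> real ^ 'k \<Rightarrow> real \<Rightarrow> real ^ 'k" where
  "pert i0 t x lam = lam *\<^sub>R x - Q x + t *\<^sub>R pert_dir i0"

lemma pert_dir_in_H: "pert_dir i0 \<in> (H :: (real ^ 'k::finite) set)"
  by (simp add: pert_dir_def H_def sum.remove[of _ i0])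

text \<open>The family is quadratic, so the secant between two points is given exactly, without
  remainder, by the linearization at the midpoint. Differences of zeros can then be rescaled and
  sent to a limit.\<close>

lemma pert_diff:
  "pert i0 t x lam - pert i0 t x' lam' =
    lin ((1/2) *\<^sub>R (x + x')) ((lam + lam') / 2) (x - x') + (lam - lam') *\<^sub>R (1/2) *\<^sub>R (x + x')"
proof -
  have "B_form (x + x') (x - x') = B_form x x - B_form x' x'"
    by (simp add: B_form.add_left B_form.diff_right B_form_commute[of x' x])
  then have "B_form (x + x') (x - x') $ i = B_form x x $ i - B_form x' x' $ i" for i by simp
  note B = this
  show ?thesis
    unfolding pert_def lin_def Q_eq_B_form B_form.scaleR_left vec_eq_iff
  proof
    fix i
    show "(lam *\<^sub>R x - B_form x x + t *\<^sub>R pert_dir i0 -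
        (lam' *\<^sub>R x' - B_form x' x' + t *\<^sub>R pert_dir i0)) $ i =
      (((lam + lam') / 2) *\<^sub>R (x - x') - 2 *\<^sub>R (1/2) *\<^sub>R B_form (x + x') (x - x') +
        (lam - lam') *\<^sub>R (1/2) *\<^sub>R (x + x')) $ i"
      using B[of i] by (simp add: field_simps)
  qed
qed

section \<open>Explicit zeros and kernels for a constant size of the perturbation\<close>

locale odd_index =
  fixes i0 :: "'k::finite" and l :: nat
  assumes card_k: "CARD('k) = 2 * l + 1" and l_pos: "l \<ge> 1"
begin

definition kk :: real where "kk = 2 * real l + 1"

lemma real_CARD [simp]: "real CARD('k) = kk"
  using card_k by (simp add: kk_def)

lemma kk_pos: "kk > 0"
  by (simp add: kk_def)

abbreviation others :: "'k set" where "others \<equiv> UNIV - {i0}"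

definition sgn_of :: "'k set \<Rightarrow> 'k \<Rightarrow> real" where
  "sgn_of S j = (if j \<in> S then 1 else - 1)"

text \<open>The sum m of the signs: \<open>card S\<close> plus signs against
  \<open>2 * l - card S\<close> minus signs.\<close>

definition excess :: "'k set \<Rightarrow> real" where
  "excess S = 2 * real (card S) - 2 * real l"

definition orthant :: "'k set \<Rightarrow> ((real ^ 'k) \<times> real) set" where
  "orthant S = {(x, lam). \<forall>j\<in>others. sgn_of S j * (x $ j - lam / 2) > 0}"

text \<open>The coordinates other than \<open>i0\<close> sit at distance \<open>s\<close> from
  \<lambda>/2 on the side given by \<open>S\<close>; the entry at \<open>i0\<close> is the one that
  makes the coordinate sum zero.\<close>

definition sol :: "'k set \<Rightarrow> real \<Rightarrow> real \<Rightarrow> real ^ 'k" where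
  "sol S s lam = (\<chi> j. if j = i0 then - (real l * lam + excess S * s) else lam / 2 + sgn_of S j * s)"

text \<open>The derivative of \<open>sol S s lam\<close> in \<open>s\<close>. At a fold it is
  tangent to the curve of zeros, because \<lambda> is stationary there.\<close>

definition ker_vec :: "'k set \<Rightarrow> real ^ 'k" where
  "ker_vec S = (\<chi> j. if j = i0 then - excess S else sgn_of S j)"

lemma sum_UNIV_others: "(\<Sum>i\<in>UNIV. f i) = f i0 + (\<Sum>j\<in>others. f j)"
  by (simp add: sum.remove[of UNIV i0])

lemma card_others: "card others = 2 * l"
  using card_k by simp

lemma sgn_of_square: "sgn_of S j * sgn_of S j = 1"
  by (simp add: sgn_of_def)

lemma sgn_of_mult_cancel [simp]: "sgn_of S j * (sgn_of S j * a) = a"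
  by (simp add: sgn_of_def)

lemma sum_sgn_of: "S \<subseteq> others \<Longrightarrow> (\<Sum>j\<in>others. sgn_of S j) = excess S"
proof -
  assume S: "S \<subseteq> others"
  have "(\<Sum>j\<in>others. sgn_of S j) = (\<Sum>j\<in>S. 1) + (\<Sum>j\<in>others - S. - 1)"
    using S by (subst sum.subset_diff[OF S]) (auto simp: sgn_of_def)
  also have "\<dots> = excess S"
    using S card_others card_mono[OF _ S] by (simp add: card_Diff_subset excess_def finite_subset)
  finally show ?thesis .
qed

text \<open>The excess is twice an integer. The resulting gap keeps m^2 - 1 at least 3 off the
  balanced case.\<close>

lemma excess_cases:
  assumes "excess S \<noteq> 0"
  shows "excess S \<le> - 2 \<or> excess S \<ge> 2"
proof -
  have "excess S = real_of_int (2 * (int (card S) - int l))" by (simp add: excess_def)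
  moreover have "int (card S) - int l \<le> -1 \<or> int (card S) - int l = 0 \<or> int (card S) - int l \<ge> 1" by linarith
  ultimately show ?thesis using assms by (simp add: excess_def) linarith
qed

lemma excess_square: "excess S \<noteq> 0 \<Longrightarrow> (excess S)\<^sup>2 \<ge> 4"
  using excess_cases[of S] power_mono[of 2 "excess S" 2] power_mono[of 2 "- excess S" 2] by auto

lemma abs_excess_less: "S \<subseteq> others \<Longrightarrow> \<bar>excess S\<bar> < kk"
  using card_mono[of others S] card_others by (auto simp: excess_def kk_def abs_if)

lemma excess_eq_0_iff: "excess S = 0 \<longleftrightarrow> card S = l"
  by (auto simp: excess_def)

lemma open_orthant: "open (orthant S)"
proof -
  have "orthant S = (\<Inter>j\<in>others. {p. 0 < sgn_of S j * (fst p $ j - snd p / 2)})"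
    by (auto simp: orthant_def)
  moreover have "open {p :: (real ^ 'k) \<times> real. 0 < sgn_of S j * (fst p $ j - snd p / 2)}" for j
    by (intro open_Collect_less continuous_intros; simp)
  ultimately show ?thesis by auto
qed

lemma orthant_disjoint:
  assumes "S \<subseteq> others" "S' \<subseteq> others" "p \<in> orthant S" "p \<in> orthant S'"
  shows "S = S'"
proof -
  obtain x lam where p: "p = (x, lam)" by (cases p)
  have "j \<in> S \<longleftrightarrow> x $ j - lam / 2 > 0" "j \<in> S' \<longleftrightarrow> x $ j - lam / 2 > 0" if "j \<in> others" for j
    using assms(3,4) that by (auto simp: orthant_def p sgn_of_def dest!: bspec[of _ _ j] split: if_splits)
  then show ?thesis using assms(1,2) by blast
qed

lemma sol_in_H: "S \<subseteq> others \<Longrightarrow> sol S s lam \<in> H"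
  using card_others
  by (simp add: H_def sum_UNIV_others sol_def sum.distrib sum_sgn_of flip: sum_distrib_right)

lemma ker_vec_in_H: "S \<subseteq> others \<Longrightarrow> ker_vec S \<in> H"
  by (simp add: H_def sum_UNIV_others ker_vec_def sum_sgn_of)

lemma ker_vec_nonzero: "ker_vec S \<noteq> 0"
proof
  assume *: "ker_vec S = 0"
  have "others \<noteq> {}" using card_others l_pos by (metis card.empty mult_eq_0_iff not_one_le_zero zero_neq_numeral)
  then obtain j where "j \<noteq> i0" by blast
  then have "ker_vec S $ j \<noteq> 0" by (simp add: ker_vec_def sgn_of_def)
  with * show False by simp
qed

lemma sol_in_orthant: "(sol S s lam, lam) \<in> orthant S \<longleftrightarrow> s > 0"
proof -
  have "others \<noteq> {}" using card_others l_pos by (metis card.empty mult_eq_0_iff not_one_le_zero zero_neq_numeral)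
  then show ?thesis by (auto simp: orthant_def sol_def)
qed

lemma pert_in_H: "x \<in> H \<Longrightarrow> pert i0 t x lam \<in> H"
  unfolding pert_def Q_eq_B_form
  by (intro subspace_diff[OF subspace_H] subspace_add[OF subspace_H] subspace_scale[OF subspace_H] B_form_in_H
      pert_dir_in_H)

text \<open>Completing the square in each coordinate: the right-hand side depends on the index only
  through \<open>pert_dir\<close>, so all squared deviations from \<lambda>/2 agree except the one
  at \<open>i0\<close>.\<close>

lemma pert_zeroD:
  assumes x: "x \<in> H" "pert i0 t x lam = 0" and t: "t \<ge> 0"
  obtains S s where "S \<subseteq> others" "s \<ge> 0" "x = sol S s lam" "(kk * lam / 2 + excess S * s)\<^sup>2 = s\<^sup>2 - kk * t"
proof -
  define c where "c = (\<Sum>j\<in>UNIV. (x $ j)\<^sup>2) / kk"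
  define r where "r = lam\<^sup>2 / 4 + c + t"
  have eq: "(x $ i - lam / 2)\<^sup>2 = lam\<^sup>2 / 4 + c + t * pert_dir i0 $ i" for i
  proof -
    have "pert i0 t x lam $ i = 0" using x(2) by simp
    then show ?thesis by (simp add: pert_def Q_def c_def power2_eq_square algebra_simps)
  qed
  have eqj: "(x $ j - lam / 2)\<^sup>2 = r" if "j \<noteq> i0" for j
    using eq[of j] that by (simp add: pert_dir_def r_def)
  have eq0: "(x $ i0 - lam / 2)\<^sup>2 = r - kk * t"
    using eq[of i0] by (simp add: pert_dir_def r_def algebra_simps)
  have r: "r \<ge> 0" unfolding r_def c_def using t kk_pos by (intro add_nonneg_nonneg divide_nonneg_nonneg sum_nonneg) auto
  \<comment> \<open>A coordinate with zero deviation receives a minus sign; then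
    \<open>r = 0\<close>, and either sign describes it correctly.\<close>
  define S where "S = {j \<in> others. x $ j - lam / 2 > 0}"
  have S: "S \<subseteq> others" by (auto simp: S_def)
  have xj: "x $ j = lam / 2 + sgn_of S j * sqrt r" if "j \<noteq> i0" for j
    using that eqj[OF that, symmetric] by (auto simp: S_def sgn_of_def)
  have "x $ i0 = - (\<Sum>j\<in>others. x $ j)"
    using x(1) by (simp add: H_def sum_UNIV_others)
  also have "(\<Sum>j\<in>others. x $ j) = (\<Sum>j\<in>others. lam / 2 + sgn_of S j * sqrt r)"
    using xj by (intro sum.cong) auto
  also have "\<dots> = real l * lam + excess S * sqrt r"
    using card_others by (simp add: sum.distrib sum_sgn_of[OF S] flip: sum_distrib_right)
  finally have x0: "x $ i0 = - (real l * lam + excess S * sqrt r)" .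
  show thesis
  proof (rule that[OF S])
    show "sqrt r \<ge> 0" using r by simp
    show "x = sol S (sqrt r) lam" using xj x0 by (simp add: sol_def vec_eq_iff)
    have "(kk * lam / 2 + excess S * sqrt r)\<^sup>2 = (x $ i0 - lam / 2)\<^sup>2"
      by (simp add: x0 kk_def power2_eq_square field_simps)
    then show "(kk * lam / 2 + excess S * sqrt r)\<^sup>2 = (sqrt r)\<^sup>2 - kk * t" using eq0 r by simp
  qed
qed

text \<open>The equation on \<open>s\<close> makes all coordinates of the value equal to one number
  \<open>C\<close>; as the value lies in \<open>H\<close>, this number is 0.\<close>

lemma pert_sol_eq_0:
  assumes S: "S \<subseteq> others" and eq: "(kk * lam / 2 + excess S * s)\<^sup>2 = s\<^sup>2 - kk * t"
  shows "pert i0 t (sol S s lam) lam = 0"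
proof -
  let ?x = "sol S s lam"
  define c where "c = (\<Sum>j\<in>UNIV. (?x $ j)\<^sup>2) / kk"
  define C where "C = lam\<^sup>2 / 4 + c + t - s\<^sup>2"
  have comp: "pert i0 t ?x lam $ i = lam\<^sup>2 / 4 + c + t * pert_dir i0 $ i - (?x $ i - lam / 2)\<^sup>2" for i
    by (simp add: pert_def Q_def c_def power2_eq_square algebra_simps)
  have "pert i0 t ?x lam $ i = C" for i
  proof (cases "i = i0")
    case True
    have "(?x $ i0 - lam / 2)\<^sup>2 = (kk * lam / 2 + excess S * s)\<^sup>2"
      by (simp add: sol_def kk_def power2_eq_square field_simps)
    then show ?thesis
      using comp[of i0] True eq by (simp add: pert_dir_def C_def algebra_simps)
  next
    case False
    then have "(?x $ i - lam / 2)\<^sup>2 = s\<^sup>2"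
      by (simp add: sol_def power2_eq_square mult.assoc[symmetric] sgn_of_def)
    then show ?thesis using comp[of i] False by (simp add: pert_dir_def C_def)
  qed note C = this
  have "(\<Sum>i\<in>UNIV. pert i0 t ?x lam $ i) = 0"
    using pert_in_H[OF sol_in_H[OF S]] by (simp add: H_def)
  then have "C = 0" using kk_pos by (simp add: C)
  with C show ?thesis by (simp add: vec_eq_iff)
qed

text \<open>For m = 0 the equation gives s^2 outright. Otherwise y = k\<lambda>/2 + ms satisfies |y|
  <= s, while |ms| >= 2s, which forces s <= k|\<lambda>|/2.\<close>

lemma s_bound:
  assumes S: "S \<subseteq> others" and s: "s \<ge> 0" and t: "t \<ge> 0"
    and eq: "(kk * lam / 2 + excess S * s)\<^sup>2 = s\<^sup>2 - kk * t"
  shows "s\<^sup>2 \<le> kk\<^sup>2 * lam\<^sup>2 / 4 + kk * t"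
proof (cases "excess S = 0")
  case True
  have "(kk * lam / 2)\<^sup>2 = kk\<^sup>2 * lam\<^sup>2 / 4" by (simp add: power_mult_distrib power_divide)
  then show ?thesis using eq True by simp
next
  case False
  let ?y = "kk * lam / 2 + excess S * s"
  have "?y\<^sup>2 \<le> s\<^sup>2" using eq t kk_pos by simp
  then have y: "\<bar>?y\<bar> \<le> s" using s by (metis abs_le_square_iff abs_of_nonneg)
  have "2 * s \<le> \<bar>excess S * s\<bar>"
    using excess_cases[OF False] s mult_right_mono[of 2 "\<bar>excess S\<bar>" s] by (auto simp: abs_mult)
  then have "s \<le> \<bar>kk * lam / 2\<bar>" using y by linarith
  then have "s\<^sup>2 \<le> (kk * lam / 2)\<^sup>2" using s by (metis abs_le_square_iff abs_of_nonneg)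
  moreover have "(kk * lam / 2)\<^sup>2 = kk\<^sup>2 * lam\<^sup>2 / 4" "kk * t \<ge> 0"
    using t kk_pos by (simp_all add: power_mult_distrib power_divide)
  ultimately show ?thesis by linarith
qed

text \<open>No coordinate deviates from \<lambda>/2 by more than \<open>s\<close>: the deviation at
  \<open>i0\<close> is -y with y = k\<lambda>/2 + ms, and y^2 <= s^2.\<close>

lemma norm_sol_bound:
  assumes S: "S \<subseteq> others" and s: "s \<ge> 0" and t: "t \<ge> 0"
    and eq: "(kk * lam / 2 + excess S * s)\<^sup>2 = s\<^sup>2 - kk * t"
  shows "(norm (sol S s lam))\<^sup>2 \<le> 2 * kk * (lam\<^sup>2 * (1 + kk\<^sup>2) / 4 + kk * t)"
proof -
  let ?x = "sol S s lam"
  let ?y = "kk * lam / 2 + excess S * s"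
  have "?y\<^sup>2 \<le> s\<^sup>2" using eq t kk_pos by simp
  then have y: "\<bar>?y\<bar> \<le> s" using s by (metis abs_le_square_iff abs_of_nonneg)
  have "\<bar>?x $ i\<bar> \<le> \<bar>lam / 2\<bar> + s" for i
  proof (cases "i = i0")
    case True
    have "?x $ i0 = lam / 2 - ?y" by (simp add: sol_def kk_def field_simps)
    then show ?thesis using y unfolding True by linarith
  next
    case False
    then show ?thesis using s by (auto simp: sol_def sgn_of_def)
  qed
  then have "(?x $ i)\<^sup>2 \<le> (\<bar>lam / 2\<bar> + s)\<^sup>2" for i
    using s by (metis abs_ge_zero abs_le_square_iff abs_of_nonneg add_nonneg_nonneg)
  then have "(\<Sum>i\<in>UNIV. (?x $ i)\<^sup>2) \<le> (\<Sum>i\<in>(UNIV::'k set). (\<bar>lam / 2\<bar> + s)\<^sup>2)" by (intro sum_mono)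
  moreover have "(norm ?x)\<^sup>2 = (\<Sum>i\<in>UNIV. (?x $ i)\<^sup>2)"
    unfolding power2_norm_eq_inner inner_vec_def by (simp add: power2_eq_square)
  ultimately have "(norm ?x)\<^sup>2 \<le> kk * (\<bar>lam / 2\<bar> + s)\<^sup>2" by simp
  moreover have "(\<bar>lam / 2\<bar> + s)\<^sup>2 \<le> 2 * (lam\<^sup>2 / 4 + s\<^sup>2)"
  proof -
    have "2 * (lam\<^sup>2 / 4 + s\<^sup>2) = (\<bar>lam / 2\<bar> + s)\<^sup>2 + (\<bar>lam / 2\<bar> - s)\<^sup>2"
      by (simp add: power2_eq_square algebra_simps)
    then show ?thesis by (simp only: le_add_same_cancel1 zero_le_power2)
  qed
  moreover have "2 * (lam\<^sup>2 / 4 + s\<^sup>2) \<le> 2 * (lam\<^sup>2 * (1 + kk\<^sup>2) / 4 + kk * t)"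
    using s_bound[OF assms] by (simp add: algebra_simps add_divide_distrib)
  ultimately have "(norm ?x)\<^sup>2 \<le> kk * (2 * (lam\<^sup>2 * (1 + kk\<^sup>2) / 4 + kk * t))"
    using kk_pos by (meson mult_left_mono less_imp_le order_trans)
  then show ?thesis by (simp add: mult_ac)
qed

text \<open>By the diagonal form, a kernel vector has (x_i - \<lambda>/2) u_i equal to one constant
  \<open>c\<close> for all i. Solving for the coordinates other than \<open>i0\<close> gives a
  multiple of the sign vector, the zero sum fixes the entry at \<open>i0\<close>, and the equation
  at \<open>i0\<close> is then the degeneracy condition s = my.\<close>

lemma lin_kernel:
  assumes S: "S \<subseteq> others" and s: "s > 0" and u: "u \<in> H" "u \<noteq> 0" "lin (sol S s lam) lam u = 0"
  shows "s = excess S * (kk * lam / 2 + excess S * s) \<and> (\<exists>c. u = c *\<^sub>R ker_vec S)"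
proof -
  let ?x = "sol S s lam"
  define y where "y = kk * lam / 2 + excess S * s"
  define c where "c = (\<Sum>i\<in>UNIV. (?x $ i - lam / 2) * u $ i) / kk"
  have eq: "(?x $ i - lam / 2) * u $ i = c" for i
  proof -
    have "lin ?x lam u $ i = - 2 * ((?x $ i - lam / 2) * u $ i - c)"
      using u(1) by (simp add: lin_eq_proj_H proj_H_def c_def)
    then show ?thesis using u(3) by simp
  qed
  have uj: "u $ j = (c / s) * sgn_of S j" if "j \<noteq> i0" for j
  proof -
    have "sgn_of S j * s * u $ j = c" using eq[of j] that by (simp add: sol_def)
    then show ?thesis using s by (auto simp: sgn_of_def field_simps split: if_splits)
  qed
  have "?x $ i0 - lam / 2 = - y" by (simp add: sol_def y_def kk_def field_simps)
  then have u0: "- y * u $ i0 = c" using eq[of i0] by simp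
  have "u $ i0 = - (\<Sum>j\<in>others. u $ j)" using u(1) by (simp add: H_def sum_UNIV_others)
  also have "(\<Sum>j\<in>others. u $ j) = (\<Sum>j\<in>others. (c / s) * sgn_of S j)"
    using uj by (intro sum.cong) auto
  also have "\<dots> = (c / s) * excess S" by (simp only: sum_distrib_left[symmetric] sum_sgn_of[OF S])
  finally have u0': "u $ i0 = - ((c / s) * excess S)" .
  have uker: "u = (c / s) *\<^sub>R ker_vec S" using uj u0' by (simp add: vec_eq_iff ker_vec_def)
  then have "c \<noteq> 0" using u(2) by auto
  moreover have "y * (c * excess S) = c * s" using u0 u0' s by (simp add: field_simps)
  ultimately have "s = excess S * y" by (simp add: field_simps)
  then show ?thesis using uker unfolding y_def by blast
qed

lemma lin_ker_vec:
  assumes S: "S \<subseteq> others" and s: "s = excess S * (kk * lam / 2 + excess S * s)"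
  shows "lin (sol S s lam) lam (ker_vec S) = 0"
proof -
  let ?x = "sol S s lam"
  have "(?x $ i - lam / 2) * ker_vec S $ i = s" for i
  proof (cases "i = i0")
    case True
    have "(?x $ i0 - lam / 2) * ker_vec S $ i0 = excess S * (kk * lam / 2 + excess S * s)"
      by (simp add: sol_def ker_vec_def kk_def field_simps)
    then show ?thesis using True s by simp
  next
    case False
    then show ?thesis by (simp add: sol_def ker_vec_def sgn_of_def)
  qed
  then show ?thesis
    using kk_pos by (simp add: lin_eq_proj_H[OF ker_vec_in_H[OF S]] proj_H_def vec_eq_iff)
qed

text \<open>The coefficient that decides the crossing speed in \<lambda>: where the perturbation is
  locally constant in \<lambda>, the parameter derivative of the family is \<open>x\<close>
  itself.\<close>

lemma ker_vec_inner_sol: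
  assumes "S \<subseteq> others" and s: "s = excess S * (kk * lam / 2 + excess S * s)"
  shows "ker_vec S \<bullet> sol S s lam = kk * s"
proof -
  have "ker_vec S \<bullet> sol S s lam =
      excess S * (real l * lam + excess S * s) + (\<Sum>j\<in>others. sgn_of S j * (lam / 2) + s)"
    unfolding inner_vec_def sum_UNIV_others
    by (intro arg_cong2[where f = "(+)"] sum.cong) (auto simp: ker_vec_def sol_def algebra_simps sgn_of_square)
  also have "(\<Sum>j\<in>others. sgn_of S j * (lam / 2) + s) = excess S * (lam / 2) + 2 * real l * s"
    using card_others by (simp add: sum.distrib sum_sgn_of[OF assms(1)] flip: sum_distrib_right sum_divide_distrib)
  also have "excess S * (real l * lam + excess S * s) + (excess S * (lam / 2) + 2 * real l * s) =
      excess S * (kk * lam / 2 + excess S * s) + 2 * real l * s"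
    by (simp add: kk_def field_simps)
  also have "\<dots> = kk * s" using s by (simp add: kk_def algebra_simps)
  finally show ?thesis .
qed

text \<open>The quadratic coefficient of the fold up to the factor -2. It equals -m(m^2 - 1), which
  is nonzero for every unbalanced sign vector.\<close>

lemma ker_vec_cubic:
  assumes "S \<subseteq> others"
  shows "ker_vec S \<bullet> B_form (ker_vec S) (ker_vec S) = excess S - (excess S) ^ 3"
proof -
  have "ker_vec S \<bullet> B_form (ker_vec S) (ker_vec S) = - ((excess S) ^ 3) + (\<Sum>j\<in>others. sgn_of S j)"
    unfolding B_form_def inner_proj_H[OF ker_vec_in_H[OF assms]] unfolding inner_vec_def sum_UNIV_others
    by (intro arg_cong2[where f = "(+)"] sum.cong) (auto simp: ker_vec_def power3_eq_cube)
  then show ?thesis by (simp add: sum_sgn_of[OF assms])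
qed

end

section \<open>Persistence of nondegenerate zeros\<close>

lemma smooth_slice_has_derivative:
  fixes h :: "(real ^ 'k::finite) \<times> real \<Rightarrow> real ^ 'k"
  assumes h: "smooth_on_subspace HR h" and x: "x \<in> H"
  shows "((\<lambda>y. h (y, lam)) has_derivative linearization h (x, lam)) (at x within H)"
proof -
  have 1: "((\<lambda>y. (y, lam)) has_derivative (\<lambda>u. (u, 0))) (at x within H)"
    by (auto intro!: derivative_eq_intros)
  have "(h has_derivative (\<lambda>u. deriv_on HR h [u] (x, lam))) (at (x, lam) within (\<lambda>y. (y, lam)) ` H)"
    using smooth_has_derivative[OF h, of "[]" "(x, lam)"] x
    by (auto simp: HR_def simp del: deriv_on.simps(2) intro: has_derivative_subset)
  from has_derivative_in_compose[OF 1 this]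
  have "(\<lambda>y. h (y, lam)) differentiable (at x within H)" by (auto simp: differentiable_def)
  then show ?thesis by (simp add: linearization_def frechet_derivative_works)
qed

lemma linear_linearization:
  fixes h :: "(real ^ 'k::finite) \<times> real \<Rightarrow> real ^ 'k"
  assumes "smooth_on_subspace HR h" "x \<in> H"
  shows "linear (linearization h (x, lam))"
  using smooth_slice_has_derivative[OF assms] by (rule has_derivative_linear)

lemma linearization_in_H:
  fixes h :: "(real ^ 'k::finite) \<times> real \<Rightarrow> real ^ 'k"
  assumes "smooth_family h" "x \<in> H" "u \<in> H"
  shows "linearization h (x, lam) u \<in> H"
  using deriv_on_in_H[OF assms(1), of "[(u, 0)]" "(x, lam)"] assms
  by (simp add: linearization_eq_deriv_on smooth_family_def HR_def del: deriv_on.simps)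

lemma smooth_continuous:
  assumes "smooth_on_subspace E h" "vs \<in> lists E"
  shows "continuous_on E (deriv_on E h vs)"
  using assms unfolding smooth_on_subspace_def by (meson differentiable_imp_continuous_on)

lemma linearization_tendsto:
  fixes h :: "(real ^ 'k::finite) \<times> real \<Rightarrow> real ^ 'k"
  assumes h: "smooth_on_subspace HR h" and u: "u \<in> H"
    and p: "\<And>n. x n \<in> H" "y \<in> H" "x \<longlonglongrightarrow> y" "lam \<longlonglongrightarrow> mu"
  shows "(\<lambda>n. linearization h (x n, lam n) u) \<longlonglongrightarrow> linearization h (y, mu) u"
proof -
  have c: "continuous_on HR (deriv_on HR h [(u, 0)])"
    using u by (intro smooth_continuous[OF h]) (simp add: HR_def)
  have l: "(\<lambda>n. (x n, lam n)) \<longlonglongrightarrow> (y, mu)" using p by (intro tendsto_Pair)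
  have "(\<lambda>n. deriv_on HR h [(u, 0)] (x n, lam n)) \<longlonglongrightarrow> deriv_on HR h [(u, 0)] (y, mu)"
    by (rule continuous_on_tendsto_compose[OF c l]) (use p in \<open>simp_all add: HR_def\<close>)
  then show ?thesis by (simp only: linearization_eq_deriv_on[OF h p(1) u] linearization_eq_deriv_on[OF h p(2) u])
qed

lemma linear_inj_on_H_surj:
  fixes L :: "real ^ 'k::finite \<Rightarrow> real ^ 'k"
  assumes L: "linear L" "\<And>u. u \<in> H \<Longrightarrow> L u \<in> H" and inj: "\<And>u. u \<in> H \<Longrightarrow> L u = 0 \<Longrightarrow> u = 0"
  shows "L ` H = H"
proof -
  have "inj_on L (span H)"
    using inj subspace_H by (subst linear_inj_on_iff_eq_0[OF L(1)])
      (auto simp: span_eq_iff[THEN iffD2, OF subspace_H])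
  then have "dim (L ` H) = dim (H :: (real ^ 'k) set)" using L(1) by (intro dim_image_eq)
  then show ?thesis
    using L by (intro subspace_dim_equal linear_subspace_image subspace_H) auto
qed

lemma bounded_subsequence:
  fixes f :: "nat \<Rightarrow> 'a::heine_borel"
  assumes "bounded (range f)"
  obtains l r where "strict_mono r" "(f \<circ> r) \<longlonglongrightarrow> l"
  using bounded_imp_convergent_subsequence[OF assms] by blast

text \<open>An implicit function theorem: the minimiser of \<open>norm (h (_, lam))\<close> over a small ball is
  an interior critical point, and is a zero because the linearization there is almost onto.\<close>

lemma nondegenerate_zero_persists:
  fixes h :: "(real ^ 'k::finite) \<times> real \<Rightarrow> real ^ 'k"
  assumes h: "smooth_family h" and z: "x0 \<in> H" "h (x0, lam0) = 0"
    and inj: "\<And>u. u \<in> H \<Longrightarrow> linearization h (x0, lam0) u = 0 \<Longrightarrow> u = 0"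
    and r: "r > 0"
  shows "\<exists>\<delta>>0. \<forall>lam. \<bar>lam - lam0\<bar> < \<delta> \<longrightarrow> (\<exists>x\<in>H. dist x x0 < r \<and> h (x, lam) = 0)"
proof -
  have hs: "smooth_on_subspace HR h" using h by (simp add: smooth_family_def)
  let ?L = "\<lambda>x lam. linearization h (x, lam)"
  note lin0 = linear_linearization[OF hs z(1), of lam0]
  obtain c where c: "c > 0" "\<And>u. u \<in> H \<Longrightarrow> norm (?L x0 lam0 u) \<ge> c * norm u"
    using injective_imp_isometric[OF closed_H subspace_H linear_conv_bounded_linear[THEN iffD1, OF lin0]] inj
    by blast
  have "\<forall>e>0. \<exists>d>0. \<forall>y\<in>H. norm (y - x0) < d \<longrightarrow>
      norm (h (y, lam0) - h (x0, lam0) - ?L x0 lam0 (y - x0)) \<le> e * norm (y - x0)"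
    using smooth_slice_has_derivative[OF hs z(1), of lam0] unfolding has_derivative_within_alt by blast
  then obtain d where d: "d > 0" "\<And>y. y \<in> H \<Longrightarrow> norm (y - x0) < d \<Longrightarrow>
      norm (h (y, lam0) - h (x0, lam0) - ?L x0 lam0 (y - x0)) \<le> (c / 2) * norm (y - x0)"
    using c(1) by (meson half_gt_zero)
  \<comment> \<open>At the parameter \<open>lam0\<close> the point \<open>x0\<close> is the only
    zero within distance \<open>d\<close>; this identifies the limit of the minimisers
    below.\<close>
  have isolated: "y = x0" if "y \<in> H" "norm (y - x0) < d" "h (y, lam0) = 0" for y
  proof -
    have "c * norm (y - x0) \<le> (c / 2) * norm (y - x0)"
      using c(2)[of "y - x0"] d(2)[OF that(1,2)] that z subspace_diff[OF subspace_H] by fastforce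
    then show ?thesis using c(1) by simp
  qed
  \<comment> \<open>Strictly smaller than \<open>r\<close> and \<open>d\<close>: the closed ball
    stays where zeros are excluded for the chosen parameters and where \<open>x0\<close> is
    isolated.\<close>
  define r1 where "r1 = min (r / 2) (d / 2)"
  have r1: "r1 > 0" "r1 < r" "r1 < d" using r d(1) by (auto simp: r1_def)
  let ?C = "cball x0 r1 \<inter> H"
  have C: "compact ?C" "x0 \<in> ?C" using r1 z by (auto intro: compact_Int_closed closed_H)
  have cont: "continuous_on HR h" using smooth_continuous[OF hs, of "[]"] by simp
  have cont_slice: "continuous_on ?C (\<lambda>x. norm (h (x, lam)))" for lam
    by (intro continuous_on_norm continuous_on_compose2[OF cont]) (auto intro!: continuous_intros simp: HR_def)
  show ?thesis
  proof (rule ccontr)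
    assume neg: "\<not> ?thesis"
    have "\<exists>lam. \<bar>lam - lam0\<bar> < inverse (real (Suc n)) \<and> (\<forall>x\<in>H. dist x x0 < r \<longrightarrow> h (x, lam) \<noteq> 0)" for n
    proof (rule ccontr)
      assume "\<not> ?thesis"
      then have "\<forall>lam. \<bar>lam - lam0\<bar> < inverse (real (Suc n)) \<longrightarrow> (\<exists>x\<in>H. dist x x0 < r \<and> h (x, lam) = 0)"
        by blast
      then show False using neg by (metis inverse_positive_iff_positive of_nat_0_less_iff zero_less_Suc)
    qed
    then obtain lam where lam: "\<And>n. \<bar>lam n - lam0\<bar> < inverse (real (Suc n))"
      "\<And>n x. x \<in> H \<Longrightarrow> dist x x0 < r \<Longrightarrow> h (x, lam n) \<noteq> 0"
      by metis
    have lam_lim: "lam \<longlonglongrightarrow> lam0"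
    proof -
      have "(\<lambda>n. lam n - lam0) \<longlonglongrightarrow> 0"
        by (rule Lim_null_comparison[OF _ LIMSEQ_inverse_real_of_nat])
           (use lam(1) less_imp_le in \<open>auto intro!: always_eventually\<close>)
      then show ?thesis by (simp add: LIM_zero_iff)
    qed
    have "\<exists>x\<in>?C. \<forall>y\<in>?C. norm (h (x, lam n)) \<le> norm (h (y, lam n))" for n
      using continuous_attains_inf[OF C(1) _ cont_slice] C(2) by blast
    then obtain x where x: "\<And>n. x n \<in> ?C"
      "\<And>n y. y \<in> ?C \<Longrightarrow> norm (h (x n, lam n)) \<le> norm (h (y, lam n))"
      by metis
    have nz: "h (x n, lam n) \<noteq> 0" for n
      using lam(2)[of "x n" n] x(1)[of n] r1 by (auto simp: dist_commute)
    \<comment> \<open>The residual is normalised so that its direction survives in the limit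
      although the residual itself tends to 0.\<close>
    define z where "z n = (1 / norm (h (x n, lam n))) *\<^sub>R h (x n, lam n)" for n
    have zn: "norm (z n) = 1" for n using nz by (simp add: z_def)
    have zH: "z n \<in> H" for n
      unfolding z_def using h x(1)[of n]
      by (intro subspace_scale[OF subspace_H]) (auto simp: smooth_family_def HR_def)
    have bnd: "bounded (range (\<lambda>n. (x n, z n)))"
    proof -
      have "norm (x n, z n) \<le> (norm x0 + r1) + 1" for n
      proof -
        have "norm (x n, z n) \<le> norm (x n) + norm (z n)" by (rule norm_Pair_le)
        also have "norm (x n) \<le> norm x0 + r1"
          using x(1)[of n] norm_triangle_ineq2[of "x n" x0] by (auto simp: dist_norm norm_minus_commute)
        finally show ?thesis using zn by simp
      qed
      then show ?thesis by (auto intro: boundedI)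
    qed
    obtain p s where s: "strict_mono s" "((\<lambda>n. (x n, z n)) \<circ> s) \<longlonglongrightarrow> p"
      using bounded_subsequence[OF bnd] by blast
    have xs: "(\<lambda>n. x (s n)) \<longlonglongrightarrow> fst p" and zs: "(\<lambda>n. z (s n)) \<longlonglongrightarrow> snd p"
      using tendsto_fst[OF s(2)] tendsto_snd[OF s(2)] by (simp_all add: o_def)
    have lams: "(\<lambda>n. lam (s n)) \<longlonglongrightarrow> lam0"
      using LIMSEQ_subseq_LIMSEQ[OF lam_lim s(1)] by (simp add: o_def)
    have xC: "fst p \<in> ?C" using closed_sequentially[OF compact_imp_closed[OF C(1)] _ xs] x(1) by blast
    have "(\<lambda>n. h (x0, lam (s n))) \<longlonglongrightarrow> h (x0, lam0)"
      using C(2) by (intro continuous_on_tendsto_compose[OF cont] tendsto_Pair lams tendsto_const)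
        (auto simp: HR_def)
    then have "(\<lambda>n. norm (h (x0, lam (s n)))) \<longlonglongrightarrow> 0" using z(2) tendsto_norm by fastforce
    then have "(\<lambda>n. h (x (s n), lam (s n))) \<longlonglongrightarrow> 0"
      by (rule Lim_null_comparison[rotated]) (use x(2) C(2) in \<open>auto intro!: always_eventually\<close>)
    moreover have "(\<lambda>n. h (x (s n), lam (s n))) \<longlonglongrightarrow> h (fst p, lam0)"
      using x(1) xC by (intro continuous_on_tendsto_compose[OF cont] tendsto_Pair xs lams) (auto simp: HR_def)
    ultimately have "h (fst p, lam0) = 0" using LIMSEQ_unique by blast
    then have fp: "fst p = x0"
      using isolated[of "fst p"] xC r1 by (auto simp: dist_norm norm_minus_commute)
    have zp: "norm (snd p) = 1"
      using LIMSEQ_unique[OF tendsto_norm[OF zs]] zn by (simp add: tendsto_const)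
    have zpH: "snd p \<in> H" using closed_sequentially[OF closed_H _ zs] zH by blast
    have ev: "\<forall>\<^sub>F n in sequentially. dist (x (s n)) x0 < r1"
      using tendstoD[OF xs[unfolded fp] r1(1)] .
    \<comment> \<open>Once the minimiser is interior, the derivative of |h|^2 vanishes in every
      direction of \<open>H\<close>, so the residual is orthogonal to the range of the
      linearization.\<close>
    have crit: "z (s n) \<bullet> ?L (x (s n)) (lam (s n)) u = 0" if n: "dist (x (s n)) x0 < r1" and u: "u \<in> H" for n u
    proof -
      define \<xi> where "\<xi> = x (s n)"
      define mu where "mu = lam (s n)"
      have \<xi>: "\<xi> \<in> H" using x(1) by (simp add: \<xi>_def)
      have line: "((\<lambda>t. \<xi> + t *\<^sub>R u) has_derivative (\<lambda>t. t *\<^sub>R u)) (at 0)"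
        by (auto intro!: derivative_eq_intros)
      have "range (\<lambda>t. \<xi> + t *\<^sub>R u) \<subseteq> H"
        using \<xi> u by (auto intro!: subspace_add[OF subspace_H] subspace_scale[OF subspace_H])
      then have "((\<lambda>y. h (y, mu)) has_derivative ?L \<xi> mu) (at (\<xi> + 0 *\<^sub>R u) within range (\<lambda>t. \<xi> + t *\<^sub>R u))"
        using smooth_slice_has_derivative[OF hs \<xi>] by (auto intro: has_derivative_subset)
      from has_derivative_in_compose[OF line this]
      have der: "((\<lambda>t. h (\<xi> + t *\<^sub>R u, mu)) has_derivative (\<lambda>t. t *\<^sub>R ?L \<xi> mu u)) (at 0)"
        using linear_scale[OF linear_linearization[OF hs \<xi>]] by simp
      have "((\<lambda>t. h (\<xi> + t *\<^sub>R u, mu) \<bullet> h (\<xi> + t *\<^sub>R u, mu)) has_field_derivative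
          2 * (h (\<xi>, mu) \<bullet> ?L \<xi> mu u)) (at 0)"
        unfolding has_field_derivative_def
        by (rule has_derivative_eq_rhs[OF has_derivative_inner[OF der der]])
           (auto simp: inner_commute)
      moreover have "\<exists>e>0. \<forall>t. \<bar>0 - t\<bar> < e \<longrightarrow>
          h (\<xi> + 0 *\<^sub>R u, mu) \<bullet> h (\<xi> + 0 *\<^sub>R u, mu) \<le> h (\<xi> + t *\<^sub>R u, mu) \<bullet> h (\<xi> + t *\<^sub>R u, mu)"
      proof (intro exI[of _ "(r1 - dist \<xi> x0) / (norm u + 1)"] conjI allI impI)
        have nu: "norm u + 1 > 0" using norm_ge_zero[of u] by linarith
        show "(r1 - dist \<xi> x0) / (norm u + 1) > 0"
          using n nu by (simp add: \<xi>_def)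
        fix t assume "\<bar>0 - t\<bar> < (r1 - dist \<xi> x0) / (norm u + 1)"
        then have "\<bar>t\<bar> * (norm u + 1) < r1 - dist \<xi> x0" using nu by (simp add: pos_less_divide_eq)
        then have "\<bar>t\<bar> * norm u \<le> r1 - dist \<xi> x0" by (simp add: distrib_left)
        then have "dist (\<xi> + t *\<^sub>R u) x0 \<le> r1"
          using dist_triangle[of "\<xi> + t *\<^sub>R u" x0 \<xi>] by (simp add: dist_norm)
        then have "\<xi> + t *\<^sub>R u \<in> ?C"
          using \<xi> u by (auto simp: dist_commute intro!: subspace_add[OF subspace_H] subspace_scale[OF subspace_H])
        then have "norm (h (\<xi>, mu)) \<le> norm (h (\<xi> + t *\<^sub>R u, mu))" using x(2) by (simp add: \<xi>_def mu_def)
        then show "h (\<xi> + 0 *\<^sub>R u, mu) \<bullet> h (\<xi> + 0 *\<^sub>R u, mu) \<le> h (\<xi> + t *\<^sub>R u, mu) \<bullet> h (\<xi> + t *\<^sub>R u, mu)"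
          by (simp add: norm_le)
      qed
      ultimately have "2 * (h (\<xi>, mu) \<bullet> ?L \<xi> mu u) = 0"
        by (metis (mono_tags, lifting) DERIV_local_min)
      then show ?thesis by (simp add: z_def \<xi>_def mu_def)
    qed
    have orth: "snd p \<bullet> ?L x0 lam0 u = 0" if u: "u \<in> H" for u
    proof -
      have "(\<lambda>n. z (s n) \<bullet> ?L (x (s n)) (lam (s n)) u) \<longlonglongrightarrow> snd p \<bullet> ?L x0 lam0 u"
        using x(1) z(1) xs by (intro tendsto_inner zs linearization_tendsto[OF hs u] lams) (auto simp: fp)
      moreover have "(\<lambda>n. z (s n) \<bullet> ?L (x (s n)) (lam (s n)) u) \<longlonglongrightarrow> 0"
        by (rule tendsto_eventually) (use ev crit u in \<open>auto elim!: eventually_mono\<close>)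
      ultimately show ?thesis using LIMSEQ_unique by blast
    qed
    have "?L x0 lam0 ` H = H"
      by (rule linear_inj_on_H_surj[OF lin0 linearization_in_H[OF h z(1)] inj])
    with zpH have "snd p \<in> ?L x0 lam0 ` H" by simp
    then obtain u where u: "u \<in> H" "?L x0 lam0 u = snd p" by (elim imageE) simp
    have "snd p \<bullet> snd p = 0" using orth[OF u(1)] u(2) by simp
    then show False using zp by simp
  qed
qed

lemma linearization_cong:
  assumes "open U" "(x, lam) \<in> U" "x \<in> H" "\<And>p. p \<in> HR \<Longrightarrow> p \<in> U \<Longrightarrow> h p = g p"
  shows "linearization h (x, lam) = linearization g (x, lam)"
proof -
  have "open ((\<lambda>y. (y, lam)) -` U)" by (intro open_vimage assms continuous_intros)
  then obtain d where d: "d > 0" "\<And>y. dist y x < d \<Longrightarrow> (y, lam) \<in> U"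
    using assms(2) by (auto simp: open_dist)
  have "((\<lambda>y. h (y, lam)) has_derivative D) (at x within H) \<longleftrightarrow>
      ((\<lambda>y. g (y, lam)) has_derivative D) (at x within H)" for D
    using has_derivative_transform_within[OF _ d(1) assms(3), of _ D] d(2) assms(4)
    by (smt (verit) HR_iff)
  then show ?thesis by (simp add: linearization_def frechet_derivative_def)
qed

lemma pert_has_derivative: "((\<lambda>y. pert i0 t y lam) has_derivative lin x lam) (at x within A)"
proof -
  have "((\<lambda>y. B_form y y) has_derivative (\<lambda>u. B_form x u + B_form u x)) (at x within A)"
    using B_form.FDERIV[OF has_derivative_ident has_derivative_ident] .
  then show ?thesis
    unfolding pert_def Q_eq_B_form lin_def
    by (auto intro!: derivative_eq_intros simp: B_form_commute[of _ x] scaleR_2)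
qed

section \<open>The perturbed family and its folds\<close>

text \<open>\<open>N\<close> is a neighbourhood of the zeros on which the cutoff in the space variable is invisible.
  All folds lie where \<open>lam\<^sup>2 < a\<close>, so that the perturbation is constant near them.\<close>

locale perturbed_family = odd_index i0 l
  for i0 :: "'k::finite" and l :: nat +
  fixes \<eta> a :: real and \<theta> :: "real \<Rightarrow> real"
    and g :: "(real ^ 'k) \<times> real \<Rightarrow> real ^ 'k" and N :: "((real ^ 'k) \<times> real) set"
  assumes eta_pos: "\<eta> > 0"
    and theta_cont: "continuous_on UNIV \<theta>"
    and theta_nonneg: "\<And>t. 0 \<le> \<theta> t" and theta_le: "\<And>t. \<theta> t \<le> \<eta>"
    and theta_eq: "\<And>t. t\<^sup>2 < a \<Longrightarrow> \<theta> t = \<eta>"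
    and a_gt: "4 * kk * \<eta> < a"
    and g_smooth: "smooth_family g"
    and N_open: "open N"
    and g_eq: "\<And>x lam. x \<in> H \<Longrightarrow> (x, lam) \<in> N \<Longrightarrow> g (x, lam) = pert i0 (\<theta> lam) x lam"
    and zeros_N: "zeros g \<subseteq> N"
    and pert_N: "\<And>x lam. x \<in> H \<Longrightarrow> pert i0 (\<theta> lam) x lam = 0 \<Longrightarrow> (x, lam) \<in> N"
begin

definition sol_eq :: "'k set \<Rightarrow> real \<Rightarrow> real \<Rightarrow> bool" where
  "sol_eq S s lam \<longleftrightarrow> (kk * lam / 2 + excess S * s)\<^sup>2 = s\<^sup>2 - kk * \<theta> lam"

definition closed_orthant :: "'k set \<Rightarrow> ((real ^ 'k) \<times> real) set" where
  "closed_orthant S = {(x, lam). \<forall>j\<in>others. sgn_of S j * (x $ j - lam / 2) \<ge> 0}"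

lemma a_pos: "a > 0"
  using a_gt eta_pos kk_pos by (meson less_trans mult_pos_pos zero_less_numeral)

lemma theta_0: "\<theta> 0 = \<eta>"
  using theta_eq[of 0] a_pos by simp

lemma g_smooth_on: "smooth_on_subspace HR g"
  using g_smooth by (simp add: smooth_family_def)

text \<open>Both zero sets lie in \<open>N\<close>, where the two maps agree.\<close>

lemma zeros_iff: "(x, lam) \<in> zeros g \<longleftrightarrow> x \<in> H \<and> pert i0 (\<theta> lam) x lam = 0"
  using zeros_N g_eq pert_N by (fastforce simp: zeros_def HR_def)

lemma zerosE:
  assumes "(x, lam) \<in> zeros g"
  obtains S s where "S \<subseteq> others" "s > 0" "x = sol S s lam" "sol_eq S s lam" "(x, lam) \<in> orthant S"
proof -
  have x: "x \<in> H" "pert i0 (\<theta> lam) x lam = 0" using assms zeros_iff by auto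
  obtain S s where S: "S \<subseteq> others" "s \<ge> 0" "x = sol S s lam"
    "(kk * lam / 2 + excess S * s)\<^sup>2 = s\<^sup>2 - kk * \<theta> lam"
    using pert_zeroD[OF x theta_nonneg] .
  \<comment> \<open>At s = 0 the equation is a sum of two nonnegative terms equal to 0, forcing
    \<lambda> = 0 and \<theta> 0 = 0, whereas \<theta> 0 = \<eta>.\<close>
  have "s \<noteq> 0"
  proof
    assume "s = 0"
    then have "(kk * lam / 2)\<^sup>2 + kk * \<theta> lam = 0" using S(4) by simp
    moreover have "kk * \<theta> lam \<ge> 0" using theta_nonneg kk_pos by simp
    ultimately have "(kk * lam / 2)\<^sup>2 = 0" "kk * \<theta> lam = 0"
      using zero_le_power2[of "kk * lam / 2"] by linarith+
    then have "lam = 0" "\<theta> lam = 0" using kk_pos by auto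
    then show False using theta_0 eta_pos by simp
  qed
  then have "s > 0" using S(2) by simp
  then show thesis using that[OF S(1) _ S(3)] S(3,4) sol_in_orthant[of S s lam] by (simp add: sol_eq_def)
qed

lemma sol_zero: "S \<subseteq> others \<Longrightarrow> sol_eq S s lam \<Longrightarrow> (sol S s lam, lam) \<in> zeros g"
  by (simp add: zeros_iff sol_in_H pert_sol_eq_0 sol_eq_def)

lemma zeros_orthantE:
  assumes "(x, lam) \<in> zeros g" "(x, lam) \<in> orthant S" "S \<subseteq> others"
  obtains s where "s > 0" "x = sol S s lam" "sol_eq S s lam"
  using zerosE[OF assms(1)] orthant_disjoint[OF assms(3) _ assms(2)] by metis

lemma closed_closed_orthant: "closed (closed_orthant S)"
proof -
  have "closed_orthant S = (\<Inter>j\<in>others. {p. 0 \<le> sgn_of S j * (fst p $ j - snd p / 2)})"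
    by (auto simp: closed_orthant_def)
  moreover have "closed {p :: (real ^ 'k) \<times> real. 0 \<le> sgn_of S j * (fst p $ j - snd p / 2)}" for j
    by (intro closed_Collect_le continuous_intros; simp)
  ultimately show ?thesis by auto
qed

lemma orthant_subset_closed: "orthant S \<subseteq> closed_orthant S"
  unfolding orthant_def closed_orthant_def using less_imp_le by blast

lemma orthant_closed_orthant_eq:
  assumes "p \<in> orthant S'" "p \<in> closed_orthant S" "S \<subseteq> others" "S' \<subseteq> others"
  shows "S = S'"
proof -
  obtain x lam where p: "p = (x, lam)" by (cases p)
  have "sgn_of S j = sgn_of S' j" if "j \<in> others" for j
    using that assms(1,2) unfolding p orthant_def closed_orthant_def sgn_of_def
    by (fastforce dest!: bspec[of _ _ j] split: if_splits)
  then show ?thesis using assms(3,4) by (force simp: sgn_of_def split: if_splits)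
qed

text \<open>Every zero has all its deviations nonzero, so it cannot sit on the boundary. Limits of
  zeros therefore stay in the same open orthant.\<close>

lemma zeros_closed_orthant:
  assumes "p \<in> zeros g" "p \<in> closed_orthant S" "S \<subseteq> others"
  shows "p \<in> orthant S"
  using zerosE[of "fst p" "snd p"] orthant_closed_orthant_eq[OF _ assms(2,3)] assms(1) by (metis prod.collapse)

lemma linearization_g:
  assumes "x \<in> H" "(x, lam) \<in> N" "u \<in> H"
  shows "linearization g (x, lam) u = lin x lam u"
proof -
  have "open ((\<lambda>y. (y, lam)) -` N)" by (intro open_vimage N_open continuous_intros)
  then obtain d where d: "d > 0" "\<And>y. dist y x < d \<Longrightarrow> (y, lam) \<in> N"
    using assms(2) by (auto simp: open_dist)
  have "((\<lambda>y. g (y, lam)) has_derivative lin x lam) (at x within H)"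
    by (rule has_derivative_transform_within[OF pert_has_derivative d(1) assms(1)])
       (use d(2) g_eq in auto)
  from frechet_derivative_within_subspace[OF subspace_H assms(1,3) this] show ?thesis
    by (simp add: linearization_def)
qed

lemma second_derivative_g:
  assumes x: "x \<in> H" "(x, lam) \<in> N" and uv: "u \<in> H" "v \<in> H"
  shows "deriv_on H (\<lambda>y. g (y, lam)) [u, v] x = - 2 *\<^sub>R B_form u v"
proof -
  have op: "open ((\<lambda>y. (y, lam)) -` N)" by (intro open_vimage N_open continuous_intros)
  have "deriv_on H (\<lambda>y. g (y, lam)) [u, v] x = deriv_on H (\<lambda>y. pert i0 (\<theta> lam) y lam) [u, v] x"
    by (rule deriv_on_local_cong[OF op _ x(1)]) (use x g_eq in auto)
  also have "\<dots> = - 2 *\<^sub>R B_form u v"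
  proof (rule deriv_on_Cons_eq[OF subspace_H x(1) uv(1)])
    show "deriv_on H (\<lambda>y. pert i0 (\<theta> lam) y lam) [v] q = lam *\<^sub>R v - 2 *\<^sub>R B_form q v" if "q \<in> H" for q
      using frechet_derivative_within_subspace[OF subspace_H that uv(2) pert_has_derivative]
      by (simp add: lin_def)
    show "((\<lambda>q. lam *\<^sub>R v - 2 *\<^sub>R B_form q v) has_derivative (\<lambda>u. - 2 *\<^sub>R B_form u v)) (at x within H)"
      by (auto intro!: derivative_eq_intros B_form.bounded_linear_left[THEN bounded_linear.has_derivative])
  qed
  finally show ?thesis .
qed

lemma parameter_derivative_g:
  assumes x: "x \<in> H" "(x, lam) \<in> N" and lam: "lam\<^sup>2 < a"
  shows "vector_derivative (\<lambda>\<mu>. g (x, \<mu>)) (at lam) = x"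
proof (rule vector_derivative_at)
  have "open ((\<lambda>\<mu>. (x, \<mu>)) -` N)" by (intro open_vimage N_open continuous_intros)
  moreover have "open {\<mu>::real. \<mu>\<^sup>2 < a}" by (intro open_Collect_less continuous_intros)
  ultimately have op: "open ((\<lambda>\<mu>. (x, \<mu>)) -` N \<inter> {\<mu>. \<mu>\<^sup>2 < a})" by (rule open_Int)
  have "((\<lambda>\<mu>. pert i0 \<eta> x \<mu>) has_vector_derivative x) (at lam)"
    unfolding pert_def by (auto intro!: derivative_eq_intros)
  then show "((\<lambda>\<mu>. g (x, \<mu>)) has_vector_derivative x) (at lam)"
    by (rule has_vector_derivative_transform_within_open[OF _ op]) (use x lam g_eq theta_eq in auto)
qed

lemma sol_eq_bounds:
  assumes "sol_eq S s lam" "s > 0"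
  shows "\<bar>kk * lam / 2 + excess S * s\<bar> \<le> s"
proof -
  have "kk * \<theta> lam \<ge> 0" using theta_nonneg kk_pos by simp
  then have "(kk * lam / 2 + excess S * s)\<^sup>2 \<le> s\<^sup>2" using assms(1) by (simp add: sol_eq_def)
  then show ?thesis using assms(2) by (metis abs_le_square_iff abs_of_pos)
qed

text \<open>From |k\<lambda>/2 + ms| <= s and |m| >= 2 the term k\<lambda>/2 must counteract ms. An
  unbalanced curve is thus confined to one side of \<lambda> = 0 and cannot cross.\<close>

lemma sol_eq_sign:
  assumes "sol_eq S s lam" "s > 0" "excess S \<noteq> 0"
  shows "excess S * lam < 0"
proof -
  note b = sol_eq_bounds[OF assms(1,2)]
  consider "excess S \<le> - 2" | "excess S \<ge> 2" using excess_cases[OF assms(3)] by blast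
  then show ?thesis
  proof cases
    case 1
    then have "excess S * s \<le> - 2 * s" using assms(2) by (intro mult_right_mono) auto
    then have "kk * lam > 0" using b assms(2) by linarith
    then show ?thesis using 1 kk_pos by (simp add: zero_less_mult_iff mult_neg_pos)
  next
    case 2
    then have "excess S * s \<ge> 2 * s" using assms(2) by (intro mult_right_mono) auto
    then have "kk * lam < 0" using b assms(2) by linarith
    then show ?thesis using 2 kk_pos by (simp add: mult_less_0_iff mult_pos_neg)
  qed
qed

lemma zeros_balanced_unique:
  assumes "(x, lam) \<in> zeros g" "(x', lam) \<in> zeros g" "(x, lam) \<in> orthant S" "(x', lam) \<in> orthant S"
    "S \<subseteq> others" "excess S = 0"
  shows "x = x'"
proof -
  obtain s where s: "s > 0" "x = sol S s lam" "sol_eq S s lam"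
    using zeros_orthantE[OF assms(1,3,5)] .
  obtain s' where s': "s' > 0" "x' = sol S s' lam" "sol_eq S s' lam"
    using zeros_orthantE[OF assms(2,4,5)] .
  have "s\<^sup>2 = s'\<^sup>2" using s(3) s'(3) assms(6) by (simp add: sol_eq_def)
  then show ?thesis using s s' by (simp add: power2_eq_iff)
qed

lemma balanced_zero_exists:
  assumes "S \<subseteq> others" "excess S = 0"
  shows "\<exists>x. (x, lam) \<in> zeros g \<inter> orthant S"
proof -
  define s where "s = sqrt ((kk * lam / 2)\<^sup>2 + kk * \<theta> lam)"
  have nn: "kk * \<theta> lam \<ge> 0" using theta_nonneg kk_pos by simp
  have "(kk * lam / 2)\<^sup>2 + kk * \<theta> lam \<noteq> 0"
  proof
    assume "(kk * lam / 2)\<^sup>2 + kk * \<theta> lam = 0"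
    then have "(kk * lam / 2)\<^sup>2 = 0" "kk * \<theta> lam = 0"
      using zero_le_power2[of "kk * lam / 2"] nn by linarith+
    then have "lam = 0" "\<theta> lam = 0" using kk_pos by auto
    then show False using theta_0 eta_pos by simp
  qed
  then have pos: "(kk * lam / 2)\<^sup>2 + kk * \<theta> lam > 0"
    using zero_le_power2[of "kk * lam / 2"] nn by linarith
  then have s: "s > 0" "s\<^sup>2 = (kk * lam / 2)\<^sup>2 + kk * \<theta> lam" by (simp_all add: s_def less_imp_le)
  then have "sol_eq S s lam" using assms(2) by (simp add: sol_eq_def)
  then show ?thesis using sol_zero[OF assms(1)] sol_in_orthant[of S s lam] s(1) by blast
qed

text \<open>With y = k\<lambda>/2 + ms, the degeneracy condition s = my and the zero equation y^2 =
  s^2 - k\<eta> give s^2 (1 - 1/m^2) = k\<eta>. Then \<lambda> follows from y = s/m.\<close>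

definition fold_s :: "'k set \<Rightarrow> real" where
  "fold_s S = sqrt (kk * \<eta> * (excess S)\<^sup>2 / ((excess S)\<^sup>2 - 1))"

definition fold_lam :: "'k set \<Rightarrow> real" where
  "fold_lam S = 2 * (fold_s S / excess S - excess S * fold_s S) / kk"

definition fold_pt :: "'k set \<Rightarrow> (real ^ 'k) \<times> real" where
  "fold_pt S = (sol S (fold_s S) (fold_lam S), fold_lam S)"

lemma fold_s_facts:
  assumes "excess S \<noteq> 0"
  shows "fold_s S > 0" "(fold_s S)\<^sup>2 = kk * \<eta> * (excess S)\<^sup>2 / ((excess S)\<^sup>2 - 1)"
proof -
  have "kk * \<eta> * (excess S)\<^sup>2 / ((excess S)\<^sup>2 - 1) > 0"
    using excess_square[OF assms] kk_pos eta_pos assms by (intro divide_pos_pos mult_pos_pos) auto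
  then show "fold_s S > 0" "(fold_s S)\<^sup>2 = kk * \<eta> * (excess S)\<^sup>2 / ((excess S)\<^sup>2 - 1)"
    by (simp_all add: fold_s_def less_imp_le)
qed

lemma fold_y:
  assumes "excess S \<noteq> 0"
  shows "kk * fold_lam S / 2 + excess S * fold_s S = fold_s S / excess S"
proof -
  have "kk \<noteq> 0" using kk_pos by simp
  then have "kk * fold_lam S = 2 * (fold_s S / excess S - excess S * fold_s S)"
    unfolding fold_lam_def by (rule nonzero_mult_div_cancel_left[of kk _, unfolded times_divide_eq_right[symmetric]])
  moreover have "x / 2 + z = y" if "x = 2 * (y - z)" for x y z :: real
    using that by (simp add: field_simps)
  ultimately show ?thesis by blast
qed

lemma fold_lam_square:
  assumes "excess S \<noteq> 0"
  shows "kk * (fold_lam S)\<^sup>2 = 4 * ((excess S)\<^sup>2 - 1) * \<eta>"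
proof -
  let ?m = "excess S" and ?s = "fold_s S"
  have m: "?m\<^sup>2 - 1 > 0" "?m \<noteq> 0" using excess_square[OF assms] assms by auto
  have "kk * fold_lam S = - 2 * ((?m\<^sup>2 - 1) / ?m) * ?s"
    using kk_pos m(2) by (simp add: fold_lam_def field_simps power2_eq_square)
  moreover have "(- 2 * X * s)\<^sup>2 = (2 * X)\<^sup>2 * s\<^sup>2" for X s :: real by (simp add: power_mult_distrib)
  ultimately have "(kk * fold_lam S)\<^sup>2 = (2 * ((?m\<^sup>2 - 1) / ?m))\<^sup>2 * ?s\<^sup>2" by metis
  also have "\<dots> = (2 * ((?m\<^sup>2 - 1) / ?m))\<^sup>2 * (kk * \<eta> * ?m\<^sup>2 / (?m\<^sup>2 - 1))"
    by (simp only: fold_s_facts(2)[OF assms])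
  also have "\<dots> = 4 * (?m\<^sup>2 - 1) * (kk * \<eta>)"
  proof -
    have "(2 * (M / m))\<^sup>2 * (c * m\<^sup>2 / M) = 4 * M * c" if "M \<noteq> 0" "m \<noteq> 0" for M m c :: real
      using that by (simp add: power2_eq_square)
    moreover have "?m\<^sup>2 - 1 \<noteq> 0" using m by simp
    ultimately show ?thesis using m(2) by blast
  qed
  finally have "kk * (kk * (fold_lam S)\<^sup>2) = kk * (4 * (?m\<^sup>2 - 1) * \<eta>)"
    by (simp add: power2_eq_square mult_ac)
  then show ?thesis using kk_pos by simp
qed

lemma excess_square_less: "S \<subseteq> others \<Longrightarrow> (excess S)\<^sup>2 < kk\<^sup>2"
  using abs_excess_less[of S] power_strict_mono[of "\<bar>excess S\<bar>" kk 2] by simp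

text \<open>Since m^2 < k^2, every fold has \<lambda>^2 <= 4k\<eta>; this is the origin of the
  requirement \<open>a_gt\<close>.\<close>

lemma fold_lam_small:
  assumes "S \<subseteq> others" "excess S \<noteq> 0"
  shows "(fold_lam S)\<^sup>2 < a"
proof -
  have "kk * (fold_lam S)\<^sup>2 \<le> 4 * kk\<^sup>2 * \<eta>"
    unfolding fold_lam_square[OF assms(2)] using excess_square_less[OF assms(1)] eta_pos
    by (intro mult_right_mono) auto
  then have "(fold_lam S)\<^sup>2 \<le> 4 * kk * \<eta>" using kk_pos by (simp add: power2_eq_square mult_ac)
  then show ?thesis using a_gt by simp
qed

lemma fold_sol_eq:
  assumes "S \<subseteq> others" "excess S \<noteq> 0"
  shows "sol_eq S (fold_s S) (fold_lam S)"
proof -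
  let ?m = "excess S" and ?s = "fold_s S"
  have m: "?m\<^sup>2 - 1 > 0" "?m \<noteq> 0" using excess_square[OF assms(2)] assms by auto
  have "?s\<^sup>2 * (?m\<^sup>2 - 1) = kk * \<eta> * ?m\<^sup>2" using m by (simp add: fold_s_facts(2)[OF assms(2)])
  then have "?s\<^sup>2 = (?s\<^sup>2 - kk * \<eta>) * ?m\<^sup>2" by (simp add: algebra_simps)
  moreover have "?m\<^sup>2 \<noteq> 0" using m by simp
  ultimately have "(?s / ?m)\<^sup>2 = ?s\<^sup>2 - kk * \<eta>"
    by (metis power_divide nonzero_divide_eq_eq)
  then show ?thesis
    unfolding sol_eq_def fold_y[OF assms(2)] theta_eq[OF fold_lam_small[OF assms]] .
qed

lemma fold_pt_zero:
  assumes "S \<subseteq> others" "excess S \<noteq> 0"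
  shows "fold_pt S \<in> zeros g" "fold_pt S \<in> orthant S"
  using sol_zero[OF assms(1) fold_sol_eq[OF assms]] sol_in_orthant fold_s_facts(1)[OF assms(2)]
  by (simp_all add: fold_pt_def)

text \<open>A degenerate zero might a priori lie where \<theta> is below \<eta>. The relation
  k\<lambda>^2 = 4(m^2 - 1) \<theta> holds with the actual value of \<theta>, and \<theta> <= \<eta>
  already places \<lambda>^2 below \<open>a\<close>; there \<theta> = \<eta>, and the zero is the
  computed fold.\<close>

lemma degenerate_zero:
  assumes z: "(x, lam) \<in> zeros g" "(x, lam) \<in> orthant S" and S: "S \<subseteq> others"
    and u: "u \<in> H" "u \<noteq> 0" "lin x lam u = 0"
  shows "excess S \<noteq> 0" "(x, lam) = fold_pt S" "\<exists>c. u = c *\<^sub>R ker_vec S"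
proof -
  let ?m = "excess S"
  obtain s where s: "s > 0" "x = sol S s lam" "sol_eq S s lam" using zeros_orthantE[OF z S] .
  define y where "y = kk * lam / 2 + ?m * s"
  have k: "s = ?m * y" "\<exists>c. u = c *\<^sub>R ker_vec S"
    using lin_kernel[OF S s(1) u(1,2)] u(3) s(2) by (auto simp: y_def)
  show "\<exists>c. u = c *\<^sub>R ker_vec S" by (rule k)
  show m0: "?m \<noteq> 0" using k(1) s(1) by auto
  have m: "?m\<^sup>2 - 1 > 0" using excess_square[OF m0] by simp
  have y2: "y\<^sup>2 = s\<^sup>2 - kk * \<theta> lam" using s(3) by (simp add: sol_eq_def y_def)
  then have th: "kk * \<theta> lam = (?m\<^sup>2 - 1) * y\<^sup>2" by (simp add: k(1) power_mult_distrib algebra_simps)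
  have "kk * lam / 2 = y - ?m * s" by (simp add: y_def)
  also have "?m * s = ?m * (?m * y)" using k(1) by simp
  finally have "kk * lam / 2 = - ((?m\<^sup>2 - 1) * y)" by (simp add: power2_eq_square algebra_simps)
  then have l2: "(kk * lam / 2)\<^sup>2 = (?m\<^sup>2 - 1)\<^sup>2 * y\<^sup>2" by (simp add: power_mult_distrib)
  have "kk\<^sup>2 * lam\<^sup>2 = kk * (4 * (?m\<^sup>2 - 1) * \<theta> lam)"
  proof -
    have "kk\<^sup>2 * lam\<^sup>2 = 4 * (kk * lam / 2)\<^sup>2" by (simp add: power_mult_distrib power_divide)
    also have "\<dots> = 4 * (?m\<^sup>2 - 1) * ((?m\<^sup>2 - 1) * y\<^sup>2)" unfolding l2 by (simp add: power2_eq_square)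
    also have "\<dots> = kk * (4 * (?m\<^sup>2 - 1) * \<theta> lam)" unfolding th[symmetric] by simp
    finally show ?thesis .
  qed
  then have "kk * lam\<^sup>2 = 4 * (?m\<^sup>2 - 1) * \<theta> lam" using kk_pos by (simp add: power2_eq_square)
  also have "\<dots> \<le> 4 * kk\<^sup>2 * \<eta>"
    using theta_nonneg theta_le excess_square_less[OF S] m by (intro mult_mono) auto
  finally have "lam\<^sup>2 \<le> 4 * kk * \<eta>" using kk_pos by (simp add: power2_eq_square mult_ac)
  then have theta: "\<theta> lam = \<eta>" using a_gt by (intro theta_eq) linarith
  have "s\<^sup>2 = ?m\<^sup>2 * y\<^sup>2" by (simp add: k(1) power_mult_distrib)
  also have "y\<^sup>2 = kk * \<eta> / (?m\<^sup>2 - 1)" using th theta m by (simp add: field_simps)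
  finally have "s\<^sup>2 = (fold_s S)\<^sup>2" using fold_s_facts(2)[OF m0] by (simp add: mult_ac)
  then have sf: "s = fold_s S" using s(1) fold_s_facts(1)[OF m0] by (simp add: power2_eq_iff)
  have "y = s / ?m" using k(1) m0 by simp
  then have "lam = fold_lam S"
    using kk_pos by (simp add: y_def fold_lam_def sf[symmetric] field_simps)
  then show "(x, lam) = fold_pt S" using s(2) sf by (simp add: fold_pt_def)
qed

lemma fold_kernel:
  assumes "S \<subseteq> others" "excess S \<noteq> 0"
  shows "lin (fst (fold_pt S)) (snd (fold_pt S)) (ker_vec S) = 0"
    and "ker_vec S \<bullet> fst (fold_pt S) \<noteq> 0"
    and "ker_vec S \<bullet> B_form (ker_vec S) (ker_vec S) \<noteq> 0"
proof -
  have *: "fold_s S = excess S * (kk * fold_lam S / 2 + excess S * fold_s S)"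
    unfolding fold_y[OF assms(2)] using assms(2) by simp
  show "lin (fst (fold_pt S)) (snd (fold_pt S)) (ker_vec S) = 0"
    using lin_ker_vec[OF assms(1) *] by (simp add: fold_pt_def)
  show "ker_vec S \<bullet> fst (fold_pt S) \<noteq> 0"
    using ker_vec_inner_sol[OF assms(1) *] kk_pos fold_s_facts(1)[OF assms(2)] by (simp add: fold_pt_def)
  have "excess S - (excess S) ^ 3 = - (excess S * ((excess S)\<^sup>2 - 1))"
    by (simp add: power2_eq_square power3_eq_cube algebra_simps)
  then show "ker_vec S \<bullet> B_form (ker_vec S) (ker_vec S) \<noteq> 0"
    using ker_vec_cubic[OF assms(1)] excess_square[OF assms(2)] assms(2) by auto
qed

lemma zeros_bounded:
  obtains R where "\<And>x lam. (x, lam) \<in> zeros g \<Longrightarrow> \<bar>lam\<bar> \<le> T \<Longrightarrow> norm x \<le> R"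
proof (rule that)
  fix x lam assume z: "(x, lam) \<in> zeros g" "\<bar>lam\<bar> \<le> T"
  obtain S s where S: "S \<subseteq> others" "s > 0" "x = sol S s lam" "sol_eq S s lam"
    using zerosE[OF z(1)] by metis
  have "(norm x)\<^sup>2 \<le> 2 * kk * (lam\<^sup>2 * (1 + kk\<^sup>2) / 4 + kk * \<theta> lam)"
    unfolding S(3) using S theta_nonneg by (intro norm_sol_bound) (auto simp: sol_eq_def)
  also have "\<dots> \<le> 2 * kk * (T\<^sup>2 * (1 + kk\<^sup>2) / 4 + kk * \<eta>)"
  proof -
    have "lam\<^sup>2 \<le> T\<^sup>2" using z(2) by (metis abs_ge_zero abs_le_square_iff abs_of_nonneg order_trans)
    then show ?thesis
      using theta_le[of lam] kk_pos by (intro mult_left_mono add_mono divide_right_mono mult_right_mono) auto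
  qed
  finally show "norm x \<le> sqrt (2 * kk * (T\<^sup>2 * (1 + kk\<^sup>2) / 4 + kk * \<eta>))"
    by (rule real_le_rsqrt)
qed

end

section \<open>Small perturbations and their limits\<close>

lemma lin_tendsto:
  "(x \<longlongrightarrow> x') F \<Longrightarrow> (lam \<longlongrightarrow> lam') F \<Longrightarrow> (u \<longlongrightarrow> u') F \<Longrightarrow>
    ((\<lambda>n. lin (x n) (lam n) (u n)) \<longlongrightarrow> lin x' lam' u') F"
  unfolding lin_def by (intro tendsto_intros B_form.tendsto)

lemma norm_le_if_eq_scaleR:
  fixes y z :: "'a::real_normed_vector"
  assumes "y = norm u *\<^sub>R z" "norm z \<le> e"
  shows "norm y \<le> e * norm u"
  using mult_right_mono[OF assms(2) norm_ge_zero[of u]] assms(1) by (simp add: mult.commute)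

context perturbed_family
begin

text \<open>The bounds hold on all of \<open>HR\<close> and are homogeneous in the directions.
  \<open>HR\<close> is convex while \<open>K\<close> need not be, so mean value estimates between
  arbitrary points become available.\<close>

definition close :: "((real ^ 'k) \<times> real) set \<Rightarrow> real \<Rightarrow> ((real ^ 'k) \<times> real \<Rightarrow> real ^ 'k) \<Rightarrow> bool" where
  "close K \<epsilon> h \<longleftrightarrow> smooth_family h \<and> (\<forall>p\<in>HR - K. h p = g p) \<and>
    (\<forall>p\<in>HR. norm (h p - g p) \<le> \<epsilon> \<and>
      (\<forall>u\<in>HR. norm (deriv_on HR (\<lambda>p. h p - g p) [u] p) \<le> \<epsilon> * norm u \<and>
        (\<forall>v\<in>HR. norm (deriv_on HR (\<lambda>p. h p - g p) [u, v] p) \<le> \<epsilon> * norm u * norm v)))"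

lemma close_mono: "close K \<epsilon> h \<Longrightarrow> \<epsilon> \<le> \<epsilon>' \<Longrightarrow> close K \<epsilon>' h"
  unfolding close_def by (meson mult_right_mono norm_ge_zero order_trans)

lemma closeD:
  assumes "close K \<epsilon> h"
  shows "smooth_family h" "smooth_on_subspace HR h" "smooth_on_subspace HR (\<lambda>p. h p - g p)"
    "\<And>p. p \<in> HR \<Longrightarrow> p \<notin> K \<Longrightarrow> h p = g p"
    "\<And>p. p \<in> HR \<Longrightarrow> norm (h p - g p) \<le> \<epsilon>"
    "\<And>p u. p \<in> HR \<Longrightarrow> u \<in> HR \<Longrightarrow> norm (deriv_on HR (\<lambda>p. h p - g p) [u] p) \<le> \<epsilon> * norm u"
    "\<And>p u v. p \<in> HR \<Longrightarrow> u \<in> HR \<Longrightarrow> v \<in> HR \<Longrightarrow>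
      norm (deriv_on HR (\<lambda>p. h p - g p) [u, v] p) \<le> \<epsilon> * norm u * norm v"
  using assms smooth_on_subspace_diff[OF subspace_HR _ g_smooth_on]
  unfolding close_def smooth_family_def by (auto simp del: deriv_on.simps)

text \<open>On \<open>K\<close> the norm controls unit directions, and scaling gives the homogeneous
  bounds. Off \<open>K\<close> the difference vanishes near the point within \<open>HR\<close>,
  hence so do its derivatives.\<close>

lemma close_if_C2_norm:
  assumes K: "compact_nhd_of_origin K" and h: "smooth_family h" "\<forall>p\<in>HR - K. h p = g p"
    and e: "C2_norm K (\<lambda>p. h p - g p) < \<epsilon>"
  shows "close K \<epsilon> h"
proof -
  let ?e = "\<lambda>p. h p - g p"
  have hs: "smooth_on_subspace HR h" using h(1) by (simp add: smooth_family_def)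
  have es: "smooth_on_subspace HR ?e" by (rule smooth_on_subspace_diff[OF subspace_HR hs g_smooth_on])
  have K': "compact K" "K \<subseteq> HR" "(0, 0) \<in> K" using K by (auto simp: compact_nhd_of_origin_def)
  have on_K: "norm (deriv_on HR ?e vs p) \<le> \<epsilon>"
    if "p \<in> K" "vs \<in> lists HR" "length vs \<le> 2" "\<And>v. v \<in> set vs \<Longrightarrow> norm v \<le> 1" for p vs
    using norm_deriv_le_C2_norm[OF es K'(1,2) that] e by simp
  have "norm (?e (0, 0)) \<le> \<epsilon>" using on_K[OF K'(3), of "[]"] by simp
  then have e_pos: "\<epsilon> \<ge> 0" using norm_ge_zero order_trans by blast
  have off_K: "deriv_on HR ?e vs p = 0" if "p \<in> HR - K" "vs \<in> lists HR" for p vs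
  proof -
    have op: "open (- K)" using K'(1) compact_imp_closed by auto
    have "deriv_on HR ?e vs p = deriv_on HR (\<lambda>p. 0) vs p"
      by (rule deriv_on_local_cong[OF op]) (use that h(2) in auto)
    moreover have "deriv_on HR (\<lambda>_. 0 :: real ^ 'k) vs q = 0" if "q \<in> HR" for q :: "(real ^ 'k) \<times> real"
      using \<open>vs \<in> lists HR\<close> that
    proof (induction vs arbitrary: q rule: list.induct)
      case (Cons v vs)
      then show ?case
        by (intro deriv_on_Cons_eq[OF subspace_HR, where F = "\<lambda>_. 0" and F' = "\<lambda>_. 0"]) auto
    qed simp
    ultimately show ?thesis using that by simp
  qed
  have bound: "norm (deriv_on HR ?e vs p) \<le> \<epsilon>"
    if "p \<in> HR" "vs \<in> lists HR" "length vs \<le> 2" "\<And>v. v \<in> set vs \<Longrightarrow> norm v \<le> 1" for p vs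
    using on_K[OF _ that(2-)] off_K[of p vs] that e_pos by (cases "p \<in> K") auto
  have b1: "norm (deriv_on HR ?e (u # vs) p) \<le> \<epsilon> * norm u"
    if "p \<in> HR" "u \<in> HR" "vs \<in> lists HR" "length vs \<le> 1" "\<And>v. v \<in> set vs \<Longrightarrow> norm v \<le> 1" for p u vs
  proof (cases "u = 0")
    case True
    interpret bounded_linear "\<lambda>u. deriv_on HR ?e (u # vs) p"
      by (rule bounded_linear_deriv_on[OF es that(3,1)])
    show ?thesis using True zero by simp
  next
    case False
    have "deriv_on HR ?e (u # vs) p = norm u *\<^sub>R deriv_on HR ?e ((1 / norm u) *\<^sub>R u # vs) p"
      unfolding deriv_on_scaleR_arg[OF es that(3,1)] using False by simp
    moreover have "norm (deriv_on HR ?e ((1 / norm u) *\<^sub>R u # vs) p) \<le> \<epsilon>"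
      using that False by (intro bound) (auto intro!: subspace_scale[OF subspace_HR])
    ultimately show ?thesis by (rule norm_le_if_eq_scaleR)
  qed
  have b2: "norm (deriv_on HR ?e [u, v] p) \<le> \<epsilon> * norm u * norm v"
    if "p \<in> HR" "u \<in> HR" "v \<in> HR" for p u v
  proof (cases "v = 0")
    case True
    then show ?thesis using deriv_on_2_scaleR[OF subspace_HR es that(1,2,3), of 0] by (simp del: deriv_on.simps)
  next
    case False
    have "deriv_on HR ?e [u, v] p = norm v *\<^sub>R deriv_on HR ?e [u, (1 / norm v) *\<^sub>R v] p"
      unfolding deriv_on_2_scaleR[OF subspace_HR es that] using False by simp
    moreover have "norm (deriv_on HR ?e [u, (1 / norm v) *\<^sub>R v] p) \<le> \<epsilon> * norm u"
      using that False by (intro b1) (auto intro!: subspace_scale[OF subspace_HR])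
    ultimately show ?thesis by (rule norm_le_if_eq_scaleR)
  qed
  show ?thesis
    unfolding close_def using h bound[of _ "[]"] b1[of _ _ "[]"] b2 by (auto simp del: deriv_on.simps(2))
qed

lemma close_lipschitz:
  assumes c: "close K \<epsilon> h" and pq: "p \<in> HR" "q \<in> HR"
  shows "norm ((h p - g p) - (h q - g q)) \<le> \<epsilon> * norm (p - q)"
  using deriv_on_lipschitz[OF subspace_HR closeD(3)[OF c], of "[]" \<epsilon> p q] closeD(6)[OF c] pq
  by (simp del: deriv_on.simps(2))

lemma close_linearization_eq:
  assumes c: "close K \<epsilon> h" and "x \<in> H" "u \<in> H"
  shows "linearization h (x, lam) u - linearization g (x, lam) u =
    deriv_on HR (\<lambda>p. h p - g p) [(u, 0)] (x, lam)"
  using assms deriv_on_diff[OF subspace_HR closeD(2)[OF c] g_smooth_on, of "[(u, 0)]" "(x, lam)"]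
  by (simp add: linearization_eq_deriv_on[OF closeD(2)[OF c]] linearization_eq_deriv_on[OF g_smooth_on]
      HR_def del: deriv_on.simps)

lemma close_linearization:
  assumes c: "close K \<epsilon> h" and "x \<in> H" "u \<in> H"
  shows "norm (linearization h (x, lam) u - linearization g (x, lam) u) \<le> \<epsilon> * norm u"
  using closeD(6)[OF c, of "(x, lam)" "(u, 0)"] assms close_linearization_eq[OF assms]
  by (simp add: HR_def norm_Pair del: deriv_on.simps)

text \<open>The second-derivative bound, integrated along the segment: the error of the
  linearization itself varies slowly. This is where C2 rather than C1 closeness enters the
  uniqueness of folds.\<close>

lemma close_linearization_lipschitz:
  assumes c: "close K \<epsilon> h" and x: "x \<in> H" "x' \<in> H" "u \<in> H"
  shows "norm ((linearization h (x, lam) u - linearization g (x, lam) u) -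
      (linearization h (x', lam') u - linearization g (x', lam') u))
    \<le> \<epsilon> * norm u * norm ((x, lam) - (x', lam'))"
  unfolding close_linearization_eq[OF c x(1,3)] close_linearization_eq[OF c x(2,3)]
proof (rule deriv_on_lipschitz[OF subspace_HR closeD(3)[OF c]])
  fix p v :: "(real ^ 'k) \<times> real" assume "p \<in> HR" "v \<in> HR"
  then show "norm (deriv_on HR (\<lambda>p. h p - g p) [v, (u, 0)] p) \<le> \<epsilon> * norm u * norm v"
    using closeD(7)[OF c, of p v "(u, 0)"] x by (simp add: HR_def norm_Pair mult_ac del: deriv_on.simps)
qed (use x in \<open>auto simp: HR_def\<close>)

lemma close_second_derivative:
  assumes c: "close K \<epsilon> h" and x: "x \<in> H" "u \<in> H" "v \<in> H"
  shows "norm (deriv_on H (\<lambda>y. h (y, lam)) [u, v] x - deriv_on H (\<lambda>y. g (y, lam)) [u, v] x)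
    \<le> \<epsilon> * norm u * norm v"
proof -
  have "deriv_on H (\<lambda>y. h (y, lam)) [u, v] x - deriv_on H (\<lambda>y. g (y, lam)) [u, v] x =
      deriv_on HR (\<lambda>p. h p - g p) [(u, 0), (v, 0)] (x, lam)"
    unfolding deriv_on_H_2[OF closeD(2)[OF c] x] deriv_on_H_2[OF g_smooth_on x]
    by (rule deriv_on_diff[OF subspace_HR closeD(2)[OF c] g_smooth_on, symmetric])
       (use x in \<open>auto simp: HR_def\<close>)
  then show ?thesis
    using closeD(7)[OF c, of "(x, lam)" "(u, 0)" "(v, 0)"] x by (simp add: HR_def norm_Pair del: deriv_on.simps)
qed

lemma close_parameter_derivative:
  assumes c: "close K \<epsilon> h" and x: "x \<in> H"
  shows "norm (vector_derivative (\<lambda>\<mu>. h (x, \<mu>)) (at lam) - vector_derivative (\<lambda>\<mu>. g (x, \<mu>)) (at lam)) \<le> \<epsilon>"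
proof -
  have H0: "(0 :: real ^ 'k) \<in> H" by (rule subspace_0[OF subspace_H])
  have "deriv_on HR h [(0, 1)] (x, lam) - deriv_on HR g [(0, 1)] (x, lam) =
      deriv_on HR (\<lambda>p. h p - g p) [(0, 1)] (x, lam)"
    by (rule deriv_on_diff[OF subspace_HR closeD(2)[OF c] g_smooth_on, symmetric])
       (use x H0 in \<open>auto simp: HR_def\<close>)
  then show ?thesis
    unfolding vector_derivative_param[OF closeD(2)[OF c] x] vector_derivative_param[OF g_smooth_on x]
    using closeD(6)[OF c, of "(x, lam)" "(0, 1)"] x H0 by (simp add: HR_def norm_Pair del: deriv_on.simps)
qed

lemma close_self: "\<epsilon> \<ge> 0 \<Longrightarrow> close K \<epsilon> g"
proof -
  assume e: "\<epsilon> \<ge> 0"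
  have 0: "deriv_on HR (\<lambda>p. g p - g p) vs p = 0" if "vs \<in> lists HR" "p \<in> HR" for vs p
    using deriv_on_diff[OF subspace_HR g_smooth_on g_smooth_on that] by simp
  show "close K \<epsilon> g"
    unfolding close_def using e g_smooth 0[of "[_]"] 0[of "[_, _]"] by (auto simp del: deriv_on.simps)
qed

text \<open>Zeros in \<open>K\<close> are bounded by \<open>K\<close>, and the others are zeros of
  \<open>g\<close>; the bound is the same for all perturbations.\<close>

lemma close_zeros_bounded:
  assumes K: "compact K"
  shows "\<exists>R. \<forall>\<epsilon> h x lam. close K \<epsilon> h \<longrightarrow> (x, lam) \<in> zeros h \<longrightarrow> \<bar>lam\<bar> \<le> T \<longrightarrow> norm x \<le> R"
proof -
  obtain R where R: "\<And>x lam. (x, lam) \<in> zeros g \<Longrightarrow> \<bar>lam\<bar> \<le> T \<Longrightarrow> norm x \<le> R"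
    using zeros_bounded by metis
  obtain M where M: "\<And>p. p \<in> K \<Longrightarrow> norm p \<le> M"
    using compact_imp_bounded[OF K] by (auto simp: bounded_iff)
  have "norm x \<le> max R M" if c: "close K \<epsilon> h" "(x, lam) \<in> zeros h" "\<bar>lam\<bar> \<le> T" for \<epsilon> h x lam
  proof (cases "(x, lam) \<in> K")
    case True
    have "norm x \<le> norm (x, lam)" by (rule norm_fst_le)
    then show ?thesis using M[OF True] by simp
  next
    case False
    then have "(x, lam) \<in> zeros g"
      using c(2) closeD(4)[OF c(1), of "(x, lam)"] by (auto simp: zeros_def)
    then have "norm x \<le> R" using R c(3) by blast
    then show ?thesis by simp
  qed
  then show ?thesis by blast
qed

text \<open>The compactness principle: a uniform \<epsilon> exists unless there are counterexamples
  with errors 1/(n+1).\<close>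

lemma close_by_sequences:
  assumes "\<And>h. (\<And>n. close K (inverse (real (Suc n))) (h n)) \<Longrightarrow> (\<And>n. \<not> P (h n)) \<Longrightarrow> False"
  shows "\<exists>\<epsilon>>0. \<forall>h. close K \<epsilon> h \<longrightarrow> P h"
proof (rule ccontr)
  assume "\<not> ?thesis"
  then have "\<exists>h. close K (inverse (real (Suc n))) h \<and> \<not> P h" for n
    by (metis inverse_positive_iff_positive of_nat_0_less_iff zero_less_Suc)
  then show False using assms by metis
qed

lemma close_subsequence:
  assumes "\<And>n. close K (inverse (real (Suc n))) (h n)" "strict_mono r"
  shows "close K (inverse (real (Suc n))) (h (r n))"
proof (rule close_mono[OF assms(1)])
  show "inverse (real (Suc (r n))) \<le> inverse (real (Suc n))"
    using seq_suble[OF assms(2), of n] by (simp add: inverse_le_iff_le)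
qed

end

section \<open>Limits of zeros along perturbations tending to g\<close>

locale close_sequence = perturbed_family i0 l \<eta> a \<theta> g N
  for i0 :: "'k::finite" and l \<eta> a \<theta> g N +
  fixes K :: "((real ^ 'k) \<times> real) set" and T :: real
    and h :: "nat \<Rightarrow> (real ^ 'k) \<times> real \<Rightarrow> real ^ 'k" and x :: "nat \<Rightarrow> real ^ 'k" and lam :: "nat \<Rightarrow> real"
  assumes K: "compact K"
    and h: "\<And>n. close K (inverse (real (Suc n))) (h n)"
    and z: "\<And>n. (x n, lam n) \<in> zeros (h n)"
    and lam_le: "\<And>n. \<bar>lam n\<bar> \<le> T"
begin

lemma subsequence:
  assumes "strict_mono r"
  shows "close_sequence i0 l \<eta> a \<theta> g N K T (h \<circ> r) (x \<circ> r) (lam \<circ> r)"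
proof unfold_locales
  fix n show "close K (inverse (real (Suc n))) ((h \<circ> r) n)"
    using close_subsequence[OF h assms] by simp
qed (use K z lam_le in auto)

lemma x_H: "x n \<in> H"
  using z[of n] by (simp add: zeros_def HR_def)

lemma bounded_x: "bounded (range x)"
proof -
  obtain R where "\<forall>\<epsilon> h x lam. close K \<epsilon> h \<longrightarrow> (x, lam) \<in> zeros h \<longrightarrow> \<bar>lam\<bar> \<le> T \<longrightarrow> norm x \<le> R"
    using close_zeros_bounded[OF K] by blast
  then have "norm (x n) \<le> R" for n using h z lam_le by blast
  then show ?thesis by (auto intro: boundedI)
qed

lemma bounded_lam: "bounded (range lam)"
  using lam_le by (auto intro!: boundedI)

end

locale convergent_sequence = close_sequence i0 l \<eta> a \<theta> g N K T h x lam
  for i0 :: "'k::finite" and l \<eta> a \<theta> g N K T h x lam +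
  fixes x' :: "real ^ 'k" and lam' :: real
  assumes x_lim: "x \<longlonglongrightarrow> x'" and lam_lim: "lam \<longlonglongrightarrow> lam'"
begin

lemma convergent_subsequence:
  assumes "strict_mono r"
  shows "convergent_sequence i0 l \<eta> a \<theta> g N K T (h \<circ> r) (x \<circ> r) (lam \<circ> r) x' lam'"
proof -
  interpret close_sequence i0 l \<eta> a \<theta> g N K T "h \<circ> r" "x \<circ> r" "lam \<circ> r"
    by (rule subsequence[OF assms])
  show ?thesis
    by unfold_locales (rule LIMSEQ_subseq_LIMSEQ[OF x_lim assms] LIMSEQ_subseq_LIMSEQ[OF lam_lim assms])+
qed

lemma x'_H: "x' \<in> H"
  by (rule closed_sequentially[OF closed_H x_H x_lim])

lemma limit_zero: "(x', lam') \<in> zeros g"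
proof -
  have "continuous_on HR g" using smooth_continuous[OF g_smooth_on, of "[]"] by simp
  then have "(\<lambda>n. g (x n, lam n)) \<longlonglongrightarrow> g (x', lam')"
    by (rule continuous_on_tendsto_compose[OF _ tendsto_Pair[OF x_lim lam_lim]])
       (use x_H x'_H in \<open>auto simp: HR_def\<close>)
  moreover have "(\<lambda>n. g (x n, lam n)) \<longlonglongrightarrow> 0"
  proof (rule Lim_null_comparison[OF _ LIMSEQ_inverse_real_of_nat], rule always_eventually, rule allI)
    fix n show "norm (g (x n, lam n)) \<le> inverse (real (Suc n))"
      using closeD(5)[OF h[of n], of "(x n, lam n)"] z[of n] by (simp add: zeros_def)
  qed
  ultimately have "g (x', lam') = 0" using LIMSEQ_unique by blast
  then show ?thesis using x'_H by (simp add: zeros_def HR_def)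
qed

lemma eventually_N: "\<forall>\<^sub>F n in sequentially. (x n, lam n) \<in> N"
  using topological_tendstoD[OF tendsto_Pair[OF x_lim lam_lim] N_open] limit_zero zeros_N by blast

text \<open>The error between the two linearizations is bounded by a null sequence, and close to the
  limit point the linearization of \<open>g\<close> is the explicit, jointly continuous
  \<open>lin\<close>.\<close>

lemma limit_linearization:
  assumes u: "\<And>n. u n \<in> H" "u \<longlonglongrightarrow> u'"
  shows "(\<lambda>n. linearization (h n) (x n, lam n) (u n)) \<longlonglongrightarrow> lin x' lam' u'"
proof -
  let ?d = "\<lambda>n. linearization (h n) (x n, lam n) (u n) - linearization g (x n, lam n) (u n)"
  have "(\<lambda>n. inverse (real (Suc n)) * norm (u n)) \<longlonglongrightarrow> 0 * norm u'"
    by (intro tendsto_mult tendsto_norm u LIMSEQ_inverse_real_of_nat)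
  then have B: "(\<lambda>n. inverse (real (Suc n)) * norm (u n)) \<longlonglongrightarrow> 0" unfolding mult_zero_left .
  have "?d \<longlonglongrightarrow> 0"
    by (rule Lim_null_comparison[OF always_eventually[OF allI] B]) (rule close_linearization[OF h x_H u(1)])
  then have "(\<lambda>n. ?d n + lin (x n) (lam n) (u n)) \<longlonglongrightarrow> 0 + lin x' lam' u'"
    by (intro tendsto_add lin_tendsto x_lim lam_lim u)
  moreover have "\<forall>\<^sub>F n in sequentially. ?d n + lin (x n) (lam n) (u n) =
      linearization (h n) (x n, lam n) (u n)"
    using eventually_N by eventually_elim (simp add: linearization_g x_H u)
  ultimately show ?thesis unfolding add_0 by (rule Lim_transform_eventually)
qed

lemma limit_second_derivative:
  assumes u: "\<And>n. u n \<in> H" "u \<longlonglongrightarrow> u'"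
  shows "(\<lambda>n. deriv_on H (\<lambda>y. h n (y, lam n)) [u n, u n] (x n)) \<longlonglongrightarrow> - 2 *\<^sub>R B_form u' u'"
proof -
  let ?d = "\<lambda>n. deriv_on H (\<lambda>y. h n (y, lam n)) [u n, u n] (x n) - deriv_on H (\<lambda>y. g (y, lam n)) [u n, u n] (x n)"
  have "(\<lambda>n. inverse (real (Suc n)) * norm (u n) * norm (u n)) \<longlonglongrightarrow> 0 * norm u' * norm u'"
    by (intro tendsto_mult tendsto_norm u LIMSEQ_inverse_real_of_nat)
  then have B: "(\<lambda>n. inverse (real (Suc n)) * norm (u n) * norm (u n)) \<longlonglongrightarrow> 0" unfolding mult_zero_left .
  have "?d \<longlonglongrightarrow> 0"
    by (rule Lim_null_comparison[OF always_eventually[OF allI] B])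
       (rule close_second_derivative[OF h x_H u(1) u(1)])
  then have "(\<lambda>n. ?d n + - 2 *\<^sub>R B_form (u n) (u n)) \<longlonglongrightarrow> 0 + - 2 *\<^sub>R B_form u' u'"
    by (intro tendsto_add tendsto_scaleR tendsto_const B_form.tendsto u)
  moreover have "\<forall>\<^sub>F n in sequentially. ?d n + - 2 *\<^sub>R B_form (u n) (u n) =
      deriv_on H (\<lambda>y. h n (y, lam n)) [u n, u n] (x n)"
    using eventually_N by eventually_elim (simp only: second_derivative_g[OF x_H _ u(1) u(1)] diff_add_cancel)
  ultimately show ?thesis unfolding add_0 by (rule Lim_transform_eventually)
qed

lemma limit_parameter_derivative:
  assumes "lam'\<^sup>2 < a"
  shows "(\<lambda>n. vector_derivative (\<lambda>\<mu>. h n (x n, \<mu>)) (at (lam n))) \<longlonglongrightarrow> x'"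
proof -
  let ?d = "\<lambda>n. vector_derivative (\<lambda>\<mu>. h n (x n, \<mu>)) (at (lam n)) - vector_derivative (\<lambda>\<mu>. g (x n, \<mu>)) (at (lam n))"
  have "?d \<longlonglongrightarrow> 0"
    by (rule Lim_null_comparison[OF always_eventually LIMSEQ_inverse_real_of_nat])
       (use close_parameter_derivative[OF h x_H] in auto)
  then have "(\<lambda>n. ?d n + x n) \<longlonglongrightarrow> 0 + x'" by (intro tendsto_add x_lim)
  moreover have "\<forall>\<^sub>F n in sequentially. (lam n)\<^sup>2 < a"
    using order_tendstoD(2)[OF tendsto_power[OF lam_lim] assms] .
  with eventually_N have "\<forall>\<^sub>F n in sequentially. ?d n + x n = vector_derivative (\<lambda>\<mu>. h n (x n, \<mu>)) (at (lam n))"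
    by eventually_elim (simp add: parameter_derivative_g x_H)
  ultimately show ?thesis unfolding add_0 by (rule Lim_transform_eventually)
qed

text \<open>The closed orthant passes to the limit; the limit is a zero of \<open>g\<close>, and
  those avoid the boundary.\<close>

lemma limit_orthant:
  assumes "\<And>n. (x n, lam n) \<in> closed_orthant S" "S \<subseteq> others"
  shows "(x', lam') \<in> orthant S"
  using zeros_closed_orthant[OF limit_zero _ assms(2)]
    closed_sequentially[OF closed_closed_orthant assms(1) tendsto_Pair[OF x_lim lam_lim]] by blast

end

text \<open>The limit of maps with this property has a two-dimensional kernel if it is symmetric;
  the inequalities hold both for a double eigenvalue 0 and for a pair of imaginary eigenvalues.\<close>

definition two_dim_null :: "(real ^ 'k \<Rightarrow> real ^ 'k) \<Rightarrow> bool" where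
  "two_dim_null L \<longleftrightarrow> (\<exists>u\<in>H. \<exists>w\<in>H. \<exists>\<alpha> \<gamma> p q. norm u = 1 \<and> norm w = 1 \<and> u \<bullet> w = 0 \<and>
     L u = \<alpha> *\<^sub>R u + \<gamma> *\<^sub>R w \<and> L w = p *\<^sub>R u + q *\<^sub>R w \<and> \<alpha>\<^sup>2 + \<gamma> * p \<le> 0 \<and> \<gamma> * p + q\<^sup>2 \<le> 0)"

lemma orthogonal_remainder:
  fixes u v :: "'a::real_inner"
  assumes "v \<noteq> 0"
  shows "v \<bullet> (u - ((u \<bullet> v) / (v \<bullet> v)) *\<^sub>R v) = 0"
  using assms by (simp add: inner_diff_right inner_commute)

text \<open>Gram-Schmidt applied to the real and imaginary parts of the eigenvector. The restriction
  of \<open>L\<close> to their plane has trace 0 and determinant \<beta>^2, which gives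
  \<open>q = - \<alpha>\<close> and turns both inequalities into the value -\<beta>^2.\<close>

lemma two_dim_null_if_imaginary:
  fixes L :: "real ^ 'k::finite \<Rightarrow> real ^ 'k"
  assumes L: "linear L" and ab: "a \<in> H" "b \<in> H" "a \<noteq> 0 \<or> b \<noteq> 0" "L a = - (\<beta> *\<^sub>R b)" "L b = \<beta> *\<^sub>R a"
    and \<beta>: "\<beta> \<noteq> 0"
  shows "two_dim_null L"
proof -
  have a0: "a \<noteq> 0" using ab \<beta> linear_0[OF L] by auto
  define A where "A = norm a"
  define u where "u = (1 / A) *\<^sub>R a"
  define c where "c = b \<bullet> u"
  define b1 where "b1 = b - c *\<^sub>R u"
  define D where "D = norm b1"
  define w where "w = (1 / D) *\<^sub>R b1"
  have A: "A > 0" using a0 by (simp add: A_def)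
  have nu: "norm u = 1" using A by (simp add: u_def A_def)
  then have uu: "u \<bullet> u = 1" by (simp add: norm_eq_1)
  have a_eq: "a = A *\<^sub>R u" using A by (simp add: u_def)
  have Lu: "L u = - ((\<beta> / A) *\<^sub>R b)" using A by (simp add: u_def linear_scale[OF L] ab(4))
  \<comment> \<open>If \<open>a\<close> and \<open>b\<close> were parallel, \<open>L\<close> would
    preserve a real line while its square acts there as -\<beta>^2.\<close>
  have "b1 \<noteq> 0"
  proof
    assume "b1 = 0"
    then have b: "b = c *\<^sub>R u" by (simp add: b1_def)
    have "\<beta> *\<^sub>R a = c *\<^sub>R L u" using ab(5) b linear_scale[OF L] by metis
    then have "(\<beta> * A) *\<^sub>R u = (- (c * \<beta> * c / A)) *\<^sub>R u"
      unfolding Lu using b by (simp add: a_eq)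
    then have "\<beta> * A = - (c * \<beta> * c / A)" using nu by (metis norm_zero scaleR_cancel_right zero_neq_one)
    then have "\<beta> * (A\<^sup>2 + c\<^sup>2) = 0" using A by (simp add: field_simps power2_eq_square)
    then show False using \<beta> A by (simp add: sum_power2_eq_zero_iff)
  qed
  then have D: "D > 0" by (simp add: D_def)
  have nw: "norm w = 1" using D by (simp add: w_def D_def)
  have uw: "u \<bullet> w = 0" by (simp add: w_def b1_def inner_diff_right uu c_def inner_commute)
  have b_eq: "b = c *\<^sub>R u + D *\<^sub>R w" using D by (simp add: w_def b1_def)
  have uH: "u \<in> H" unfolding u_def by (intro subspace_scale[OF subspace_H] ab)
  have wH: "w \<in> H" unfolding w_def b1_def by (intro subspace_scale[OF subspace_H] subspace_diff[OF subspace_H] ab uH)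
  define \<alpha> where "\<alpha> = - (\<beta> * c / A)"
  define \<gamma> where "\<gamma> = - (\<beta> * D / A)"
  define p where "p = (\<beta> * A - c * \<alpha>) / D"
  have Lu': "L u = \<alpha> *\<^sub>R u + \<gamma> *\<^sub>R w"
    unfolding Lu by (subst b_eq) (simp add: \<alpha>_def \<gamma>_def scaleR_add_right)
  have "L w = (1 / D) *\<^sub>R (L b - c *\<^sub>R L u)"
    by (simp add: w_def b1_def linear_scale[OF L] linear_diff[OF L])
  also have "\<dots> = p *\<^sub>R u + (- \<alpha>) *\<^sub>R w"
  proof -
    have "(1 / D) * (c * \<gamma>) = \<alpha>" using D by (simp add: \<alpha>_def \<gamma>_def)
    then show ?thesis
      unfolding ab(5) Lu' a_eq by (simp add: p_def algebra_simps diff_divide_distrib)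
  qed
  finally have Lw: "L w = p *\<^sub>R u + (- \<alpha>) *\<^sub>R w" .
  have "\<alpha>\<^sup>2 + \<gamma> * p = - \<beta>\<^sup>2"
    using A D by (simp add: \<alpha>_def \<gamma>_def p_def field_simps power2_eq_square)
  then have "\<alpha>\<^sup>2 + \<gamma> * p \<le> 0" by simp
  moreover from this have "\<gamma> * p + (- \<alpha>)\<^sup>2 \<le> 0" by simp
  ultimately show ?thesis
    unfolding two_dim_null_def
    by (intro bexI[of _ u] bexI[of _ w] exI[of _ \<alpha>] exI[of _ \<gamma>] exI[of _ p] exI[of _ "- \<alpha>"]
        conjI uH wH nu nw uw Lu' Lw)
qed

text \<open>A second kernel vector or a preimage of \<open>v\<close>, made orthogonal to
  \<open>v\<close>, spans with \<open>v\<close> a plane on which \<open>L\<close> is nilpotent; that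
  is an instance of the excluded condition with \<alpha>, \<gamma> and q equal to 0.\<close>

lemma simple_zero_eigenvalue:
  fixes L :: "real ^ 'k::finite \<Rightarrow> real ^ 'k"
  assumes L: "linear L" and n: "\<not> two_dim_null L" and v: "v \<in> H" "v \<noteq> 0" "L v = 0"
  shows "u \<in> H \<Longrightarrow> L u = 0 \<Longrightarrow> \<exists>c. u = c *\<^sub>R v" and "u \<in> H \<Longrightarrow> L u \<noteq> v"
proof -
  define c where "c = (u \<bullet> v) / (v \<bullet> v)"
  define u1 where "u1 = u - c *\<^sub>R v"
  have orth: "v \<bullet> u1 = 0" unfolding u1_def c_def by (rule orthogonal_remainder[OF v(2)])
  have Lu1: "L u1 = L u" by (simp add: u1_def linear_diff[OF L] linear_scale[OF L] v)
  \<comment> \<open>The value \<open>d = 0\<close> covers a two-dimensional kernel,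
    \<open>d = 1\<close> a Jordan block.\<close>
  have key: False if "u \<in> H" "u1 \<noteq> 0" "L u = d *\<^sub>R v" for d
  proof -
    have "u1 \<in> H" unfolding u1_def by (intro subspace_diff[OF subspace_H] subspace_scale[OF subspace_H] v that)
    then have "two_dim_null L"
      unfolding two_dim_null_def using v that orth
      by (intro bexI[of _ "(1 / norm v) *\<^sub>R v"] bexI[of _ "(1 / norm u1) *\<^sub>R u1"] exI[of _ 0]
          exI[of _ "d * norm v / norm u1"])
        (auto simp: linear_scale[OF L] Lu1 intro!: subspace_scale[OF subspace_H])
    then show False using n by blast
  qed
  show "\<exists>c. u = c *\<^sub>R v" if "u \<in> H" "L u = 0"
  proof -
    have "u1 = 0" using key[of 0] that by auto
    then show ?thesis unfolding u1_def by auto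
  qed
  show "L u \<noteq> v" if "u \<in> H"
  proof
    assume Lu: "L u = v"
    then have "u1 \<noteq> 0" using Lu1 v(2) linear_0[OF L] by metis
    then show False using key[of 1] that Lu by simp
  qed
qed

text \<open>As \<open>v\<close> is missing from the range, the range is a proper subspace of
  \<open>H\<close> and has a unit normal in \<open>H\<close>.\<close>

lemma left_null_vector:
  fixes L :: "real ^ 'k::finite \<Rightarrow> real ^ 'k"
  assumes L: "linear L" "\<And>u. u \<in> H \<Longrightarrow> L u \<in> H" and n: "\<not> two_dim_null L"
    and v: "v \<in> H" "v \<noteq> 0" "L v = 0"
  obtains w where "w \<in> H" "norm w = 1" "\<And>u. u \<in> H \<Longrightarrow> w \<bullet> L u = 0"
proof -
  have sub: "subspace (L ` H)" by (rule linear_subspace_image[OF L(1) subspace_H])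
  have "v \<notin> L ` H" using simple_zero_eigenvalue(2)[OF L(1) n v] by blast
  then have "span (L ` H) \<subset> span H"
    using L(2) v(1) by (auto simp: span_eq_iff[THEN iffD2, OF subspace_H] span_eq_iff[THEN iffD2, OF sub])
  then obtain w where w: "w \<noteq> 0" "w \<in> span H" "\<And>y. y \<in> span (L ` H) \<Longrightarrow> orthogonal w y"
    using orthogonal_to_subspace_exists_gen[of "L ` H" H] by metis
  show thesis
  proof (rule that[of "(1 / norm w) *\<^sub>R w"])
    show "(1 / norm w) *\<^sub>R w \<in> H"
      using w(2) by (intro subspace_scale[OF subspace_H]) (simp add: span_eq_iff[THEN iffD2, OF subspace_H])
    show "norm ((1 / norm w) *\<^sub>R w) = 1" using w(1) by simp
    show "(1 / norm w) *\<^sub>R w \<bullet> L u = 0" if "u \<in> H" for u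
      using w(3)[of "L u"] that by (simp add: orthogonal_def span_base)
  qed
qed

lemma non_hyperbolic_iff:
  fixes h :: "(real ^ 'k::finite) \<times> real \<Rightarrow> real ^ 'k"
  assumes "p \<in> zeros h"
  shows "p \<notin> hyperbolic_zeros h \<longleftrightarrow> (\<exists>a\<in>H. \<exists>b\<in>H. \<exists>\<beta>. (a \<noteq> 0 \<or> b \<noteq> 0) \<and>
    linearization h p a = - (\<beta> *\<^sub>R b) \<and> linearization h p b = \<beta> *\<^sub>R a)"
proof -
  have "p \<notin> hyperbolic_zeros h \<longleftrightarrow> (\<exists>\<beta>. \<exists>\<mu>\<in>eigenvalues (linearization h p). Re \<mu> = 0 \<and> Im \<mu> = \<beta>)"
    using assms by (auto simp: hyperbolic_zeros_def)
  then show ?thesis unfolding imaginary_eigenvalue_iff by blast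
qed

context convergent_sequence
begin

abbreviation "L n \<equiv> linearization (h n) (x n, lam n)"

lemma linear_L: "linear (L n)"
  by (rule linear_linearization[OF closeD(2)[OF h] x_H])

lemma L_in_H: "u \<in> H \<Longrightarrow> L n u \<in> H"
  by (rule linearization_in_H[OF closeD(1)[OF h] x_H])

lemma limit_kernel:
  assumes "u \<in> H" "u' \<in> H" "lin x' lam' u = 0" "lin x' lam' u' = 0" "u \<bullet> u' = 0"
  shows "u = 0 \<or> u' = 0"
proof (rule ccontr)
  assume *: "\<not> ?thesis"
  obtain S where S: "S \<subseteq> others" "(x', lam') \<in> orthant S" using zerosE[OF limit_zero] by metis
  obtain c where c: "u = c *\<^sub>R ker_vec S" using degenerate_zero(3)[OF limit_zero S(2,1), of u] assms * by auto
  obtain c' where c': "u' = c' *\<^sub>R ker_vec S" using degenerate_zero(3)[OF limit_zero S(2,1), of u'] assms * by auto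
  show False using assms(5) * ker_vec_nonzero[of S] by (auto simp: c c')
qed

text \<open>In the limit the off-diagonal entries coincide by symmetry, so the inequalities become
  \<alpha>^2 + \<gamma>^2 <= 0 and \<gamma>^2 + q^2 <= 0. The limiting plane would lie in the
  kernel, but kernels at zeros of \<open>g\<close> are at most lines.\<close>

lemma not_always_two_dim_null: "\<not> (\<forall>n. two_dim_null (L n))"
proof
  assume "\<forall>n. two_dim_null (L n)"
  then obtain u w \<alpha> \<gamma> p q where
    u: "\<And>n. u n \<in> H" "\<And>n. w n \<in> H" "\<And>n. norm (u n) = 1" "\<And>n. norm (w n) = 1" "\<And>n. u n \<bullet> w n = 0"
    and L: "\<And>n. L n (u n) = \<alpha> n *\<^sub>R u n + \<gamma> n *\<^sub>R w n" "\<And>n. L n (w n) = p n *\<^sub>R u n + q n *\<^sub>R w n"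
    and neg: "\<And>n. (\<alpha> n)\<^sup>2 + \<gamma> n * p n \<le> 0" "\<And>n. \<gamma> n * p n + (q n)\<^sup>2 \<le> 0"
    unfolding two_dim_null_def by metis
  have "norm (u n, w n) \<le> 2" for n using norm_Pair_le[of "u n" "w n"] u by simp
  then have "bounded (range (\<lambda>n. (u n, w n)))" by (auto intro: boundedI)
  then obtain lm r where r: "strict_mono r" "((\<lambda>n. (u n, w n)) \<circ> r) \<longlonglongrightarrow> lm"
    using bounded_subsequence by blast
  define u' w' where "u' = fst lm" and "w' = snd lm"
  have ur: "(\<lambda>n. u (r n)) \<longlonglongrightarrow> u'" and wr: "(\<lambda>n. w (r n)) \<longlonglongrightarrow> w'"
    using tendsto_fst[OF r(2)] tendsto_snd[OF r(2)] by (simp_all add: o_def u'_def w'_def)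
  interpret sub: convergent_sequence i0 l \<eta> a \<theta> g N K T "h \<circ> r" "x \<circ> r" "lam \<circ> r" x' lam'
    by (rule convergent_subsequence[OF r(1)])
  have Lu: "(\<lambda>n. L (r n) (u (r n))) \<longlonglongrightarrow> lin x' lam' u'" and Lw: "(\<lambda>n. L (r n) (w (r n))) \<longlonglongrightarrow> lin x' lam' w'"
    using sub.limit_linearization[OF _ ur] sub.limit_linearization[OF _ wr] u by (simp_all add: o_def)
  have H': "u' \<in> H" "w' \<in> H"
    using closed_sequentially[OF closed_H _ ur] closed_sequentially[OF closed_H _ wr] u by blast+
  have ip: "u n \<bullet> u n = 1" "w n \<bullet> w n = 1" "w n \<bullet> u n = 0" for n
    using u(3-5)[of n] by (simp_all add: norm_eq_1 inner_commute)
  have co: "\<alpha> n = L n (u n) \<bullet> u n" "\<gamma> n = L n (u n) \<bullet> w n" "p n = L n (w n) \<bullet> u n" "q n = L n (w n) \<bullet> w n" for n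
    unfolding L using ip u(5) by (simp_all add: inner_add_left)
  have n1: "norm u' = 1" "norm w' = 1" "u' \<bullet> w' = 0"
    using LIMSEQ_unique[OF tendsto_norm[OF ur]] LIMSEQ_unique[OF tendsto_norm[OF wr]]
      LIMSEQ_unique[OF tendsto_inner[OF ur wr]] u by (simp_all add: tendsto_const)
  let ?\<alpha> = "lin x' lam' u' \<bullet> u'" and ?\<gamma> = "lin x' lam' u' \<bullet> w'" and ?p = "lin x' lam' w' \<bullet> u'"
    and ?q = "lin x' lam' w' \<bullet> w'"
  have lims: "(\<lambda>n. \<alpha> (r n)) \<longlonglongrightarrow> ?\<alpha>" "(\<lambda>n. \<gamma> (r n)) \<longlonglongrightarrow> ?\<gamma>"
    "(\<lambda>n. p (r n)) \<longlonglongrightarrow> ?p" "(\<lambda>n. q (r n)) \<longlonglongrightarrow> ?q"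
    unfolding co by (intro tendsto_inner Lu Lw ur wr)+
  have sym: "?p = ?\<gamma>" using lin_symmetric[OF H'] by (simp add: inner_commute)
  have "?\<alpha>\<^sup>2 + ?\<gamma> * ?p \<le> 0"
    by (rule LIMSEQ_le_const2[OF tendsto_add[OF tendsto_power[OF lims(1)] tendsto_mult[OF lims(2,3)]]])
       (use neg in blast)
  moreover have "?\<gamma> * ?p + ?q\<^sup>2 \<le> 0"
    by (rule LIMSEQ_le_const2[OF tendsto_add[OF tendsto_mult[OF lims(2,3)] tendsto_power[OF lims(4)]]])
       (use neg in blast)
  ultimately have "?\<alpha>\<^sup>2 + ?\<gamma>\<^sup>2 \<le> 0" "?\<gamma>\<^sup>2 + ?q\<^sup>2 \<le> 0" unfolding sym by (simp_all add: power2_eq_square)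
  then have z: "?\<alpha> = 0" "?\<gamma> = 0" "?q = 0" by (auto simp: sum_power2_le_zero_iff)
  have "(\<lambda>n. L (r n) (u (r n))) \<longlonglongrightarrow> ?\<alpha> *\<^sub>R u' + ?\<gamma> *\<^sub>R w'"
    unfolding L by (intro tendsto_add tendsto_scaleR lims ur wr)
  then have 1: "lin x' lam' u' = 0" using LIMSEQ_unique[OF Lu] unfolding z by simp
  have "(\<lambda>n. L (r n) (w (r n))) \<longlonglongrightarrow> ?p *\<^sub>R u' + ?q *\<^sub>R w'"
    unfolding L by (intro tendsto_add tendsto_scaleR lims ur wr)
  then have 2: "lin x' lam' w' = 0" using LIMSEQ_unique[OF Lw] sym unfolding z by simp
  show False using limit_kernel[OF H' 1 2 n1(3)] n1 by auto
qed

lemma limit_of_kernels: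
  assumes v: "\<And>n. v n \<in> H" "\<And>n. norm (v n) = 1" "\<And>n. L n (v n) = 0"
  obtains r :: "nat \<Rightarrow> nat" and v' where "strict_mono r" "(\<lambda>n. v (r n)) \<longlonglongrightarrow> v'" "v' \<in> H" "norm v' = 1" "lin x' lam' v' = 0"
proof -
  have "bounded (range v)" using v(2) by (intro boundedI[of _ 1]) auto
  then obtain r v' where r: "strict_mono r" "(v \<circ> r) \<longlonglongrightarrow> v'" using bounded_subsequence by blast
  interpret sub: convergent_sequence i0 l \<eta> a \<theta> g N K T "h \<circ> r" "x \<circ> r" "lam \<circ> r" x' lam'
    by (rule convergent_subsequence[OF r(1)])
  have vr: "(\<lambda>n. v (r n)) \<longlonglongrightarrow> v'" using r(2) by (simp add: o_def)
  have "(\<lambda>n. L (r n) (v (r n))) \<longlonglongrightarrow> lin x' lam' v'"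
    using sub.limit_linearization[OF _ vr] v(1) by (simp add: o_def)
  then have "lin x' lam' v' = 0" using v(3) by (simp add: LIMSEQ_const_iff)
  moreover have "v' \<in> H" using closed_sequentially[OF closed_H _ vr] v(1) by blast
  moreover have "norm v' = 1" using LIMSEQ_unique[OF tendsto_norm[OF vr]] v(2) by simp
  ultimately show thesis using that[OF r(1) vr] by blast
qed

text \<open>For large n the two-dimensional degeneracy is excluded, so an eigenvalue on the
  imaginary axis can only be 0, and it has a real eigenvector.\<close>

lemma unit_kernel_vectors:
  assumes "\<And>n. (x n, lam n) \<notin> hyperbolic_zeros (h n)"
  obtains r :: "nat \<Rightarrow> nat" and v where "strict_mono r" "\<And>n. \<not> two_dim_null (L (r n))" "\<And>n. v n \<in> H" "\<And>n. norm (v n) = 1"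
    "\<And>n. L (r n) (v n) = 0"
proof -
  have "\<forall>\<^sub>F n in sequentially. \<not> two_dim_null (L n)"
  proof (rule ccontr)
    assume "\<not> ?thesis"
    then obtain r :: "nat \<Rightarrow> nat" where r: "strict_mono r" "\<And>n. two_dim_null (L (r n))"
      using not_eventually_sequentiallyD[of "\<lambda>n. \<not> two_dim_null (L n)"] by blast
    interpret sub: convergent_sequence i0 l \<eta> a \<theta> g N K T "h \<circ> r" "x \<circ> r" "lam \<circ> r" x' lam'
      by (rule convergent_subsequence[OF r(1)])
    show False using sub.not_always_two_dim_null r(2) by (simp add: o_def)
  qed
  then obtain m where m: "\<And>n. n \<ge> m \<Longrightarrow> \<not> two_dim_null (L n)" by (auto simp: eventually_sequentially)
  define r where "r n = n + m" for n
  have nt: "\<not> two_dim_null (L (r n))" for n using m by (simp add: r_def)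
  have "\<exists>v\<in>H. norm v = 1 \<and> L (r n) v = 0" for n
  proof -
    obtain a b \<beta> where ab: "a \<in> H" "b \<in> H" "a \<noteq> 0 \<or> b \<noteq> 0" "L (r n) a = - (\<beta> *\<^sub>R b)" "L (r n) b = \<beta> *\<^sub>R a"
      using assms[of "r n"] non_hyperbolic_iff[OF z[of "r n"]] by blast
    have "\<beta> = 0" using two_dim_null_if_imaginary[OF linear_L ab] nt by blast
    then obtain c where c: "c \<in> H" "c \<noteq> 0" "L (r n) c = 0" using ab by auto
    then show ?thesis
      by (intro bexI[of _ "(1 / norm c) *\<^sub>R c"])
         (auto simp: linear_scale[OF linear_L] intro!: subspace_scale[OF subspace_H])
  qed
  then obtain v where "\<And>n. v n \<in> H" "\<And>n. norm (v n) = 1" "\<And>n. L (r n) (v n) = 0" by metis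
  moreover have "strict_mono r" by (simp add: r_def strict_mono_def)
  ultimately show thesis using that nt by blast
qed

lemma limit_degenerate:
  assumes "\<And>n. (x n, lam n) \<notin> hyperbolic_zeros (h n)"
  obtains v where "v \<in> H" "v \<noteq> 0" "lin x' lam' v = 0"
proof -
  obtain r :: "nat \<Rightarrow> nat" and v where r: "strict_mono r" "\<And>n. v n \<in> H" "\<And>n. norm (v n) = 1" "\<And>n. L (r n) (v n) = 0"
    using unit_kernel_vectors[OF assms] by metis
  interpret sub: convergent_sequence i0 l \<eta> a \<theta> g N K T "h \<circ> r" "x \<circ> r" "lam \<circ> r" x' lam'
    by (rule convergent_subsequence[OF r(1)])
  show thesis
    using sub.limit_of_kernels[of v] r that by (metis comp_apply norm_zero zero_neq_one)
qed

text \<open>The left null vectors also tend to a kernel vector, because the limit is symmetric. Both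
  limits are then nonzero multiples of \<open>ker_vec S\<close>, for which the two saddle-node
  coefficients are nonzero.\<close>

lemma not_always_tangential:
  assumes fold: "(x', lam') = fold_pt S" and S: "S \<subseteq> others" "excess S \<noteq> 0"
    and v: "\<And>n. v n \<in> H" "\<And>n. norm (v n) = 1" "\<And>n. L n (v n) = 0"
    and w: "\<And>n. w n \<in> H" "\<And>n. norm (w n) = 1" "\<And>n u. u \<in> H \<Longrightarrow> w n \<bullet> L n u = 0"
  shows "\<exists>n. w n \<bullet> vector_derivative (\<lambda>\<mu>. h n (x n, \<mu>)) (at (lam n)) \<noteq> 0 \<and>
    w n \<bullet> deriv_on H (\<lambda>y. h n (y, lam n)) [v n, v n] (x n) \<noteq> 0"
proof (rule ccontr)
  assume *: "\<not> ?thesis"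
  have "norm (v n, w n) \<le> 2" for n using norm_Pair_le[of "v n" "w n"] v w by simp
  then have "bounded (range (\<lambda>n. (v n, w n)))" by (auto intro: boundedI)
  then obtain lm r where r: "strict_mono r" "((\<lambda>n. (v n, w n)) \<circ> r) \<longlonglongrightarrow> lm"
    using bounded_subsequence by blast
  define v' w' where "v' = fst lm" and "w' = snd lm"
  have vr: "(\<lambda>n. v (r n)) \<longlonglongrightarrow> v'" and wr: "(\<lambda>n. w (r n)) \<longlonglongrightarrow> w'"
    using tendsto_fst[OF r(2)] tendsto_snd[OF r(2)] by (simp_all add: o_def v'_def w'_def)
  interpret sub: convergent_sequence i0 l \<eta> a \<theta> g N K T "h \<circ> r" "x \<circ> r" "lam \<circ> r" x' lam'
    by (rule convergent_subsequence[OF r(1)])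
  have H': "v' \<in> H" "w' \<in> H"
    using closed_sequentially[OF closed_H _ vr] closed_sequentially[OF closed_H _ wr] v w by blast+
  have n1: "norm v' = 1" "norm w' = 1"
    using LIMSEQ_unique[OF tendsto_norm[OF vr]] LIMSEQ_unique[OF tendsto_norm[OF wr]] v w by simp_all
  have "(\<lambda>n. L (r n) (v (r n))) \<longlonglongrightarrow> lin x' lam' v'"
    using sub.limit_linearization[OF _ vr] v(1) by (simp add: o_def)
  then have kv: "lin x' lam' v' = 0" using v(3) by (simp add: LIMSEQ_const_iff)
  have "w' \<bullet> lin x' lam' u = 0" if u: "u \<in> H" for u
  proof -
    have "(\<lambda>n. w (r n) \<bullet> L (r n) u) \<longlonglongrightarrow> w' \<bullet> lin x' lam' u"
      using sub.limit_linearization[of "\<lambda>_. u" u] u by (intro tendsto_inner wr) (simp add: o_def)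
    then show ?thesis using w(3)[OF u] by (simp add: LIMSEQ_const_iff)
  qed
  then have "lin x' lam' w' \<bullet> lin x' lam' w' = 0"
    using lin_symmetric[OF H'(2) lin_in_H[OF H'(2)]] lin_in_H[OF H'(2)] by metis
  then have kw: "lin x' lam' w' = 0" by simp
  have or: "(x', lam') \<in> orthant S" using fold_pt_zero(2)[OF S] fold by simp
  have nz: "v' \<noteq> 0" "w' \<noteq> 0" using n1 by auto
  obtain c where c: "v' = c *\<^sub>R ker_vec S" using degenerate_zero(3)[OF limit_zero or S(1) H'(1) nz(1) kv] by blast
  obtain d where d: "w' = d *\<^sub>R ker_vec S" using degenerate_zero(3)[OF limit_zero or S(1) H'(2) nz(2) kw] by blast
  have cd: "c \<noteq> 0" "d \<noteq> 0" using n1 c d by auto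
  let ?A = "\<lambda>n. w n \<bullet> vector_derivative (\<lambda>\<mu>. h n (x n, \<mu>)) (at (lam n))"
  let ?B = "\<lambda>n. w n \<bullet> deriv_on H (\<lambda>y. h n (y, lam n)) [v n, v n] (x n)"
  have lam_a: "lam'\<^sup>2 < a" using fold_lam_small[OF S] fold by (simp add: fold_pt_def)
  have "(\<lambda>n. ?A (r n)) \<longlonglongrightarrow> w' \<bullet> x'"
    using sub.limit_parameter_derivative[OF lam_a] by (intro tendsto_inner wr) (simp add: o_def)
  moreover have "(\<lambda>n. ?B (r n)) \<longlonglongrightarrow> w' \<bullet> (- 2 *\<^sub>R B_form v' v')"
    using sub.limit_second_derivative[OF _ vr] v(1)
    by (intro tendsto_inner wr) (simp add: o_def del: deriv_on.simps)
  ultimately have "(\<lambda>n. ?A (r n) * ?B (r n)) \<longlonglongrightarrow> (w' \<bullet> x') * (w' \<bullet> (- 2 *\<^sub>R B_form v' v'))"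
    by (rule tendsto_mult)
  \<comment> \<open>Which of the two coefficients vanishes may depend on n; their product vanishes
    for every n and so has limit 0.\<close>
  moreover have "?A n * ?B n = 0" for n using * by (auto simp del: deriv_on.simps)
  ultimately have "(w' \<bullet> x') * (w' \<bullet> (- 2 *\<^sub>R B_form v' v')) = 0"
    by (simp only: LIMSEQ_const_iff)
  moreover have "w' \<bullet> x' \<noteq> 0" using fold_kernel(2)[OF S] cd fold by (metis d fst_conv inner_scaleR_left mult_eq_0_iff)
  moreover have "w' \<bullet> (- 2 *\<^sub>R B_form v' v') \<noteq> 0"
    using fold_kernel(3)[OF S] cd by (simp add: c d B_form.scaleR_left B_form.scaleR_right)
  ultimately show False by simp
qed

text \<open>A single n suffices, since this refutes sequences in which no term is a saddle-node.
  Simplicity of the eigenvalue 0 and the absence of other imaginary eigenvalues come from excluding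
  \<open>two_dim_null\<close>.\<close>

lemma some_saddle_node:
  assumes fold: "(x', lam') = fold_pt S" and S: "S \<subseteq> others" "excess S \<noteq> 0"
    and nh: "\<And>n. (x n, lam n) \<notin> hyperbolic_zeros (h n)"
  shows "\<exists>n. saddle_node (h n) (x n, lam n)"
proof -
  obtain r :: "nat \<Rightarrow> nat" and v where r: "strict_mono r" "\<And>n. \<not> two_dim_null (L (r n))" "\<And>n. v n \<in> H" "\<And>n. norm (v n) = 1"
    "\<And>n. L (r n) (v n) = 0" using unit_kernel_vectors[OF nh] by metis
  have v0: "v n \<noteq> 0" for n using r(4)[of n] by auto
  have "\<exists>w\<in>H. norm w = 1 \<and> (\<forall>u\<in>H. w \<bullet> L (r n) u = 0)" for n
    using left_null_vector[OF linear_L L_in_H r(2) r(3) v0 r(5)] by metis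
  then obtain w where w: "\<And>n. w n \<in> H" "\<And>n. norm (w n) = 1" "\<And>n u. u \<in> H \<Longrightarrow> w n \<bullet> L (r n) u = 0"
    by metis
  interpret sub: convergent_sequence i0 l \<eta> a \<theta> g N K T "h \<circ> r" "x \<circ> r" "lam \<circ> r" x' lam'
    by (rule convergent_subsequence[OF r(1)])
  obtain n where n: "w n \<bullet> vector_derivative (\<lambda>\<mu>. h (r n) (x (r n), \<mu>)) (at (lam (r n))) \<noteq> 0"
    "w n \<bullet> deriv_on H (\<lambda>y. h (r n) (y, lam (r n))) [v n, v n] (x (r n)) \<noteq> 0"
    using sub.not_always_tangential[OF fold S, of v w] r w by (auto simp del: deriv_on.simps)
  let ?L = "L (r n)"
  have "0 \<in> eigenvalues ?L" unfolding eigenvalue_0_iff[OF linear_L] using r v0 by blast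
  moreover have "alg_mult ?L 0 = 1"
    by (rule alg_mult_0_eq_1[OF linear_L L_in_H r(3) v0 r(5)])
       (use simple_zero_eigenvalue[OF linear_L r(2) r(3) v0 r(5)] in auto)
  moreover have "Re \<mu> \<noteq> 0" if "\<mu> \<in> eigenvalues ?L" "\<mu> \<noteq> 0" for \<mu>
  proof
    assume "Re \<mu> = 0"
    then have "\<exists>\<nu>\<in>eigenvalues ?L. Re \<nu> = 0 \<and> Im \<nu> = Im \<mu>" using that by blast
    then obtain a b where ab: "a \<in> H" "b \<in> H" "a \<noteq> 0 \<or> b \<noteq> 0" "?L a = - (Im \<mu> *\<^sub>R b)" "?L b = Im \<mu> *\<^sub>R a"
      unfolding imaginary_eigenvalue_iff by blast
    have "Im \<mu> \<noteq> 0" using that(2) \<open>Re \<mu> = 0\<close> by (auto simp: complex_eq_iff)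
    then show False using two_dim_null_if_imaginary[OF linear_L ab] r(2) by blast
  qed
  moreover have "w n \<noteq> 0" using w(2)[of n] by auto
  ultimately have "saddle_node (h (r n)) (x (r n), lam (r n))"
    unfolding saddle_node_def Let_def prod.case using z[of "r n"] r(3,5)[of n] v0[of n] w(1)[of n] w(3)[of _ n] n by blast
  then show ?thesis by blast
qed

end

section \<open>Uniqueness of the folds\<close>

lemma lin_diff:
  "lin x lam v - lin y mu w = lin x lam (v - w) + (lam - mu) *\<^sub>R w - 2 *\<^sub>R B_form (x - y) w"
  by (simp add: lin_def B_form.diff_left B_form.diff_right algebra_simps)

context perturbed_family
begin

text \<open>The three equations are the linearization of the extended system h = 0, D_x h v = 0, |v|
  = 1 in the direction (\<xi>, \<tau>, \<zeta>); at a generic saddle-node this system is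
  nonsingular. Pairing with the kernel vector removes the range terms: the first equation yields
  \<tau> = 0, the second kills the component of \<xi> along the kernel through the cubic
  coefficient, and the normalisation then gives \<zeta> = 0.\<close>

lemma double_fold_limit:
  assumes S: "S \<subseteq> others" "excess S \<noteq> 0" and fold: "(x', lam') = fold_pt S"
    and H: "\<xi> \<in> H" "\<zeta> \<in> H" "v \<in> H" "v \<noteq> 0" and kv: "lin x' lam' v = 0"
    and eq1: "lin x' lam' \<xi> + \<tau> *\<^sub>R x' = 0"
    and eq2: "lin x' lam' \<zeta> + \<tau> *\<^sub>R v - 2 *\<^sub>R B_form \<xi> v = 0"
    and eq3: "v \<bullet> \<zeta> = 0"
  shows "\<xi> = 0 \<and> \<tau> = 0 \<and> \<zeta> = 0"
proof -
  let ?e = "ker_vec S"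
  have z: "(x', lam') \<in> zeros g" "(x', lam') \<in> orthant S" using fold_pt_zero[OF S] fold by auto
  have eH: "?e \<in> H" by (rule ker_vec_in_H[OF S(1)])
  have ke: "lin x' lam' ?e = 0" using fold_kernel(1)[OF S] fold by (metis fst_conv snd_conv)
  have perp: "?e \<bullet> lin x' lam' u = 0" if "u \<in> H" for u
    using lin_symmetric[OF eH that, of x' lam'] ke by simp
  have "?e \<bullet> x' \<noteq> 0" using fold_kernel(2)[OF S] fold by (metis fst_conv)
  moreover have "?e \<bullet> (lin x' lam' \<xi> + \<tau> *\<^sub>R x') = 0" using eq1 by simp
  ultimately have \<tau>: "\<tau> = 0" using perp[OF H(1)] by (simp add: inner_add_right)
  obtain d where d: "v = d *\<^sub>R ?e" using degenerate_zero(3)[OF z S(1) H(3,4) kv] by blast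
  have d0: "d \<noteq> 0" using d H(4) by auto
  have "\<exists>c. \<xi> = c *\<^sub>R ?e"
  proof (cases "\<xi> = 0")
    case True
    then show ?thesis by (intro exI[of _ 0]) simp
  next
    case False
    have "lin x' lam' \<xi> = 0" using eq1 \<tau> by simp
    then show ?thesis using degenerate_zero(3)[OF z S(1) H(1) False] by blast
  qed
  then obtain c where c: "\<xi> = c *\<^sub>R ?e" ..
  have "?e \<bullet> (lin x' lam' \<zeta> + \<tau> *\<^sub>R v - 2 *\<^sub>R B_form \<xi> v) = 0" using eq2 by simp
  then have "c * d * (?e \<bullet> B_form ?e ?e) = 0"
    using perp[OF H(2)] \<tau> by (simp add: inner_diff_right c d B_form.scaleR_left B_form.scaleR_right) blast
  then have "c = 0" using d0 fold_kernel(3)[OF S] by simp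
  then have \<xi>: "\<xi> = 0" using c by simp
  then have "lin x' lam' \<zeta> = 0" using eq2 \<tau> by (simp add: B_form.zero_left)
  then have "\<zeta> = 0"
    using degenerate_zero(3)[OF z S(1) H(2)] eq3 d d0 ker_vec_nonzero[of S] by (metis
        inner_eq_zero_iff inner_scaleR_left inner_scaleR_right mult_eq_0_iff scale_eq_0_iff)
  then show ?thesis using \<xi> \<tau> by simp
qed

text \<open>The difference of two solutions (x, \<lambda>, v) of the extended system is divided by
  its size \<open>t\<close>. The limit solves the linearized system, hence is zero, although its
  norm was kept equal to 1.\<close>

lemma no_two_folds_aux:
  assumes X: "convergent_sequence i0 l \<eta> a \<theta> g N K T h x lam x' lam'"
    and Y: "convergent_sequence i0 l \<eta> a \<theta> g N K T h y mu x' lam'"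
    and S: "S \<subseteq> others" "excess S \<noteq> 0" and fold: "(x', lam') = fold_pt S"
    and v: "\<And>n. v n \<in> H" "\<And>n. norm (v n) = 1" "\<And>n. linearization (h n) (x n, lam n) (v n) = 0"
    and w: "\<And>n. w n \<in> H" "\<And>n. norm (w n) = 1" "\<And>n. linearization (h n) (y n, mu n) (w n) = 0"
    and t: "\<And>n. t n = norm (x n - y n) + \<bar>lam n - mu n\<bar> + norm (v n - w n)" "\<And>n. t n > 0"
    and v_lim: "v \<longlonglongrightarrow> v'" and w_lim: "w \<longlonglongrightarrow> v'"
    and \<xi>_lim: "(\<lambda>n. (1 / t n) *\<^sub>R (x n - y n)) \<longlonglongrightarrow> \<xi>"
    and \<tau>_lim: "(\<lambda>n. (1 / t n) * (lam n - mu n)) \<longlonglongrightarrow> \<tau>"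
    and \<zeta>_lim: "(\<lambda>n. (1 / t n) *\<^sub>R (v n - w n)) \<longlonglongrightarrow> \<zeta>"
  shows False
proof -
  interpret X: convergent_sequence i0 l \<eta> a \<theta> g N K T h x lam x' lam' by (rule X)
  interpret Y: convergent_sequence i0 l \<eta> a \<theta> g N K T h y mu x' lam' by (rule Y)
  note h = X.h
  note inv_lim = LIMSEQ_inverse_real_of_nat
  have lam_a: "lam'\<^sup>2 < a" using fold_lam_small[OF S] fold by (simp add: fold_pt_def)
  have ev: "\<forall>\<^sub>F n in sequentially. (x n, lam n) \<in> N \<and> (y n, mu n) \<in> N \<and> (lam n)\<^sup>2 < a \<and> (mu n)\<^sup>2 < a"
    using X.eventually_N Y.eventually_N order_tendstoD(2)[OF tendsto_power[OF X.lam_lim] lam_a]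
      order_tendstoD(2)[OF tendsto_power[OF Y.lam_lim] lam_a]
    by eventually_elim auto
  have dp: "norm ((x n, lam n) - (y n, mu n)) \<le> t n" for n
    using norm_Pair_le[of "x n - y n" "lam n - mu n"] norm_ge_zero[of "v n - w n"] unfolding t
    by (simp add: add_increasing2)
  have scaled_le: "norm ((1 / t n) *\<^sub>R r) \<le> inverse (real (Suc n))"
    if "norm r \<le> inverse (real (Suc n)) * t n" for r :: "real ^ 'k" and n
    using that t(2)[of n] by (simp add: divide_le_eq)
  let ?\<xi> = "\<lambda>n. (1 / t n) *\<^sub>R (x n - y n)" and ?\<tau> = "\<lambda>n. (1 / t n) * (lam n - mu n)"
    and ?\<zeta> = "\<lambda>n. (1 / t n) *\<^sub>R (v n - w n)"
  have HH: "\<xi> \<in> H" "\<zeta> \<in> H" "v' \<in> H"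
    using closed_sequentially[OF closed_H _ \<xi>_lim] closed_sequentially[OF closed_H _ \<zeta>_lim]
      closed_sequentially[OF closed_H _ v_lim] v(1) w(1) X.x_H Y.x_H
    by (meson subspace_scale[OF subspace_H] subspace_diff[OF subspace_H])+
  have nv: "norm v' = 1" using LIMSEQ_unique[OF tendsto_norm[OF v_lim]] v by simp
  have kv: "lin x' lam' v' = 0"
    using X.limit_linearization[OF v(1) v_lim] v(3) by (simp add: LIMSEQ_const_iff)
  have eq1: "lin x' lam' \<xi> + \<tau> *\<^sub>R x' = 0"
  proof -
    \<comment> \<open>The midpoint form of the secant is exact, so the only error is the variation
      of h - g between the two points, at most \<open>t n / (n+1)\<close>.\<close>
    let ?f = "\<lambda>n. lin ((1/2) *\<^sub>R (x n + y n)) ((lam n + mu n) / 2) (?\<xi> n) + ?\<tau> n *\<^sub>R (1/2) *\<^sub>R (x n + y n)"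
    have "?f \<longlonglongrightarrow> lin ((1/2) *\<^sub>R (x' + x')) ((lam' + lam') / 2) \<xi> + \<tau> *\<^sub>R (1/2) *\<^sub>R (x' + x')"
      by (intro tendsto_intros lin_tendsto X.x_lim Y.x_lim X.lam_lim Y.lam_lim \<xi>_lim \<tau>_lim) simp
    moreover have "?f \<longlonglongrightarrow> 0"
    proof (rule Lim_null_comparison[OF _ inv_lim])
      show "\<forall>\<^sub>F n in sequentially. norm (?f n) \<le> inverse (real (Suc n))"
        using ev
      proof eventually_elim
        case (elim n)
        have "g (x n, lam n) - g (y n, mu n) =
            lin ((1/2) *\<^sub>R (x n + y n)) ((lam n + mu n) / 2) (x n - y n) + (lam n - mu n) *\<^sub>R (1/2) *\<^sub>R (x n + y n)"
          using elim by (simp add: g_eq X.x_H Y.x_H theta_eq pert_diff)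
        then have "?f n = (1 / t n) *\<^sub>R (g (x n, lam n) - g (y n, mu n))"
          using linear_scale[OF linear_lin] by (simp add: scaleR_add_right)
        moreover have "norm (g (x n, lam n) - g (y n, mu n)) \<le> inverse (real (Suc n)) * t n"
        proof -
          have "norm ((h n (x n, lam n) - g (x n, lam n)) - (h n (y n, mu n) - g (y n, mu n)))
              \<le> inverse (real (Suc n)) * norm ((x n, lam n) - (y n, mu n))"
            by (rule close_lipschitz[OF h]) (simp_all add: HR_def X.x_H Y.x_H)
          also have "\<dots> \<le> inverse (real (Suc n)) * t n" using dp by (intro mult_left_mono) auto
          finally show ?thesis using X.z[of n] Y.z[of n] by (simp add: zeros_def norm_minus_commute)
        qed
        ultimately show ?case using scaled_le by simp
      qed
    qed
    ultimately show ?thesis using LIMSEQ_unique by (fastforce simp: scaleR_2[symmetric])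
  qed
  have eq2: "lin x' lam' \<zeta> + \<tau> *\<^sub>R v' - 2 *\<^sub>R B_form \<xi> v' = 0"
  proof -
    let ?f = "\<lambda>n. lin (x n) (lam n) (?\<zeta> n) + ?\<tau> n *\<^sub>R w n - 2 *\<^sub>R B_form (?\<xi> n) (w n)"
    have "?f \<longlonglongrightarrow> lin x' lam' \<zeta> + \<tau> *\<^sub>R v' - 2 *\<^sub>R B_form \<xi> v'"
      by (intro tendsto_intros lin_tendsto B_form.tendsto X.x_lim X.lam_lim \<xi>_lim \<tau>_lim \<zeta>_lim w_lim)
    moreover have "?f \<longlonglongrightarrow> 0"
    proof (rule Lim_null_comparison[OF _ inv_lim])
      show "\<forall>\<^sub>F n in sequentially. norm (?f n) \<le> inverse (real (Suc n))"
        using ev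
      proof eventually_elim
        case (elim n)
        let ?L = "\<lambda>h x lam. linearization h (x, lam)"
        let ?E = "\<lambda>x lam u. ?L (h n) x lam u - ?L g x lam u"
        have lg: "?L g (x n) (lam n) u = lin (x n) (lam n) u" "?L g (y n) (mu n) u = lin (y n) (mu n) u"
          if "u \<in> H" for u using linearization_g that elim X.x_H Y.x_H by auto
        have "?f n = (1 / t n) *\<^sub>R (lin (x n) (lam n) (v n) - lin (y n) (mu n) (w n))"
          unfolding lin_diff linear_scale[OF linear_lin] B_form.scaleR_left
          by (simp add: scaleR_add_right scaleR_diff_right)
        \<comment> \<open>Both linearizations of \<open>h n\<close> vanish on their own kernel
          vectors. What remains is the error of the linearization, split into a change of direction
          and a change of base point.\<close>
        also have "lin (x n) (lam n) (v n) - lin (y n) (mu n) (w n) =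
            - (?E (x n) (lam n) (v n - w n) + (?E (x n) (lam n) (w n) - ?E (y n) (mu n) (w n)))"
          using v(3)[of n] w(3)[of n] lg v(1)[of n] w(1)[of n]
          by (simp add: linear_diff[OF X.linear_L] linear_diff[OF linear_linearization[OF g_smooth_on X.x_H]])
        finally have f: "?f n = (1 / t n) *\<^sub>R
            (- (?E (x n) (lam n) (v n - w n) + (?E (x n) (lam n) (w n) - ?E (y n) (mu n) (w n))))" .
        have vw: "v n - w n \<in> H" by (intro subspace_diff[OF subspace_H] v w)
        have "norm (?E (x n) (lam n) (v n - w n)) \<le> inverse (real (Suc n)) * norm (v n - w n)"
          by (rule close_linearization[OF h X.x_H vw])
        moreover have "norm (?E (x n) (lam n) (w n) - ?E (y n) (mu n) (w n))
            \<le> inverse (real (Suc n)) * norm (w n) * norm ((x n, lam n) - (y n, mu n))"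
          by (rule close_linearization_lipschitz[OF h X.x_H Y.x_H w(1)])
        moreover have "norm ((x n, lam n) - (y n, mu n)) + norm (v n - w n) \<le> t n"
          using norm_Pair_le[of "x n - y n" "lam n - mu n"] unfolding t by simp
        ultimately have "norm (- (?E (x n) (lam n) (v n - w n) +
            (?E (x n) (lam n) (w n) - ?E (y n) (mu n) (w n)))) \<le> inverse (real (Suc n)) * t n"
          using norm_triangle_ineq[of "?E (x n) (lam n) (v n - w n)" "?E (x n) (lam n) (w n) - ?E (y n) (mu n) (w n)"]
            mult_left_mono[of "norm ((x n, lam n) - (y n, mu n)) + norm (v n - w n)" "t n" "inverse (real (Suc n))"] w(2)[of n]
          unfolding norm_minus_cancel by (simp add: distrib_left)
        then show ?case unfolding f by (rule scaled_le)
      qed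
    qed
    ultimately show ?thesis using LIMSEQ_unique by blast
  qed
  have eq3: "v' \<bullet> \<zeta> = 0"
  proof -
    have "(\<lambda>n. (v n + w n) \<bullet> ?\<zeta> n) \<longlonglongrightarrow> (v' + v') \<bullet> \<zeta>"
      by (intro tendsto_intros v_lim w_lim \<zeta>_lim)
    \<comment> \<open>Equal norms make v + w orthogonal to v - w; this is the secant form of the
      normalisation.\<close>
    moreover have "(v n + w n) \<bullet> ?\<zeta> n = 0" for n
    proof -
      have "(v n + w n) \<bullet> (v n - w n) = 0"
        using v(2)[of n] w(2)[of n] inner_commute[of "v n" "w n"]
        by (simp add: inner_diff_right inner_add_left norm_eq_1)
      then show ?thesis unfolding inner_scaleR_right by simp
    qed
    ultimately have "(v' + v') \<bullet> \<zeta> = 0" by (simp only: LIMSEQ_const_iff)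
    then show ?thesis unfolding inner_add_left by simp
  qed
  have zero: "\<xi> = 0 \<and> \<tau> = 0 \<and> \<zeta> = 0"
    using double_fold_limit[OF S fold HH _ kv eq1 eq2 eq3] nv by fastforce
  have "(\<lambda>n. norm (?\<xi> n) + \<bar>?\<tau> n\<bar> + norm (?\<zeta> n)) \<longlonglongrightarrow> norm \<xi> + \<bar>\<tau>\<bar> + norm \<zeta>"
    by (intro tendsto_intros \<xi>_lim \<tau>_lim \<zeta>_lim)
  moreover have "norm (?\<xi> n) + \<bar>?\<tau> n\<bar> + norm (?\<zeta> n) = 1" for n
  proof -
    have "norm (?\<xi> n) = (1 / t n) * norm (x n - y n)" "\<bar>?\<tau> n\<bar> = (1 / t n) * \<bar>lam n - mu n\<bar>"
      "norm (?\<zeta> n) = (1 / t n) * norm (v n - w n)"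
      using t(2)[of n] by (simp_all add: abs_mult)
    then have "norm (?\<xi> n) + \<bar>?\<tau> n\<bar> + norm (?\<zeta> n) = (1 / t n) * t n"
      by (simp only: t(1) distrib_left)
    then show ?thesis using t(2)[of n] by simp
  qed
  ultimately have "norm \<xi> + \<bar>\<tau>\<bar> + norm \<zeta> = 1" by (simp add: LIMSEQ_const_iff)
  then show False using zero by simp
qed

text \<open>Nonnegative products with \<open>ker_vec S\<close> fix the signs of the unit kernel
  vectors, so both sequences have the same limit along a common subsequence. Without this, v - w
  might fail to tend to 0.\<close>

lemma no_two_folds:
  assumes X: "convergent_sequence i0 l \<eta> a \<theta> g N K T h x lam x' lam'"
    and Y: "convergent_sequence i0 l \<eta> a \<theta> g N K T h y mu x' lam'"
    and S: "S \<subseteq> others" "excess S \<noteq> 0" and fold: "(x', lam') = fold_pt S"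
    and ne: "\<And>n. (x n, lam n) \<noteq> (y n, mu n)"
    and v: "\<And>n. v n \<in> H" "\<And>n. norm (v n) = 1" "\<And>n. linearization (h n) (x n, lam n) (v n) = 0"
      "\<And>n. v n \<bullet> ker_vec S \<ge> 0"
    and w: "\<And>n. w n \<in> H" "\<And>n. norm (w n) = 1" "\<And>n. linearization (h n) (y n, mu n) (w n) = 0"
      "\<And>n. w n \<bullet> ker_vec S \<ge> 0"
  shows False
proof -
  interpret X: convergent_sequence i0 l \<eta> a \<theta> g N K T h x lam x' lam' by (rule X)
  interpret Y: convergent_sequence i0 l \<eta> a \<theta> g N K T h y mu x' lam' by (rule Y)
  define t where "t n = norm (x n - y n) + \<bar>lam n - mu n\<bar> + norm (v n - w n)" for n
  have t: "t n > 0" for n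
  proof -
    have "norm (x n - y n) > 0 \<or> \<bar>lam n - mu n\<bar> > 0" using ne[of n] by auto
    then show ?thesis unfolding t_def
      using norm_ge_zero[of "x n - y n"] abs_ge_zero[of "lam n - mu n"] norm_ge_zero[of "v n - w n"] by linarith
  qed
  let ?\<xi> = "\<lambda>n. (1 / t n) *\<^sub>R (x n - y n)" and ?\<tau> = "\<lambda>n. (1 / t n) * (lam n - mu n)"
    and ?\<zeta> = "\<lambda>n. (1 / t n) *\<^sub>R (v n - w n)"
  have le: "norm (?\<xi> n) \<le> 1" "norm (?\<tau> n) \<le> 1" "norm (?\<zeta> n) \<le> 1" for n
    using t[of n] norm_ge_zero[of "x n - y n"] abs_ge_zero[of "lam n - mu n"] norm_ge_zero[of "v n - w n"]
    by (simp_all add: abs_mult t_def)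
  let ?P = "\<lambda>n. (v n, w n, ?\<xi> n, ?\<tau> n, ?\<zeta> n)"
  have "norm (?P n) \<le> 5" for n
  proof -
    have "norm (?P n) \<le> norm (v n) + (norm (w n) + (norm (?\<xi> n) + (norm (?\<tau> n) + norm (?\<zeta> n))))"
      by (intro order_trans[OF norm_Pair_le] add_left_mono norm_Pair_le)
    then show ?thesis using le[of n] v(2)[of n] w(2)[of n] by linarith
  qed
  then have "bounded (range ?P)" by (auto intro: boundedI)
  then obtain q r where r: "strict_mono r" "(?P \<circ> r) \<longlonglongrightarrow> q" using bounded_subsequence by blast
  obtain v' w' \<xi> \<tau> \<zeta> where q: "q = (v', w', \<xi>, \<tau>, \<zeta>)" by (cases q)
  have lims: "(\<lambda>n. v (r n)) \<longlonglongrightarrow> v'" "(\<lambda>n. w (r n)) \<longlonglongrightarrow> w'" "(\<lambda>n. ?\<xi> (r n)) \<longlonglongrightarrow> \<xi>"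
    "(\<lambda>n. ?\<tau> (r n)) \<longlonglongrightarrow> \<tau>" "(\<lambda>n. ?\<zeta> (r n)) \<longlonglongrightarrow> \<zeta>"
    using tendsto_fst[OF r(2)] tendsto_fst[OF tendsto_snd[OF r(2)]]
      tendsto_fst[OF tendsto_snd[OF tendsto_snd[OF r(2)]]]
      tendsto_fst[OF tendsto_snd[OF tendsto_snd[OF tendsto_snd[OF r(2)]]]]
      tendsto_snd[OF tendsto_snd[OF tendsto_snd[OF tendsto_snd[OF r(2)]]]]
    by (simp_all add: o_def q)
  have z: "(x', lam') \<in> zeros g" "(x', lam') \<in> orthant S" using fold_pt_zero[OF S] fold by auto
  have unit_ker: "\<exists>c>0. u' = c *\<^sub>R ker_vec S \<and> c * norm (ker_vec S) = 1"
    if u: "(\<lambda>n. u (r n)) \<longlonglongrightarrow> u'" "\<And>n. u n \<in> H" "\<And>n. norm (u n) = 1" "\<And>n. u n \<bullet> ker_vec S \<ge> 0"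
      "lin x' lam' u' = 0" for u u'
  proof -
    have u'H: "u' \<in> H" using closed_sequentially[OF closed_H _ u(1)] u(2) by blast
    have nu: "norm u' = 1" using LIMSEQ_unique[OF tendsto_norm[OF u(1)]] u(3) by simp
    then have "u' \<noteq> 0" by auto
    then obtain c where c: "u' = c *\<^sub>R ker_vec S" using degenerate_zero(3)[OF z S(1) u'H _ u(5)] by blast
    have "u' \<bullet> ker_vec S \<ge> 0"
      using LIMSEQ_le_const[OF tendsto_inner[OF u(1) tendsto_const]] u(4) by blast
    moreover have "ker_vec S \<bullet> ker_vec S > 0" using ker_vec_nonzero[of S] by simp
    ultimately have "c \<ge> 0" by (auto simp: c zero_le_mult_iff simp del: inner_gt_zero_iff)
    moreover have "\<bar>c\<bar> * norm (ker_vec S) = 1" using nu by (simp add: c)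
    ultimately show ?thesis using c by (intro exI[of _ c]) (auto simp: less_le)
  qed
  have kv: "lin x' lam' v' = 0"
  proof -
    interpret X': convergent_sequence i0 l \<eta> a \<theta> g N K T "h \<circ> r" "x \<circ> r" "lam \<circ> r" x' lam'
      by (rule X.convergent_subsequence[OF r(1)])
    show ?thesis using X'.limit_linearization[OF _ lims(1)] v by (simp add: LIMSEQ_const_iff)
  qed
  have kw: "lin x' lam' w' = 0"
  proof -
    interpret Y': convergent_sequence i0 l \<eta> a \<theta> g N K T "h \<circ> r" "y \<circ> r" "mu \<circ> r" x' lam'
      by (rule Y.convergent_subsequence[OF r(1)])
    show ?thesis using Y'.limit_linearization[OF _ lims(2)] w by (simp add: LIMSEQ_const_iff)
  qed
  obtain c where c: "v' = c *\<^sub>R ker_vec S" "c * norm (ker_vec S) = 1"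
    using unit_ker[OF lims(1) v(1,2,4) kv] by blast
  obtain d where d: "w' = d *\<^sub>R ker_vec S" "d * norm (ker_vec S) = 1"
    using unit_ker[OF lims(2) w(1,2,4) kw] by blast
  have "c = d" using c(2) d(2) by (metis mult_right_cancel mult_zero_right zero_neq_one)
  then have wv: "w' = v'" using c d by simp
  show False
    by (rule no_two_folds_aux[OF X.convergent_subsequence[OF r(1)] Y.convergent_subsequence[OF r(1)] S fold,
        where v = "v \<circ> r" and w = "w \<circ> r" and t = "t \<circ> r" and v' = v' and \<xi> = \<xi> and \<tau> = \<tau> and \<zeta> = \<zeta>])
       (use v w lims t in \<open>simp_all add: o_def wv t_def[abs_def]\<close>)
qed

end

section \<open>The structure of small perturbations\<close>

context perturbed_family
begin

lemma extract_convergent: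
  assumes K: "compact K" and h: "\<And>n. close K (inverse (real (Suc n))) (h n)"
    and z: "\<And>n. (x n, lam n) \<in> zeros (h n)" "\<And>n. \<bar>lam n\<bar> \<le> T"
  obtains r x' lam' where "strict_mono (r :: nat \<Rightarrow> nat)"
    "convergent_sequence i0 l \<eta> a \<theta> g N K T (h \<circ> r) (x \<circ> r) (lam \<circ> r) x' lam'"
proof -
  interpret close_sequence i0 l \<eta> a \<theta> g N K T h x lam
    by unfold_locales (use assms in auto)
  have "range (\<lambda>n. (x n, lam n)) \<subseteq> range x \<times> range lam" by auto
  then have "bounded (range (\<lambda>n. (x n, lam n)))"
    using bounded_Times[OF bounded_x bounded_lam] bounded_subset by blast
  then obtain q r where r: "strict_mono r" "((\<lambda>n. (x n, lam n)) \<circ> r) \<longlonglongrightarrow> q"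
    using bounded_subsequence by blast
  interpret sub: close_sequence i0 l \<eta> a \<theta> g N K T "h \<circ> r" "x \<circ> r" "lam \<circ> r"
    by (rule subsequence[OF r(1)])
  have "convergent_sequence i0 l \<eta> a \<theta> g N K T (h \<circ> r) (x \<circ> r) (lam \<circ> r) (fst q) (snd q)"
    by unfold_locales (use tendsto_fst[OF r(2)] tendsto_snd[OF r(2)] in \<open>simp_all add: o_def\<close>)
  then show thesis using that[OF r(1)] by blast
qed

lemma close_outside:
  assumes c: "close K \<epsilon> h" and K: "compact K" and p: "p \<in> HR" "p \<notin> K"
  shows "p \<in> zeros h \<longleftrightarrow> p \<in> zeros g" "linearization h p = linearization g p"
    "p \<in> hyperbolic_zeros h \<longleftrightarrow> p \<in> hyperbolic_zeros g"
proof -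
  show z: "p \<in> zeros h \<longleftrightarrow> p \<in> zeros g" using closeD(4)[OF c p] by (simp add: zeros_def)
  obtain x lam where xl: "p = (x, lam)" by (cases p)
  have op: "open (- K)" using compact_imp_closed[OF K] by auto
  show lin: "linearization h p = linearization g p"
    unfolding xl by (rule linearization_cong[OF op]) (use p closeD(4)[OF c] in \<open>auto simp: xl HR_def\<close>)
  show "p \<in> hyperbolic_zeros h \<longleftrightarrow> p \<in> hyperbolic_zeros g"
    using z lin by (simp add: hyperbolic_zeros_def)
qed

text \<open>Symmetry of the linearization leaves 0 as the only possible eigenvalue on the imaginary
  axis, and degenerate zeros are already located.\<close>

lemma g_non_hyperbolic:
  assumes p: "p \<in> zeros g" "p \<notin> hyperbolic_zeros g" and S: "S \<subseteq> others" "p \<in> orthant S"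
  shows "excess S \<noteq> 0 \<and> p = fold_pt S"
proof -
  obtain x lam where xl: "p = (x, lam)" by (cases p)
  have x: "x \<in> H" "(x, lam) \<in> N" using p(1) zeros_N by (auto simp: xl zeros_def HR_def)
  obtain v w \<beta> where ab: "v \<in> H" "w \<in> H" "v \<noteq> 0 \<or> w \<noteq> 0"
    "linearization g p v = - (\<beta> *\<^sub>R w)" "linearization g p w = \<beta> *\<^sub>R v"
    using p non_hyperbolic_iff[OF p(1)] by blast
  have "lin x lam v = - (\<beta> *\<^sub>R w)" "lin x lam w = \<beta> *\<^sub>R v"
    using ab linearization_g[OF x] by (auto simp: xl)
  then have "lin x lam v = 0 \<and> lin x lam w = 0"
    by (intro symmetric_imaginary_eigenvalue[OF lin_symmetric ab(1,2)])
  then obtain u where "u \<in> H" "u \<noteq> 0" "lin x lam u = 0" using ab by blast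
  then show ?thesis using degenerate_zero(1,2)[of x lam S u] p(1) S by (simp add: xl)
qed

text \<open>The features of the zero set that small perturbations preserve by a limit argument.
  Existence of curves and folds is deliberately absent: it is obtained afterwards by continuation
  from parameters beyond the support of the perturbation.\<close>

definition structured :: "((real ^ 'k) \<times> real \<Rightarrow> real ^ 'k) \<Rightarrow> bool" where
  "structured h \<longleftrightarrow> (\<forall>p\<in>zeros h. \<exists>S\<in>Pow others. p \<in> orthant S) \<and>
    (\<forall>S\<in>Pow others.
      (\<forall>p\<in>zeros h \<inter> orthant S. p \<notin> hyperbolic_zeros h \<longrightarrow> excess S \<noteq> 0 \<and> saddle_node h p) \<and>
      (excess S = 0 \<longrightarrow> (\<forall>x y lam. (x, lam) \<in> zeros h \<inter> orthant S \<longrightarrow>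
         (y, lam) \<in> zeros h \<inter> orthant S \<longrightarrow> x = y)) \<and>
      (excess S \<noteq> 0 \<longrightarrow> (\<forall>p\<in>zeros h \<inter> orthant S. snd p \<noteq> 0) \<and>
         (\<forall>p\<in>zeros h \<inter> orthant S. \<forall>q\<in>zeros h \<inter> orthant S.
            p \<notin> hyperbolic_zeros h \<longrightarrow> q \<notin> hyperbolic_zeros h \<longrightarrow> p = q)))"

lemma close_finite_Ball:
  assumes "finite A" "\<And>S. S \<in> A \<Longrightarrow> \<exists>\<epsilon>>0. \<forall>h. close K \<epsilon> h \<longrightarrow> P S h"
  shows "\<exists>\<epsilon>>0. \<forall>h. close K \<epsilon> h \<longrightarrow> (\<forall>S\<in>A. P S h)"
  using assms
proof (induction A rule: finite_induct)
  case empty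
  show ?case by (intro exI[of _ 1]) simp
next
  case (insert S A)
  then obtain e1 e2 where e: "e1 > 0" "\<forall>h. close K e1 h \<longrightarrow> P S h" "e2 > 0"
    "\<forall>h. close K e2 h \<longrightarrow> (\<forall>S\<in>A. P S h)" by (metis insertI1 insertI2)
  then show ?case
    by (intro exI[of _ "min e1 e2"]) (auto dest: close_mono[of _ _ _ e1] close_mono[of _ _ _ e2])
qed

lemma close_conj:
  assumes "\<exists>\<epsilon>>0. \<forall>h. close K \<epsilon> h \<longrightarrow> P h" "\<exists>\<epsilon>>0. \<forall>h. close K \<epsilon> h \<longrightarrow> P' h"
  shows "\<exists>\<epsilon>>0. \<forall>h. close K \<epsilon> h \<longrightarrow> P h \<and> P' h"
proof -
  from assms obtain e1 e2 where e: "e1 > 0" "\<forall>h. close K e1 h \<longrightarrow> P h" "e2 > 0" "\<forall>h. close K e2 h \<longrightarrow> P' h"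
    by blast
  then show ?thesis
    by (intro exI[of _ "min e1 e2"]) (auto dest: close_mono[of _ _ _ e1] close_mono[of _ _ _ e2])
qed

section \<open>Preservation of the structure, with parameters bounded by the support\<close>

context
  fixes K :: "((real ^ 'k) \<times> real) set" and T :: real
  assumes K: "compact K" and T: "\<And>x lam. (x, lam) \<in> K \<Longrightarrow> \<bar>lam\<bar> < T" "a < T\<^sup>2" "T > 0"
begin

lemma zero_beyond:
  assumes "close K \<epsilon> h" "(x, lam) \<in> zeros h" "\<bar>lam\<bar> \<ge> T"
  shows "(x, lam) \<in> zeros g"
  using close_outside(1)[OF assms(1) K, of "(x, lam)"] assms T(1)[of x lam] by (force simp: zeros_def)

text \<open>Beyond \<open>T\<close> the perturbed family is \<open>g\<close> itself, whose
  degenerate zeros have \<lambda>^2 < a < T^2. Sequences of degenerate zeros therefore stay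
  bounded.\<close>

lemma non_hyperbolic_within:
  assumes c: "close K \<epsilon> h" and z: "(x, lam) \<in> zeros h" "(x, lam) \<notin> hyperbolic_zeros h"
  shows "\<bar>lam\<bar> \<le> T"
proof (rule ccontr)
  assume *: "\<not> ?thesis"
  then have "(x, lam) \<notin> K" "(x, lam) \<in> HR" using T(1)[of x lam] z(1) by (auto simp: zeros_def)
  then have p: "(x, lam) \<in> zeros g" "(x, lam) \<notin> hyperbolic_zeros g"
    using close_outside[OF c K] z by auto
  obtain S where S: "S \<subseteq> others" "(x, lam) \<in> orthant S" using zerosE[OF p(1)] by metis
  have "excess S \<noteq> 0" "lam = fold_lam S" using g_non_hyperbolic[OF p S] by (auto simp: fold_pt_def)
  then have "lam\<^sup>2 < T\<^sup>2" using fold_lam_small[OF S(1)] T(2) by simp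
  then show False using * T(3) by (metis abs_le_square_iff abs_of_pos less_imp_le linorder_not_le)
qed

lemma close_zeros_in_orthants:
  "\<exists>\<epsilon>>0. \<forall>h. close K \<epsilon> h \<longrightarrow> (\<forall>p\<in>zeros h. \<exists>S\<in>Pow others. p \<in> orthant S)"
proof (rule close_by_sequences)
  fix h assume h: "\<And>n. close K (inverse (real (Suc n))) (h n)"
    and neg: "\<And>n. \<not> (\<forall>p\<in>zeros (h n). \<exists>S\<in>Pow others. p \<in> orthant S)"
  then have "\<exists>x lam. (x, lam) \<in> zeros (h n) \<and> (\<forall>S\<subseteq>others. (x, lam) \<notin> orthant S)" for n by force
  then obtain x lam where z: "\<And>n. (x n, lam n) \<in> zeros (h n)"
    "\<And>n S. S \<subseteq> others \<Longrightarrow> (x n, lam n) \<notin> orthant S" by metis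
  have le: "\<bar>lam n\<bar> \<le> T" for n
    using zero_beyond[OF h z(1), of n] zerosE z(2) by (metis linear)
  obtain r x' lam' where r: "strict_mono (r :: nat \<Rightarrow> nat)"
    "convergent_sequence i0 l \<eta> a \<theta> g N K T (h \<circ> r) (x \<circ> r) (lam \<circ> r) x' lam'"
    using extract_convergent[OF K h z(1) le] by metis
  interpret X: convergent_sequence i0 l \<eta> a \<theta> g N K T "h \<circ> r" "x \<circ> r" "lam \<circ> r" x' lam' by (rule r(2))
  obtain S where S: "S \<subseteq> others" "(x', lam') \<in> orthant S" using zerosE[OF X.limit_zero] by metis
  have "\<forall>\<^sub>F n in sequentially. ((x \<circ> r) n, (lam \<circ> r) n) \<in> orthant S"
    using topological_tendstoD[OF tendsto_Pair[OF X.x_lim X.lam_lim] open_orthant S(2)] .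
  then show False using z(2)[OF S(1)] by (auto simp: eventually_sequentially)
qed

text \<open>Non-hyperbolic zeros converge to a degenerate zero of \<open>g\<close> in the same
  orthant, which can only be its fold. This rules out balanced orthants and makes some term of the
  sequence a saddle-node.\<close>

lemma close_non_hyperbolic_saddle:
  assumes S: "S \<subseteq> others"
  shows "\<exists>\<epsilon>>0. \<forall>h. close K \<epsilon> h \<longrightarrow>
    (\<forall>p\<in>zeros h \<inter> orthant S. p \<notin> hyperbolic_zeros h \<longrightarrow> excess S \<noteq> 0 \<and> saddle_node h p)"
proof (rule close_by_sequences)
  fix h assume h: "\<And>n. close K (inverse (real (Suc n))) (h n)"
    and neg: "\<And>n. \<not> (\<forall>p\<in>zeros (h n) \<inter> orthant S. p \<notin> hyperbolic_zeros (h n) \<longrightarrow>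
      excess S \<noteq> 0 \<and> saddle_node (h n) p)"
  then have "\<exists>x lam. (x, lam) \<in> zeros (h n) \<and> (x, lam) \<in> orthant S \<and> (x, lam) \<notin> hyperbolic_zeros (h n) \<and>
      \<not> (excess S \<noteq> 0 \<and> saddle_node (h n) (x, lam))" for n by force
  then obtain x lam where z: "\<And>n. (x n, lam n) \<in> zeros (h n)" "\<And>n. (x n, lam n) \<in> orthant S"
    "\<And>n. (x n, lam n) \<notin> hyperbolic_zeros (h n)"
    "\<And>n. \<not> (excess S \<noteq> 0 \<and> saddle_node (h n) (x n, lam n))" by metis
  have le: "\<bar>lam n\<bar> \<le> T" for n by (rule non_hyperbolic_within[OF h z(1,3)])
  obtain r x' lam' where r: "strict_mono (r :: nat \<Rightarrow> nat)"
    "convergent_sequence i0 l \<eta> a \<theta> g N K T (h \<circ> r) (x \<circ> r) (lam \<circ> r) x' lam'"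
    using extract_convergent[OF K h z(1) le] by metis
  interpret X: convergent_sequence i0 l \<eta> a \<theta> g N K T "h \<circ> r" "x \<circ> r" "lam \<circ> r" x' lam' by (rule r(2))
  have or: "(x', lam') \<in> orthant S"
    using z(2) orthant_subset_closed by (intro X.limit_orthant S) auto
  obtain v where "v \<in> H" "v \<noteq> 0" "lin x' lam' v = 0" using X.limit_degenerate z(3) by (metis comp_apply)
  note deg = degenerate_zero[OF X.limit_zero or S this]
  show False using X.some_saddle_node[OF deg(2) S deg(1)] z(3,4) deg(1) by auto
qed

text \<open>Two zeros over the same \<lambda> have a common limit, because \<open>g\<close> has only
  one there. Their normalised difference would converge to a kernel vector at a balanced zero, and
  those are nondegenerate.\<close>

lemma close_balanced_unique:
  assumes S: "S \<subseteq> others" "excess S = 0"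
  shows "\<exists>\<epsilon>>0. \<forall>h. close K \<epsilon> h \<longrightarrow> (\<forall>x y lam. (x, lam) \<in> zeros h \<inter> orthant S \<longrightarrow>
    (y, lam) \<in> zeros h \<inter> orthant S \<longrightarrow> x = y)"
proof (rule close_by_sequences)
  fix h assume h: "\<And>n. close K (inverse (real (Suc n))) (h n)"
    and "\<And>n. \<not> (\<forall>x y lam. (x, lam) \<in> zeros (h n) \<inter> orthant S \<longrightarrow> (y, lam) \<in> zeros (h n) \<inter> orthant S \<longrightarrow> x = y)"
  then have "\<exists>x y lam. (x, lam) \<in> zeros (h n) \<and> (x, lam) \<in> orthant S \<and> (y, lam) \<in> zeros (h n) \<and>
    (y, lam) \<in> orthant S \<and> x \<noteq> y" for n by blast
  then obtain x y lam where z: "\<And>n. (x n, lam n) \<in> zeros (h n)" "\<And>n. (x n, lam n) \<in> orthant S"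
    "\<And>n. (y n, lam n) \<in> zeros (h n)" "\<And>n. (y n, lam n) \<in> orthant S" "\<And>n. x n \<noteq> y n" by metis
  have le: "\<bar>lam n\<bar> \<le> T" for n
    using zero_beyond[OF h z(1), of n] zero_beyond[OF h z(3), of n] zeros_balanced_unique[OF _ _ z(2,4) S, of n] z(5)
    by (metis linear)
  obtain r1 x' lam' where r1: "strict_mono (r1 :: nat \<Rightarrow> nat)"
    "convergent_sequence i0 l \<eta> a \<theta> g N K T (h \<circ> r1) (x \<circ> r1) (lam \<circ> r1) x' lam'"
    using extract_convergent[OF K h z(1) le] by metis
  interpret X1: convergent_sequence i0 l \<eta> a \<theta> g N K T "h \<circ> r1" "x \<circ> r1" "lam \<circ> r1" x' lam' by (rule r1(2))
  obtain r2 y' mu' where r2: "strict_mono (r2 :: nat \<Rightarrow> nat)"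
    "convergent_sequence i0 l \<eta> a \<theta> g N K T (h \<circ> r1 \<circ> r2) (y \<circ> r1 \<circ> r2) (lam \<circ> r1 \<circ> r2) y' mu'"
    using extract_convergent[OF K X1.h, of "y \<circ> r1" "lam \<circ> r1" T] z(3) le by (metis comp_apply)
  define r where "r = r1 \<circ> r2"
  have X: "convergent_sequence i0 l \<eta> a \<theta> g N K T (h \<circ> r) (x \<circ> r) (lam \<circ> r) x' lam'"
    using X1.convergent_subsequence[OF r2(1)] by (simp add: r_def o_assoc)
  have Y: "convergent_sequence i0 l \<eta> a \<theta> g N K T (h \<circ> r) (y \<circ> r) (lam \<circ> r) y' mu'"
    using r2(2) by (simp add: r_def o_assoc)
  interpret X: convergent_sequence i0 l \<eta> a \<theta> g N K T "h \<circ> r" "x \<circ> r" "lam \<circ> r" x' lam' by (rule X)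
  interpret Y: convergent_sequence i0 l \<eta> a \<theta> g N K T "h \<circ> r" "y \<circ> r" "lam \<circ> r" y' mu' by (rule Y)
  have mu: "mu' = lam'" using LIMSEQ_unique[OF X.lam_lim Y.lam_lim] by simp
  have orX: "(x', lam') \<in> orthant S"
    using z(2) orthant_subset_closed by (intro X.limit_orthant S) auto
  have orY: "(y', lam') \<in> orthant S"
    using z(4) orthant_subset_closed by (intro Y.limit_orthant[unfolded mu] S) auto
  have y': "y' = x'"
    using zeros_balanced_unique[OF Y.limit_zero[unfolded mu] X.limit_zero orY orX S] .
  define d where "d n = (1 / norm (x (r n) - y (r n))) *\<^sub>R (x (r n) - y (r n))" for n
  have nd: "norm (d n) = 1" for n using z(5)[of "r n"] by (simp add: d_def)
  have "bounded (range d)" using nd by (intro boundedI[of _ 1]) auto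
  then obtain \<xi> s where s: "strict_mono s" "(d \<circ> s) \<longlonglongrightarrow> \<xi>" using bounded_subsequence by blast
  have d_lim: "(\<lambda>n. d (s n)) \<longlonglongrightarrow> \<xi>" using s(2) by (simp add: o_def)
  have \<xi>H: "\<xi> \<in> H"
    using closed_sequentially[OF closed_H _ d_lim] X.x_H Y.x_H unfolding d_def
    by (metis comp_apply subspace_H subspace_diff subspace_scale)
  have n\<xi>: "norm \<xi> = 1" using LIMSEQ_unique[OF tendsto_norm[OF d_lim]] nd by simp
  \<comment> \<open>With equal parameters the secant formula has no \<lambda> term, and the
    Lipschitz bound on h - g makes the quotient tend to 0.\<close>
  let ?f = "\<lambda>n. lin ((1/2) *\<^sub>R (x (r n) + y (r n))) (lam (r n)) (d n)"
  have "?f n = (1 / norm (x (r n) - y (r n))) *\<^sub>R (g (x (r n), lam (r n)) - g (y (r n), lam (r n)))"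
    if "(x (r n), lam (r n)) \<in> N" "(y (r n), lam (r n)) \<in> N" for n
    using that X.x_H[of n] Y.x_H[of n] by (simp add: g_eq pert_diff d_def linear_scale[OF linear_lin])
  then have f_le: "norm (?f n) \<le> inverse (real (Suc n))"
    if "(x (r n), lam (r n)) \<in> N" "(y (r n), lam (r n)) \<in> N" for n
  proof -
    let ?t = "norm (x (r n) - y (r n))"
    have t: "?t > 0" using z(5)[of "r n"] by simp
    have "norm ((h (r n) (x (r n), lam (r n)) - g (x (r n), lam (r n))) -
        (h (r n) (y (r n), lam (r n)) - g (y (r n), lam (r n)))) \<le> inverse (real (Suc n)) * ?t"
      using close_lipschitz[OF X.h[of n], of "(x (r n), lam (r n))" "(y (r n), lam (r n))"] X.x_H[of n] Y.x_H[of n]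
      by (simp add: HR_def norm_Pair)
    then have "norm (g (x (r n), lam (r n)) - g (y (r n), lam (r n))) \<le> inverse (real (Suc n)) * ?t"
      using z(1,3)[of "r n"] by (simp add: zeros_def norm_minus_commute)
    then have "norm ((1 / ?t) *\<^sub>R (g (x (r n), lam (r n)) - g (y (r n), lam (r n)))) \<le> inverse (real (Suc n))"
      using t by (simp add: divide_le_eq)
    then show ?thesis using \<open>\<And>n. _ \<Longrightarrow> _ \<Longrightarrow> ?f n = _\<close>[OF that] by simp
  qed
  have "\<forall>\<^sub>F n in sequentially. norm (?f n) \<le> inverse (real (Suc n))"
    using X.eventually_N Y.eventually_N by eventually_elim (rule f_le; simp)
  from Lim_null_comparison[OF this LIMSEQ_inverse_real_of_nat]
  have "(\<lambda>n. ?f (s n)) \<longlonglongrightarrow> 0" using LIMSEQ_subseq_LIMSEQ[OF _ s(1)] by (fastforce simp: o_def)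
  moreover have "(\<lambda>n. ?f (s n)) \<longlonglongrightarrow> lin ((1/2) *\<^sub>R (x' + x')) lam' \<xi>"
  proof (intro lin_tendsto tendsto_intros d_lim)
    show "(\<lambda>n. x (r (s n))) \<longlonglongrightarrow> x'" using LIMSEQ_subseq_LIMSEQ[OF X.x_lim s(1)] by (simp add: o_def)
    show "(\<lambda>n. y (r (s n))) \<longlonglongrightarrow> x'" using LIMSEQ_subseq_LIMSEQ[OF Y.x_lim s(1)] by (simp add: o_def y')
    show "(\<lambda>n. lam (r (s n))) \<longlonglongrightarrow> lam'" using LIMSEQ_subseq_LIMSEQ[OF X.lam_lim s(1)] by (simp add: o_def)
  qed
  ultimately have "lin ((1/2) *\<^sub>R (x' + x')) lam' \<xi> = 0" using LIMSEQ_unique by blast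
  moreover have "(1/2) *\<^sub>R (x' + x') = x'" by (simp add: scaleR_2[symmetric])
  ultimately have "lin x' lam' \<xi> = 0" by simp
  then show False using degenerate_zero(1)[OF X.limit_zero orX S(1) \<xi>H] n\<xi> S(2) by fastforce
qed

text \<open>A limit of such zeros would be an unbalanced zero of \<open>g\<close> over \<lambda> =
  0, which the sign condition forbids.\<close>

lemma close_unbalanced_nonzero:
  assumes S: "S \<subseteq> others" "excess S \<noteq> 0"
  shows "\<exists>\<epsilon>>0. \<forall>h. close K \<epsilon> h \<longrightarrow> (\<forall>p\<in>zeros h \<inter> orthant S. snd p \<noteq> 0)"
proof (rule close_by_sequences)
  fix h assume h: "\<And>n. close K (inverse (real (Suc n))) (h n)"
    and neg: "\<And>n. \<not> (\<forall>p\<in>zeros (h n) \<inter> orthant S. snd p \<noteq> 0)"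
  then have "\<exists>x. (x, 0) \<in> zeros (h n) \<and> (x, 0) \<in> orthant S" for n by force
  then obtain x where z: "\<And>n. (x n, 0) \<in> zeros (h n)" "\<And>n. (x n, 0) \<in> orthant S" by metis
  obtain r x' lam' where r: "strict_mono (r :: nat \<Rightarrow> nat)"
    "convergent_sequence i0 l \<eta> a \<theta> g N K T (h \<circ> r) (x \<circ> r) ((\<lambda>_. 0) \<circ> r) x' lam'"
    using extract_convergent[OF K h, of x "\<lambda>_. 0" T] z(1) T(3) by auto
  interpret X: convergent_sequence i0 l \<eta> a \<theta> g N K T "h \<circ> r" "x \<circ> r" "(\<lambda>_. 0) \<circ> r" x' lam' by (rule r(2))
  have or: "(x', lam') \<in> orthant S"
    using z(2) orthant_subset_closed by (intro X.limit_orthant S) auto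
  have "lam' = 0" using X.lam_lim by (simp add: o_def LIMSEQ_const_iff)
  then show False using zeros_orthantE[OF X.limit_zero or S(1)] sol_eq_sign[OF _ _ S(2)]
    by (metis less_irrefl mult_zero_right)
qed

text \<open>Two distinct degenerate zeros in one orthant both converge to its fold. Kernel vectors
  are chosen along successive subsequences, and the nonsingular extended system then separates
  them.\<close>

lemma close_unbalanced_unique:
  assumes S: "S \<subseteq> others" "excess S \<noteq> 0"
  shows "\<exists>\<epsilon>>0. \<forall>h. close K \<epsilon> h \<longrightarrow> (\<forall>p\<in>zeros h \<inter> orthant S. \<forall>q\<in>zeros h \<inter> orthant S.
    p \<notin> hyperbolic_zeros h \<longrightarrow> q \<notin> hyperbolic_zeros h \<longrightarrow> p = q)"
proof (rule close_by_sequences)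
  fix h assume h: "\<And>n. close K (inverse (real (Suc n))) (h n)"
    and neg: "\<And>n. \<not> (\<forall>p\<in>zeros (h n) \<inter> orthant S. \<forall>q\<in>zeros (h n) \<inter> orthant S.
      p \<notin> hyperbolic_zeros (h n) \<longrightarrow> q \<notin> hyperbolic_zeros (h n) \<longrightarrow> p = q)"
  then have "\<exists>x lam y mu. (x, lam) \<in> zeros (h n) \<and> (x, lam) \<in> orthant S \<and> (x, lam) \<notin> hyperbolic_zeros (h n) \<and>
    (y, mu) \<in> zeros (h n) \<and> (y, mu) \<in> orthant S \<and> (y, mu) \<notin> hyperbolic_zeros (h n) \<and> (x, lam) \<noteq> (y, mu)" for n
    by force
  then obtain x lam y mu where
    z: "\<And>n. (x n, lam n) \<in> zeros (h n)" "\<And>n. (x n, lam n) \<in> orthant S" "\<And>n. (x n, lam n) \<notin> hyperbolic_zeros (h n)"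
    "\<And>n. (y n, mu n) \<in> zeros (h n)" "\<And>n. (y n, mu n) \<in> orthant S" "\<And>n. (y n, mu n) \<notin> hyperbolic_zeros (h n)"
    "\<And>n. (x n, lam n) \<noteq> (y n, mu n)" by metis
  have le: "\<bar>lam n\<bar> \<le> T" "\<bar>mu n\<bar> \<le> T" for n
    using non_hyperbolic_within[OF h z(1,3)] non_hyperbolic_within[OF h z(4,6)] by blast+
  obtain r1 x' lam' where r1: "strict_mono (r1 :: nat \<Rightarrow> nat)"
    "convergent_sequence i0 l \<eta> a \<theta> g N K T (h \<circ> r1) (x \<circ> r1) (lam \<circ> r1) x' lam'"
    using extract_convergent[OF K h z(1) le(1)] by metis
  interpret X1: convergent_sequence i0 l \<eta> a \<theta> g N K T "h \<circ> r1" "x \<circ> r1" "lam \<circ> r1" x' lam' by (rule r1(2))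
  obtain r2 y' mu' where r2: "strict_mono (r2 :: nat \<Rightarrow> nat)"
    "convergent_sequence i0 l \<eta> a \<theta> g N K T (h \<circ> r1 \<circ> r2) (y \<circ> r1 \<circ> r2) (mu \<circ> r1 \<circ> r2) y' mu'"
    using extract_convergent[OF K X1.h, of "y \<circ> r1" "mu \<circ> r1" T] z(4) le by (metis comp_apply)
  interpret Y2: convergent_sequence i0 l \<eta> a \<theta> g N K T "h \<circ> r1 \<circ> r2" "y \<circ> r1 \<circ> r2" "mu \<circ> r1 \<circ> r2" y' mu' by (rule r2(2))
  interpret X2: convergent_sequence i0 l \<eta> a \<theta> g N K T "h \<circ> r1 \<circ> r2" "x \<circ> r1 \<circ> r2" "lam \<circ> r1 \<circ> r2" x' lam'
    by (rule X1.convergent_subsequence[OF r2(1)])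
  have orX: "(x', lam') \<in> orthant S"
    using z(2) orthant_subset_closed by (intro X2.limit_orthant S) auto
  have orY: "(y', mu') \<in> orthant S"
    using z(5) orthant_subset_closed by (intro Y2.limit_orthant S) auto
  obtain v where "v \<in> H" "v \<noteq> 0" "lin x' lam' v = 0" using X2.limit_degenerate z(3) by (metis comp_apply)
  from degenerate_zero(2)[OF X2.limit_zero orX S(1) this] have fX: "(x', lam') = fold_pt S" .
  obtain w where "w \<in> H" "w \<noteq> 0" "lin y' mu' w = 0" using Y2.limit_degenerate z(6) by (metis comp_apply)
  from degenerate_zero(2)[OF Y2.limit_zero orY S(1) this] have fY: "(y', mu') = fold_pt S" .
  have eq: "y' = x'" "mu' = lam'" using fX fY by (metis prod.inject)+
  have "\<And>n. ((x \<circ> r1 \<circ> r2) n, (lam \<circ> r1 \<circ> r2) n) \<notin> hyperbolic_zeros ((h \<circ> r1 \<circ> r2) n)" using z(3) by simp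
  from X2.unit_kernel_vectors[OF this]
  obtain r3 :: "nat \<Rightarrow> nat" and v where v: "strict_mono r3" "\<And>n. v n \<in> H" "\<And>n. norm (v n) = 1"
    "\<And>n. X2.L (r3 n) (v n) = 0" by metis
  interpret Y3: convergent_sequence i0 l \<eta> a \<theta> g N K T "h \<circ> r1 \<circ> r2 \<circ> r3" "y \<circ> r1 \<circ> r2 \<circ> r3" "mu \<circ> r1 \<circ> r2 \<circ> r3" y' mu'
    by (rule Y2.convergent_subsequence[OF v(1)])
  interpret X3: convergent_sequence i0 l \<eta> a \<theta> g N K T "h \<circ> r1 \<circ> r2 \<circ> r3" "x \<circ> r1 \<circ> r2 \<circ> r3" "lam \<circ> r1 \<circ> r2 \<circ> r3" x' lam'
    by (rule X2.convergent_subsequence[OF v(1)])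
  have "\<And>n. ((y \<circ> r1 \<circ> r2 \<circ> r3) n, (mu \<circ> r1 \<circ> r2 \<circ> r3) n) \<notin> hyperbolic_zeros ((h \<circ> r1 \<circ> r2 \<circ> r3) n)"
    using z(6) by simp
  from Y3.unit_kernel_vectors[OF this]
  obtain r4 :: "nat \<Rightarrow> nat" and w where w: "strict_mono r4" "\<And>n. w n \<in> H" "\<And>n. norm (w n) = 1"
    "\<And>n. Y3.L (r4 n) (w n) = 0" by metis
  \<comment> \<open>The index \<open>r4\<close> aligns the vectors of the first sequence with the
    later subsequence of the second, and the signs are normalised against
    \<open>ker_vec S\<close>.\<close>
  define v' where "v' n = (if v (r4 n) \<bullet> ker_vec S \<ge> 0 then v (r4 n) else - v (r4 n))" for n
  define w' where "w' n = (if w n \<bullet> ker_vec S \<ge> 0 then w n else - w n)" for n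
  have "X3.L (r4 n) (v (r4 n)) = 0" for n using v(4) by simp
  then have v': "v' n \<in> H" "norm (v' n) = 1" "X3.L (r4 n) (v' n) = 0" "v' n \<bullet> ker_vec S \<ge> 0" for n
    using v(2,3) subspace_neg[OF subspace_H] linear_neg[OF X3.linear_L] by (auto simp: v'_def)
  have w': "w' n \<in> H" "norm (w' n) = 1" "Y3.L (r4 n) (w' n) = 0" "w' n \<bullet> ker_vec S \<ge> 0" for n
    using w(2,3,4) subspace_neg[OF subspace_H] linear_neg[OF Y3.linear_L] by (auto simp: w'_def)
  show False
    by (rule no_two_folds[OF X3.convergent_subsequence[OF w(1)]
          Y3.convergent_subsequence[OF w(1), unfolded eq] S fX, of v' w'])
       (use v' w' z(7) in \<open>simp_all add: o_def\<close>)
qed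

lemma close_structured: "\<exists>\<epsilon>>0. \<forall>h. close K \<epsilon> h \<longrightarrow> structured h"
  unfolding structured_def
proof (intro close_conj close_zeros_in_orthants close_finite_Ball)
  show "finite (Pow others)" by simp
  fix S assume "S \<in> Pow others"
  then have S: "S \<subseteq> others" by simp
  show "\<exists>\<epsilon>>0. \<forall>h. close K \<epsilon> h \<longrightarrow>
      (\<forall>p\<in>zeros h \<inter> orthant S. p \<notin> hyperbolic_zeros h \<longrightarrow> excess S \<noteq> 0 \<and> saddle_node h p)"
    by (rule close_non_hyperbolic_saddle[OF S])
  show "\<exists>\<epsilon>>0. \<forall>h. close K \<epsilon> h \<longrightarrow> (excess S = 0 \<longrightarrow> (\<forall>x y lam. (x, lam) \<in> zeros h \<inter> orthant S \<longrightarrow>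
         (y, lam) \<in> zeros h \<inter> orthant S \<longrightarrow> x = y))"
    using close_balanced_unique[OF S] by (cases "excess S = 0") (auto intro: exI[of _ 1])
  show "\<exists>\<epsilon>>0. \<forall>h. close K \<epsilon> h \<longrightarrow> (excess S \<noteq> 0 \<longrightarrow> (\<forall>p\<in>zeros h \<inter> orthant S. snd p \<noteq> 0) \<and>
         (\<forall>p\<in>zeros h \<inter> orthant S. \<forall>q\<in>zeros h \<inter> orthant S.
            p \<notin> hyperbolic_zeros h \<longrightarrow> q \<notin> hyperbolic_zeros h \<longrightarrow> p = q))"
  proof (cases "excess S = 0")
    case False
    then show ?thesis
      using close_conj[OF close_unbalanced_nonzero[OF S False] close_unbalanced_unique[OF S False]] by simp
  qed (auto intro: exI[of _ 1])
qed

end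

end

section \<open>Counting saddle-nodes and crossing curves\<close>

context perturbed_family
begin

text \<open>The discriminant of \<open>sol_eq\<close> as a quadratic equation in \<open>s\<close>,
  namely (m^2 - 1)s^2 + km\<lambda>s + k^2\<lambda>^2/4 + k\<theta> = 0.\<close>

definition disc :: "'k set \<Rightarrow> real \<Rightarrow> real" where
  "disc S lam = kk\<^sup>2 * lam\<^sup>2 - 4 * kk * ((excess S)\<^sup>2 - 1) * \<theta> lam"

lemma sol_eq_iff_disc:
  assumes "excess S \<noteq> 0"
  shows "sol_eq S s lam \<longleftrightarrow> (2 * ((excess S)\<^sup>2 - 1) * s + kk * excess S * lam)\<^sup>2 = disc S lam"
proof -
  let ?m = "excess S"
  have "?m\<^sup>2 - 1 > 0" using excess_square[OF assms] by simp
  moreover have "(2 * (?m\<^sup>2 - 1) * s + kk * ?m * lam)\<^sup>2 - disc S lam =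
      4 * (?m\<^sup>2 - 1) * ((kk * lam / 2 + ?m * s)\<^sup>2 - (s\<^sup>2 - kk * \<theta> lam))"
    by (simp add: disc_def power2_eq_square field_simps)
  ultimately show ?thesis unfolding sol_eq_def
    by (metis eq_iff_diff_eq_0 less_irrefl mult_eq_0_iff zero_neq_numeral)
qed

text \<open>The roots of that quadratic equation for \<sigma> = 1 and \<sigma> = -1: the two sheets
  that meet at the fold.\<close>

definition branch_s :: "'k set \<Rightarrow> real \<Rightarrow> real \<Rightarrow> real" where
  "branch_s S \<sigma> lam = (\<sigma> * sqrt (disc S lam) - kk * excess S * lam) / (2 * ((excess S)\<^sup>2 - 1))"

lemma disc_le: "excess S \<noteq> 0 \<Longrightarrow> disc S lam \<le> kk\<^sup>2 * lam\<^sup>2"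
  using excess_square[of S] theta_nonneg[of lam] kk_pos by (simp add: disc_def)

text \<open>The discriminant is at most k^2\<lambda>^2, which is below (km\<lambda>)^2. Both roots
  therefore have the sign of -m\<lambda>, that is, they are positive.\<close>

lemma sqrt_disc_less:
  assumes m: "excess S \<noteq> 0" and lam: "excess S * lam < 0"
  shows "sqrt (disc S lam) < - (kk * excess S * lam)"
proof -
  have l0: "lam \<noteq> 0" using lam by auto
  have "disc S lam \<le> kk\<^sup>2 * lam\<^sup>2" by (rule disc_le[OF m])
  also have "\<dots> < kk\<^sup>2 * lam\<^sup>2 * (excess S)\<^sup>2"
    using excess_square[OF m] kk_pos l0 by simp
  also have "\<dots> = (kk * excess S * lam)\<^sup>2" by (simp add: power_mult_distrib)
  finally have "sqrt (disc S lam) < \<bar>kk * excess S * lam\<bar>"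
    by (metis real_sqrt_abs real_sqrt_less_iff)
  moreover have "kk * excess S * lam < 0" using lam kk_pos by (simp add: mult.assoc mult_pos_neg)
  ultimately show ?thesis by simp
qed

lemma branch_s_sol:
  assumes m: "excess S \<noteq> 0" and lam: "excess S * lam < 0" and D: "disc S lam \<ge> 0" and \<sigma>: "\<sigma> = 1 \<or> \<sigma> = -1"
  shows "branch_s S \<sigma> lam > 0" "sol_eq S (branch_s S \<sigma> lam) lam"
    "2 * ((excess S)\<^sup>2 - 1) * branch_s S \<sigma> lam + kk * excess S * lam = \<sigma> * sqrt (disc S lam)"
proof -
  have M: "(excess S)\<^sup>2 - 1 > 0" using excess_square[OF m] by simp
  show *: "2 * ((excess S)\<^sup>2 - 1) * branch_s S \<sigma> lam + kk * excess S * lam = \<sigma> * sqrt (disc S lam)"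
    using M by (simp add: branch_s_def)
  have "\<sigma> * sqrt (disc S lam) \<ge> - sqrt (disc S lam)" using \<sigma> D by auto
  then have "\<sigma> * sqrt (disc S lam) - kk * excess S * lam > 0" using sqrt_disc_less[OF m lam] by linarith
  then show "branch_s S \<sigma> lam > 0" using M by (simp add: branch_s_def)
  have "(\<sigma> * sqrt (disc S lam))\<^sup>2 = disc S lam" using \<sigma> D by (auto simp: power_mult_distrib)
  then show "sol_eq S (branch_s S \<sigma> lam) lam" unfolding sol_eq_iff_disc[OF m] * .
qed

lemma disc_pos_large:
  assumes S: "S \<subseteq> others" "excess S \<noteq> 0" and lam: "lam\<^sup>2 \<ge> a"
  shows "disc S lam > 0"
proof -
  have "4 * kk * ((excess S)\<^sup>2 - 1) * \<theta> lam \<le> 4 * kk * kk\<^sup>2 * \<eta>"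
    using excess_square_less[OF S(1)] excess_square[OF S(2)] theta_le[of lam] theta_nonneg[of lam] kk_pos
    by (intro mult_mono) auto
  also have "\<dots> = kk\<^sup>2 * (4 * kk * \<eta>)" by simp
  also have "\<dots> < kk\<^sup>2 * lam\<^sup>2" using a_gt lam kk_pos by (intro mult_strict_left_mono) auto
  finally show ?thesis by (simp add: disc_def)
qed

lemma unbalanced_zero_exists:
  assumes S: "S \<subseteq> others" "excess S \<noteq> 0" and lam: "excess S * lam < 0" "lam\<^sup>2 \<ge> a"
  shows "\<exists>x. (x, lam) \<in> zeros g \<inter> orthant S"
proof -
  have "disc S lam \<ge> 0" using disc_pos_large[OF S lam(2)] by simp
  from branch_s_sol[OF S(2) lam(1) this, of 1] show ?thesis
    using sol_zero[OF S(1)] sol_in_orthant by blast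
qed

lemma hyperbolic_zero_persists:
  assumes h: "smooth_family h" and p: "(x, lam) \<in> hyperbolic_zeros h" and S: "(x, lam) \<in> orthant S"
    and e: "e > 0"
  shows "\<exists>\<delta>>0. \<forall>mu. \<bar>mu - lam\<bar> < \<delta> \<longrightarrow> (\<exists>y. dist y x < e \<and> (y, mu) \<in> zeros h \<inter> orthant S)"
proof -
  have hs: "smooth_on_subspace HR h" using h by (simp add: smooth_family_def)
  have z: "x \<in> H" "h (x, lam) = 0" using p by (auto simp: hyperbolic_zeros_def zeros_def HR_def)
  have "0 \<notin> eigenvalues (linearization h (x, lam))" using p by (auto simp: hyperbolic_zeros_def)
  then have inj: "u = 0" if "u \<in> H" "linearization h (x, lam) u = 0" for u
    using that eigenvalue_0_iff[OF linear_linearization[OF hs z(1)]] by blast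
  obtain d where d: "d > 0" "\<And>q. dist q (x, lam) < d \<Longrightarrow> q \<in> orthant S"
    using open_orthant[of S] S by (auto simp: open_dist)
  obtain \<delta> where \<delta>: "\<delta> > 0"
    "\<And>mu. \<bar>mu - lam\<bar> < \<delta> \<Longrightarrow> \<exists>y\<in>H. dist y x < min e (d / 2) \<and> h (y, mu) = 0"
    using nondegenerate_zero_persists[OF h z inj, of "min e (d / 2)"] e d(1) by auto
  have "\<exists>y. dist y x < e \<and> (y, mu) \<in> zeros h \<inter> orthant S" if mu: "\<bar>mu - lam\<bar> < min \<delta> (d / 2)" for mu
  proof -
    obtain y where y: "y \<in> H" "dist y x < e" "dist y x < d / 2" "h (y, mu) = 0" using \<delta>(2)[of mu] mu by auto
    have "dist (y, mu) (x, lam) \<le> dist y x + dist mu lam"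
      unfolding dist_Pair_Pair by (rule sqrt_sum_squares_le_sum) auto
    then have "(y, mu) \<in> orthant S" using y(3) mu by (intro d(2)) (simp add: dist_real_def)
    then show ?thesis using y by (auto simp: zeros_def HR_def)
  qed
  then show ?thesis using \<delta>(1) d(1) by (intro exI[of _ "min \<delta> (d / 2)"]) auto
qed

lemma card_balanced: "card {S \<in> Pow others. excess S = 0} = (2 * l) choose l"
  using n_subsets[of others l] card_others by (simp add: excess_eq_0_iff)

lemma card_unbalanced: "card {S \<in> Pow others. excess S \<noteq> 0} = 2 ^ (2 * l) - ((2 * l) choose l)"
proof -
  have "{S \<in> Pow others. excess S \<noteq> 0} = Pow others - {S \<in> Pow others. excess S = 0}" by auto
  then have "card {S \<in> Pow others. excess S \<noteq> 0} = card (Pow others) - card {S \<in> Pow others. excess S = 0}"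
    by (simp only:) (rule card_Diff_subset, auto)
  then show ?thesis using card_others by (simp only: card_balanced card_Pow finite)
qed

lemma saddle_node_non_hyperbolic:
  assumes "saddle_node h p"
  shows "p \<in> zeros h" "p \<notin> hyperbolic_zeros h"
proof -
  obtain x lam where p: "p = (x, lam)" by (cases p)
  show "p \<in> zeros h" using assms by (simp add: saddle_node_def p)
  have "0 \<in> eigenvalues (linearization h p)" using assms by (simp add: saddle_node_def p Let_def)
  then show "p \<notin> hyperbolic_zeros h" by (force simp: hyperbolic_zeros_def)
qed

section \<open>Counting for one structured perturbation\<close>

context
  fixes K :: "((real ^ 'k) \<times> real) set" and h :: "(real ^ 'k) \<times> real \<Rightarrow> real ^ 'k" and \<epsilon> :: real
  assumes K: "compact K" and c: "close K \<epsilon> h" and st: "structured h"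
begin

lemma structured_zeros:
  assumes "p \<in> zeros h"
  obtains S where "S \<subseteq> others" "p \<in> orthant S"
  using assms st by (auto simp: structured_def)

lemma structured_balanced:
  assumes "S \<subseteq> others" "excess S = 0"
  shows "(x, lam) \<in> zeros h \<inter> orthant S \<Longrightarrow> (x, lam) \<in> hyperbolic_zeros h"
    and "(x, lam) \<in> zeros h \<inter> orthant S \<Longrightarrow> (y, lam) \<in> zeros h \<inter> orthant S \<Longrightarrow> x = y"
  using assms st unfolding structured_def by (blast, blast)

lemma structured_unbalanced:
  assumes "S \<subseteq> others" "excess S \<noteq> 0"
  shows "p \<in> zeros h \<inter> orthant S \<Longrightarrow> snd p \<noteq> 0"
    and "p \<in> zeros h \<inter> orthant S \<Longrightarrow> p \<notin> hyperbolic_zeros h \<Longrightarrow> saddle_node h p"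
    and "p \<in> zeros h \<inter> orthant S \<Longrightarrow> q \<in> zeros h \<inter> orthant S \<Longrightarrow>
      p \<notin> hyperbolic_zeros h \<Longrightarrow> q \<notin> hyperbolic_zeros h \<Longrightarrow> p = q"
  using assms st unfolding structured_def by (blast, blast, blast)

lemma compact_zeros: "compact (zeros h \<inter> closed_orthant S \<inter> {p. \<bar>snd p\<bar> \<le> T})"
proof -
  obtain R where R: "\<And>\<epsilon> h x lam. close K \<epsilon> h \<Longrightarrow> (x, lam) \<in> zeros h \<Longrightarrow> \<bar>lam\<bar> \<le> T \<Longrightarrow> norm x \<le> R"
    using close_zeros_bounded[OF K] by blast
  have "bounded (zeros h \<inter> closed_orthant S \<inter> {p. \<bar>snd p\<bar> \<le> T})"
  proof (rule boundedI)
    fix p assume "p \<in> zeros h \<inter> closed_orthant S \<inter> {p. \<bar>snd p\<bar> \<le> T}"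
    then have "norm (fst p) \<le> R" "\<bar>snd p\<bar> \<le> T" using R[OF c, of "fst p" "snd p"] by auto
    then show "norm p \<le> R + T" using norm_Pair_le[of "fst p" "snd p"] by simp
  qed
  moreover have "closed (zeros h)"
  proof -
    have "continuous_on HR h" using smooth_continuous[OF closeD(2)[OF c], of "[]"] by simp
    then have "closed (HR \<inter> h -` {0})" by (intro continuous_closed_preimage closed_HR) auto
    moreover have "zeros h = HR \<inter> h -` {0}" by (auto simp: zeros_def)
    ultimately show ?thesis by simp
  qed
  moreover have "closed {p :: (real ^ 'k) \<times> real. \<bar>snd p\<bar> \<le> T}"
    by (intro closed_Collect_le continuous_intros)
  ultimately show ?thesis
    using closed_closed_orthant by (auto simp: compact_eq_bounded_closed intro!: closed_Int)
qed

lemma zeros_closed_orthant_h: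
  assumes "p \<in> zeros h" "p \<in> closed_orthant S" "S \<subseteq> others"
  shows "p \<in> orthant S"
  using structured_zeros[OF assms(1)] orthant_closed_orthant_eq[OF _ assms(2,3)] by metis

lemma K_bounded: obtains T where "\<And>x lam. (x, lam) \<in> K \<Longrightarrow> \<bar>lam\<bar> < T" "a < T\<^sup>2" "T > 0"
proof -
  obtain M where M: "M > 0" "\<And>p. p \<in> K \<Longrightarrow> norm p \<le> M"
    using compact_imp_bounded[OF K] by (auto simp: bounded_pos)
  have "\<bar>lam\<bar> < M + a + 1" if "(x, lam) \<in> K" for x lam
    using M(2)[OF that] norm_snd_le[of lam x] a_pos by simp
  moreover have "a < (M + a + 1)\<^sup>2"
  proof -
    have "a < (a + 1) * 1" by simp
    also have "\<dots> \<le> (M + a + 1) * (M + a + 1)" using M(1) a_pos by (intro mult_mono) auto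
    finally show ?thesis by (simp add: power2_eq_square)
  qed
  ultimately show thesis using that[of "M + a + 1"] M(1) a_pos by simp
qed

text \<open>The set of parameters with a zero in the orthant is open by persistence of hyperbolic
  zeros. It is closed because zeros are bounded and their limits cannot leave the orthant, and it is
  nonempty since \<open>h\<close> equals \<open>g\<close> far out.\<close>

lemma balanced_curve:
  assumes S: "S \<subseteq> others" "excess S = 0"
  shows "\<exists>x. (x, lam) \<in> zeros h \<inter> orthant S"
proof -
  define A where "A = {lam. \<exists>x. (x, lam) \<in> zeros h \<inter> orthant S}"
  have "open A"
    unfolding open_dist
  proof
    fix lam assume "lam \<in> A"
    then obtain x where x: "(x, lam) \<in> zeros h \<inter> orthant S" by (auto simp: A_def)
    from hyperbolic_zero_persists[OF closeD(1)[OF c] structured_balanced(1)[OF S x], of S 1] x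
    obtain \<delta> where \<delta>: "\<delta> > 0"
      "\<forall>mu. \<bar>mu - lam\<bar> < \<delta> \<longrightarrow> (\<exists>y. dist y x < 1 \<and> (y, mu) \<in> zeros h \<inter> orthant S)" by auto
    have "\<forall>mu. dist mu lam < \<delta> \<longrightarrow> mu \<in> A"
      using \<delta>(2) unfolding A_def dist_real_def by blast
    with \<delta>(1) show "\<exists>e>0. \<forall>mu. dist mu lam < e \<longrightarrow> mu \<in> A" by blast
  qed
  moreover have "closed A"
    unfolding closed_sequential_limits
  proof (intro allI impI, elim conjE)
    fix lam and mu :: real assume lam: "\<forall>n. lam n \<in> A" "lam \<longlonglongrightarrow> mu"
    have "\<forall>n. \<exists>x. (x, lam n) \<in> zeros h \<inter> orthant S"
    proof
      fix n
      have "lam n \<in> A" using lam(1) by blast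
      then show "\<exists>x. (x, lam n) \<in> zeros h \<inter> orthant S" by (simp add: A_def)
    qed
    from choice[OF this] obtain x where x: "\<And>n. (x n, lam n) \<in> zeros h \<inter> orthant S" by blast
    obtain T where T: "\<And>n. \<bar>lam n\<bar> \<le> T"
      using convergent_imp_Bseq[of lam] lam(2) by (auto simp: convergent_def Bseq_def)
    let ?Z = "zeros h \<inter> closed_orthant S \<inter> {p. \<bar>snd p\<bar> \<le> T}"
    have "\<forall>n. (x n, lam n) \<in> ?Z" using x T orthant_subset_closed by auto
    then obtain q r where r: "q \<in> ?Z" "strict_mono (r :: nat \<Rightarrow> nat)" "((\<lambda>n. (x n, lam n)) \<circ> r) \<longlonglongrightarrow> q"
      using compact_zeros[of S T, unfolded compact_def, THEN spec, of "\<lambda>n. (x n, lam n)"] by blast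
    have "(lam \<circ> r) \<longlonglongrightarrow> snd q" using tendsto_snd[OF r(3)] by (simp add: o_def)
    then have "snd q = mu" using LIMSEQ_unique[OF _ LIMSEQ_subseq_LIMSEQ[OF lam(2) r(2)]] by blast
    moreover have "q \<in> orthant S" using zeros_closed_orthant_h[of q S] r(1) S by blast
    ultimately have "(fst q, mu) \<in> zeros h \<inter> orthant S" using r(1) by auto
    then show "mu \<in> A" unfolding A_def by blast
  qed
  moreover have "A \<noteq> {}"
  proof -
    obtain T where T: "\<And>x lam. (x, lam) \<in> K \<Longrightarrow> \<bar>lam\<bar> < T" "T > 0" using K_bounded by metis
    obtain x where x: "(x, T) \<in> zeros g \<inter> orthant S" using balanced_zero_exists[OF S] by blast
    have "(x, T) \<notin> K" using T(1)[of x T] T(2) by auto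
    then have "(x, T) \<in> zeros h \<inter> orthant S"
      using x close_outside(1)[OF c K, of "(x, T)"] by (auto simp: zeros_def)
    then show ?thesis by (auto simp: A_def)
  qed
  ultimately have "A = UNIV" using clopen by blast
  then show ?thesis by (auto simp: A_def)
qed

text \<open>The zero over each \<lambda> is unique, so the nearby zeros provided by persistence are
  values of the same function; this is its continuity.\<close>

lemma balanced_crossing_curve:
  assumes S: "S \<subseteq> others" "excess S = 0"
  obtains \<gamma> where "crossing_curve h \<gamma>" "range \<gamma> = zeros h \<inter> orthant S"
proof -
  obtain X where X: "\<And>lam. (X lam, lam) \<in> zeros h \<inter> orthant S" using balanced_curve[OF S] by metis
  note uniq = structured_balanced(2)[OF S]
  have "isCont X lam" for lam
    unfolding continuous_at_eps_delta
  proof (intro allI impI)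
    fix e :: real assume "e > 0"
    from hyperbolic_zero_persists[OF closeD(1)[OF c] structured_balanced(1)[OF S X] _ this, of lam S] X
    obtain \<delta> where \<delta>: "\<delta> > 0"
      "\<And>mu. \<bar>mu - lam\<bar> < \<delta> \<Longrightarrow> \<exists>y. dist y (X lam) < e \<and> (y, mu) \<in> zeros h \<inter> orthant S" by auto
    have "dist (X mu) (X lam) < e" if "dist mu lam < \<delta>" for mu
      using \<delta>(2)[of mu] that uniq[OF X[of mu]] by (auto simp: dist_real_def)
    then show "\<exists>d>0. \<forall>mu. dist mu lam < d \<longrightarrow> dist (X mu) (X lam) < e" using \<delta>(1) by blast
  qed
  then have "continuous_on UNIV (\<lambda>lam. (X lam, lam))"
    by (intro continuous_intros continuous_at_imp_continuous_on) auto
  moreover have "range (\<lambda>lam. (X lam, lam)) = zeros h \<inter> orthant S"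
  proof (intro equalityI subsetI)
    fix p assume p: "p \<in> zeros h \<inter> orthant S"
    then have "fst p = X (snd p)" using uniq[OF _ X, of "fst p" "snd p"] by simp
    then have "p = (X (snd p), snd p)" by (simp add: prod_eq_iff)
    then show "p \<in> range (\<lambda>lam. (X lam, lam))" by (rule range_eqI)
  qed (use X in auto)
  moreover have "range (\<lambda>t. snd (X t, t)) = UNIV" by simp
  ultimately show thesis
    using that[of "\<lambda>lam. (X lam, lam)"] structured_balanced(1)[OF S X] by (simp add: crossing_curve_def)
qed

text \<open>A connected set of zeros stays in one of the disjoint open orthants. The curve passes
  over \<lambda> = 0, which unbalanced orthants do not allow, and uniqueness over each \<lambda>
  makes it exhaust the zeros of its orthant.\<close>

lemma crossing_curve_range:
  assumes \<gamma>: "crossing_curve h \<gamma>"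
  obtains S where "S \<subseteq> others" "excess S = 0" "range \<gamma> = zeros h \<inter> orthant S"
proof -
  have z: "\<gamma> t \<in> zeros h" for t using \<gamma> by (auto simp: crossing_curve_def hyperbolic_zeros_def)
  obtain S where S: "S \<subseteq> others" "\<gamma> 0 \<in> orthant S" using structured_zeros[OF z] by metis
  have conn: "connected (range \<gamma>)"
    using \<gamma> by (intro connected_continuous_image connected_UNIV) (simp add: crossing_curve_def)
  define V where "V = (\<Union>S'\<in>Pow others - {S}. orthant S')"
  have "open V" unfolding V_def using open_orthant by blast
  moreover have "orthant S \<inter> V \<inter> range \<gamma> = {}"
    unfolding V_def using orthant_disjoint S(1) by blast
  moreover have "range \<gamma> \<subseteq> orthant S \<union> V"
  proof
    fix p assume "p \<in> range \<gamma>"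
    then obtain t where t: "p = \<gamma> t" by blast
    obtain S' where "S' \<subseteq> others" "\<gamma> t \<in> orthant S'" using structured_zeros[OF z] .
    then show "p \<in> orthant S \<union> V" unfolding V_def t by (cases "S' = S") auto
  qed
  ultimately have "range \<gamma> \<inter> orthant S = {} \<or> range \<gamma> \<inter> V = {}"
    using connectedD[OF conn open_orthant[of S]] by (metis inf_commute)
  then have sub: "\<gamma> t \<in> orthant S" for t
    using S(2) \<open>range \<gamma> \<subseteq> orthant S \<union> V\<close> by blast
  have onto: "\<exists>t. snd (\<gamma> t) = lam" for lam
    using \<gamma> by (metis (mono_tags, lifting) crossing_curve_def UNIV_I imageE)
  have m: "excess S = 0"
  proof (rule ccontr)
    assume "excess S \<noteq> 0"
    moreover obtain t where "snd (\<gamma> t) = 0" using onto by blast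
    ultimately show False using structured_unbalanced(1)[OF S(1)] z[of t] sub[of t] by blast
  qed
  have "range \<gamma> = zeros h \<inter> orthant S"
  proof (intro equalityI subsetI)
    fix p assume p: "p \<in> zeros h \<inter> orthant S"
    obtain t where t: "snd (\<gamma> t) = snd p" using onto by blast
    have "fst p = fst (\<gamma> t)"
      using structured_balanced(2)[OF S(1) m, of "fst p" "snd p" "fst (\<gamma> t)"] p z[of t] sub[of t] t
      by (metis IntI prod.collapse)
    then show "p \<in> range \<gamma>" using t by (metis prod_eq_iff rangeI)
  qed (use z sub in auto)
  then show thesis using that S(1) m by blast
qed

lemma crossing_sets_eq: "crossing_sets h = (\<lambda>S. zeros h \<inter> orthant S) ` {S \<in> Pow others. excess S = 0}"
proof (intro equalityI subsetI)
  fix C assume "C \<in> crossing_sets h"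
  then obtain \<gamma> where \<gamma>: "crossing_curve h \<gamma>" "C = range \<gamma>" by (auto simp: crossing_sets_def)
  obtain S where "S \<subseteq> others" "excess S = 0" "range \<gamma> = zeros h \<inter> orthant S"
    using crossing_curve_range[OF \<gamma>(1)] .
  then show "C \<in> (\<lambda>S. zeros h \<inter> orthant S) ` {S \<in> Pow others. excess S = 0}"
    using \<gamma>(2) by simp
next
  fix C assume "C \<in> (\<lambda>S. zeros h \<inter> orthant S) ` {S \<in> Pow others. excess S = 0}"
  then obtain S where S: "S \<subseteq> others" "excess S = 0" "C = zeros h \<inter> orthant S" by auto
  then obtain \<gamma> where "crossing_curve h \<gamma>" "range \<gamma> = C" using balanced_crossing_curve by metis
  then show "C \<in> crossing_sets h" by (auto simp: crossing_sets_def)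
qed

lemma card_crossing_sets: "finite (crossing_sets h)" "card (crossing_sets h) = (2 * l) choose l"
proof -
  show "finite (crossing_sets h)" unfolding crossing_sets_eq by (intro finite_imageI) simp
  have "inj_on (\<lambda>S. zeros h \<inter> orthant S) {S \<in> Pow others. excess S = 0}"
  proof (rule inj_onI)
    fix S S' assume *: "S \<in> {S \<in> Pow others. excess S = 0}" "S' \<in> {S \<in> Pow others. excess S = 0}"
      "zeros h \<inter> orthant S = zeros h \<inter> orthant S'"
    obtain x where "(x, 0) \<in> zeros h \<inter> orthant S" using balanced_curve[of S] * by blast
    then show "S = S'" using * orthant_disjoint[of S S' "(x, 0)"] by auto
  qed
  then show "card (crossing_sets h) = (2 * l) choose l"
    unfolding crossing_sets_eq by (simp only: card_image card_balanced)
qed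

text \<open>Zeros exist over the far end of the admissible side of \<lambda> = 0. A zero closest to
  the opposite end cannot be hyperbolic, since persistence would continue it further.\<close>

lemma unbalanced_fold:
  assumes S: "S \<subseteq> others" "excess S \<noteq> 0"
  shows "\<exists>p\<in>zeros h \<inter> orthant S. p \<notin> hyperbolic_zeros h"
proof -
  \<comment> \<open>The sign of \<lambda> on the side where the orthant has zeros of
    \<open>g\<close>; it treats both signs of the excess at once.\<close>
  define \<kappa> :: real where "\<kappa> = (if excess S > 0 then -1 else 1)"
  have \<kappa>: "\<kappa> * \<kappa> = 1" "\<bar>\<kappa>\<bar> = 1" "\<And>lam. excess S * lam < 0 \<longleftrightarrow> \<kappa> * lam > 0"
    using S(2) by (auto simp: \<kappa>_def mult_less_0_iff)
  obtain T where T: "\<And>x lam. (x, lam) \<in> K \<Longrightarrow> \<bar>lam\<bar> < T" "a < T\<^sup>2" "T > 0" using K_bounded by metis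
  let ?Z = "zeros h \<inter> closed_orthant S \<inter> {p. \<bar>snd p\<bar> \<le> T}"
  have beyond: "(x, lam) \<in> zeros h \<longleftrightarrow> (x, lam) \<in> zeros g" if "\<bar>lam\<bar> = T" for x lam
    using close_outside(1)[OF c K, of "(x, lam)"] T(1)[of x lam] that by (force simp: zeros_def)
  have kT: "\<bar>\<kappa> * T\<bar> = T" using \<kappa>(2) T(3) by (simp add: abs_mult)
  have "(\<kappa> * T)\<^sup>2 \<ge> a" using T(2) kT by (metis power2_abs less_imp_le)
  moreover have "excess S * (\<kappa> * T) < 0" unfolding \<kappa>(3) using \<kappa>(1) T(3) by (simp flip: mult.assoc)
  ultimately obtain x where "(x, \<kappa> * T) \<in> zeros g \<inter> orthant S" using unbalanced_zero_exists[OF S] by blast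
  then have "(x, \<kappa> * T) \<in> ?Z" using beyond[OF kT] orthant_subset_closed kT by auto
  then have "?Z \<noteq> {}" by blast
  moreover have "continuous_on ?Z (\<lambda>p. \<kappa> * snd p)" by (intro continuous_intros)
  ultimately have "\<exists>p\<in>?Z. \<forall>q\<in>?Z. \<kappa> * snd p \<le> \<kappa> * snd q"
    by (rule continuous_attains_inf[OF compact_zeros])
  then obtain p where p: "p \<in> ?Z" "\<And>q. q \<in> ?Z \<Longrightarrow> \<kappa> * snd p \<le> \<kappa> * snd q" by blast
  obtain y lam where y: "p = (y, lam)" by (cases p)
  have or: "p \<in> orthant S" using zeros_closed_orthant_h p(1) S(1) by blast
  have "p \<notin> hyperbolic_zeros h"
  proof
    assume "p \<in> hyperbolic_zeros h"
    from hyperbolic_zero_persists[OF closeD(1)[OF c] this[unfolded y] or[unfolded y], of 1]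
    obtain \<delta> where \<delta>: "\<delta> > 0"
      "\<forall>mu. \<bar>mu - lam\<bar> < \<delta> \<longrightarrow> (\<exists>x. dist x y < 1 \<and> (x, mu) \<in> zeros h \<inter> orthant S)" by auto
    have lT: "\<bar>lam\<bar> \<le> T" using p(1) y by simp
    \<comment> \<open>The minimum is not at the end of the parameter window: there \<open>h\<close>
      and \<open>g\<close> have the same zeros, and the sign condition excludes that side.\<close>
    have gt: "\<kappa> * lam > - T"
    proof (rule ccontr)
      assume *: "\<not> ?thesis"
      have "\<bar>\<kappa> * lam\<bar> = \<bar>lam\<bar>" using \<kappa>(2) by (simp add: abs_mult)
      then have lT': "\<bar>lam\<bar> = T" using * lT by linarith
      then have "(y, lam) \<in> zeros g" using beyond p(1) y by blast
      from zeros_orthantE[OF this or[unfolded y] S(1)]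
      have "excess S * lam < 0" using sol_eq_sign S(2) by metis
      then show False using \<kappa>(3) * T(3) by simp
    qed
    \<comment> \<open>Small enough for persistence and for the new parameter to stay in the window
      bounded by \<open>T\<close>.\<close>
    define d where "d = min (\<delta> / 2) (\<kappa> * lam + T)"
    have d: "d > 0" "d < \<delta>" "d \<le> \<kappa> * lam + T" using \<delta>(1) gt by (auto simp: d_def)
    define mu where "mu = lam - \<kappa> * d"
    have "\<bar>mu - lam\<bar> < \<delta>" using d \<kappa>(2) by (simp add: mu_def abs_mult)
    then obtain x where x: "(x, mu) \<in> zeros h \<inter> orthant S" using \<delta>(2) by blast
    have kmu: "\<kappa> * mu = \<kappa> * lam - d" using \<kappa>(1) by (simp add: mu_def right_diff_distrib flip: mult.assoc)
    have "\<bar>\<kappa> * lam\<bar> = \<bar>lam\<bar>" "\<bar>\<kappa> * mu\<bar> = \<bar>mu\<bar>" using \<kappa>(2) by (simp_all add: abs_mult)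
    then have "\<bar>mu\<bar> \<le> T" using kmu d lT by linarith
    then have "(x, mu) \<in> ?Z" using x orthant_subset_closed by auto
    from p(2)[OF this] show False using kmu d(1) y by simp
  qed
  then show ?thesis using p(1) or by blast
qed

lemma saddle_nodes_card:
  "only_saddle_nodes h" "finite (saddle_nodes h)"
  "card (saddle_nodes h) = 2 ^ (2 * l) - ((2 * l) choose l)"
proof -
  let ?U = "{S \<in> Pow others. excess S \<noteq> 0}"
  have "\<forall>S\<in>?U. \<exists>p. p \<in> zeros h \<inter> orthant S \<and> p \<notin> hyperbolic_zeros h"
  proof
    fix S assume "S \<in> ?U"
    then show "\<exists>p. p \<in> zeros h \<inter> orthant S \<and> p \<notin> hyperbolic_zeros h"
      using unbalanced_fold[of S] by blast
  qed
  from bchoice[OF this] obtain F where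
    F: "\<And>S. S \<in> ?U \<Longrightarrow> F S \<in> zeros h \<inter> orthant S \<and> F S \<notin> hyperbolic_zeros h" by blast
  have nh: "\<exists>S\<in>?U. p = F S \<and> saddle_node h p" if p: "p \<in> zeros h" "p \<notin> hyperbolic_zeros h" for p
  proof -
    obtain S where S: "S \<subseteq> others" "p \<in> orthant S" using structured_zeros[OF p(1)] .
    have m: "excess S \<noteq> 0" using structured_balanced(1)[OF S(1), of "fst p" "snd p"] p S(2) by auto
    then have "S \<in> ?U" using S by simp
    then show ?thesis
      using structured_unbalanced(2,3)[OF S(1) m] F[of S] p S(2) by blast
  qed
  show "only_saddle_nodes h" unfolding only_saddle_nodes_def saddle_nodes_def using nh by blast
  have eq: "saddle_nodes h = F ` ?U"
  proof (intro equalityI subsetI)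
    fix p assume "p \<in> saddle_nodes h"
    then have "saddle_node h p" by (simp add: saddle_nodes_def)
    from nh[OF saddle_node_non_hyperbolic[OF this]] show "p \<in> F ` ?U" by blast
  next
    fix p assume "p \<in> F ` ?U"
    then obtain S where "S \<in> ?U" "p = F S" by blast
    then show "p \<in> saddle_nodes h"
      using F[of S] structured_unbalanced(2)[of S p] by (auto simp: saddle_nodes_def)
  qed
  show "finite (saddle_nodes h)" unfolding eq by (intro finite_imageI) simp
  have "inj_on F ?U"
  proof (rule inj_onI)
    fix S S' assume "S \<in> ?U" "S' \<in> ?U" "F S = F S'"
    then show "S = S'" using F[of S] F[of S'] orthant_disjoint[of S S' "F S"] by auto
  qed
  then show "card (saddle_nodes h) = 2 ^ (2 * l) - ((2 * l) choose l)"
    unfolding eq by (simp only: card_image card_unbalanced)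
qed

end

text \<open>\<open>g\<close> is a perturbation of itself of any size \<epsilon> >= 0, supported in a
  single point, so the preservation result yields its own structure.\<close>

lemma g_structured: "structured g"
proof -
  have 1: "compact {(0, 0) :: (real ^ 'k) \<times> real}" by simp
  have T: "\<bar>lam\<bar> < a + 1" if "(x, lam) \<in> {(0, 0) :: (real ^ 'k) \<times> real}" for x lam using that a_pos by simp
  have "a < (a + 1)\<^sup>2" "a + 1 > 0"
    using a_pos add_pos_pos[OF zero_less_one add_pos_pos[OF a_pos mult_pos_pos[OF a_pos a_pos]]]
    by (simp_all add: power2_eq_square algebra_simps)
  then obtain \<epsilon> where "\<epsilon> > 0" "\<And>h. close {(0, 0)} \<epsilon> h \<Longrightarrow> structured h"
    using close_structured[OF 1, of "a + 1"] T by blast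
  then show ?thesis using close_self[of \<epsilon> "{(0, 0)}"] by simp
qed

lemma g_close: "close {(0, 0)} 1 g"
  by (rule close_self) simp

lemmas g_saddle_nodes = saddle_nodes_card[OF _ g_close g_structured, simplified]
  and g_crossing_sets = card_crossing_sets[OF _ g_close g_structured, simplified]

lemma g_stable: "C2_stable g"
  unfolding C2_stable_def
proof (intro allI impI)
  fix K :: "((real ^ 'k) \<times> real) set" assume nhd: "compact_nhd_of_origin K"
  then have K: "compact K" by (simp add: compact_nhd_of_origin_def)
  obtain T where T: "\<And>x lam. (x, lam) \<in> K \<Longrightarrow> \<bar>lam\<bar> < T" "a < T\<^sup>2" "T > 0"
    using K_bounded[OF K close_self[OF zero_le_one] g_structured] by metis
  obtain \<epsilon> where \<epsilon>: "\<epsilon> > 0" "\<And>h. close K \<epsilon> h \<Longrightarrow> structured h" using close_structured[OF K, of T] T by blast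
  have "only_saddle_nodes h \<and> finite (saddle_nodes h) \<and> card (saddle_nodes h) = card (saddle_nodes g) \<and>
      finite (crossing_sets h) \<and> card (crossing_sets h) = card (crossing_sets g)"
    if h: "smooth_family h" "\<forall>p\<in>HR - K. h p = g p" "C2_norm K (\<lambda>p. h p - g p) < \<epsilon>" for h
  proof -
    have c: "close K \<epsilon> h" by (rule close_if_C2_norm[OF nhd h])
    note * = K c \<epsilon>(2)[OF c]
    show ?thesis
      using saddle_nodes_card[OF *] card_crossing_sets[OF *] g_saddle_nodes g_crossing_sets by simp
  qed
  then show "\<exists>\<epsilon>>0. \<forall>h. smooth_family h \<and> (\<forall>p\<in>HR - K. h p = g p) \<and> C2_norm K (\<lambda>p. h p - g p) < \<epsilon> \<longrightarrow>
      only_saddle_nodes h \<and> finite (saddle_nodes h) \<and> card (saddle_nodes h) = card (saddle_nodes g) \<and>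
      finite (crossing_sets h) \<and> card (crossing_sets h) = card (crossing_sets g)"
    using \<epsilon>(1) by blast
qed

end

section \<open>The index along the crossing curves\<close>

text \<open>The space is the orthogonal complement of the indicator vector of \<open>S\<close>
  inside the coordinate subspace of \<open>S\<close>.\<close>

lemma dim_supported_sum_zero:
  fixes S :: "'k::finite set"
  assumes "S \<noteq> {}"
  shows "dim {u :: real ^ 'k. (\<forall>j. j \<notin> S \<longrightarrow> u $ j = 0) \<and> (\<Sum>j\<in>UNIV. u $ j) = 0} = card S - 1"
proof -
  let ?V = "{u :: real ^ 'k. \<forall>j. j \<notin> S \<longrightarrow> u $ j = 0}"
  let ?one = "(\<chi> j. if j \<in> S then 1 else 0) :: real ^ 'k"
  have V: "?V = {x. \<forall>i\<in>Basis. i \<notin> (\<lambda>j. axis j 1) ` S \<longrightarrow> x \<bullet> i = 0}"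
    by (auto simp: Basis_vec_def inner_axis axis_eq_axis image_iff)
  have dimV: "dim ?V = card S"
    unfolding V by (subst dim_substandard) (auto simp: Basis_vec_def card_image inj_on_def axis_eq_axis)
  have subV: "subspace ?V" by (auto simp: subspace_def)
  have "?one \<in> ?V" by simp
  then have sub: "span {?one} \<subseteq> ?V" using subV by (simp add: span_minimal)
  have one0: "?one \<noteq> 0" using assms by (auto simp: vec_eq_iff)
  have inner_one: "?one \<bullet> u = (\<Sum>j\<in>UNIV. u $ j)" if "u \<in> ?V" for u
    unfolding inner_vec_def by (rule sum.cong) (use that in auto)
  have "{y \<in> ?V. \<forall>x\<in>span {?one}. orthogonal x y} =
      {u. (\<forall>j. j \<notin> S \<longrightarrow> u $ j = 0) \<and> (\<Sum>j\<in>UNIV. u $ j) = 0}" (is "?L = ?R")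
  proof (intro equalityI subsetI)
    fix u assume u: "u \<in> ?L"
    then have "?one \<bullet> u = 0" by (auto simp: orthogonal_def intro: span_base)
    then show "u \<in> ?R" using u inner_one[of u] by simp
  next
    fix u assume u: "u \<in> ?R"
    then have "?one \<bullet> u = 0" using inner_one[of u] by simp
    then show "u \<in> ?L" using u by (auto simp: orthogonal_def span_singleton)
  qed
  moreover have "dim {y \<in> ?V. \<forall>x\<in>span {?one}. orthogonal x y} + dim (span {?one}) = dim ?V"
    by (rule dim_subspace_orthogonal_to_vectors[OF subspace_span subV sub])
  ultimately show ?thesis using dimV one0 by (simp add: dim_singleton)
qed

context perturbed_family
begin

lemma lin_constant_diag:
  assumes "u \<in> H" "\<And>i. (x $ i - lam / 2) * u $ i = c * u $ i"
  shows "lin x lam u = (- 2 * c) *\<^sub>R u"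
proof -
  have "(\<chi> i. (x $ i - lam / 2) * u $ i) = c *\<^sub>R u" using assms(2) by (simp add: vec_eq_iff)
  moreover have "proj_H (c *\<^sub>R u) = c *\<^sub>R u"
    using assms(1) by (simp add: proj_H_def H_def vec_eq_iff flip: sum_distrib_left)
  ultimately show ?thesis by (simp add: lin_eq_proj_H[OF assms(1)])
qed

text \<open>\<open>H\<close> splits orthogonally into the zero-sum vectors supported on
  \<open>S\<close> (eigenvalue -2s), those supported on the complementary set \<open>S'\<close>
  (eigenvalue 2s), each of dimension l - 1, and a plane on which the eigenvalues have opposite
  signs. The index is (l - 1) + 1; for l = 1 the plane alone remains.\<close>

lemma balanced_index:
  assumes z: "(x, lam) \<in> zeros g" "(x, lam) \<in> orthant S" and S: "S \<subseteq> others" "excess S = 0"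
  shows "index g (x, lam) = l"
proof -
  obtain s where s: "s > 0" "x = sol S s lam" "sol_eq S s lam" using zeros_orthantE[OF z S(1)] .
  have xH: "x \<in> H" and xN: "(x, lam) \<in> N" using z(1) zeros_N by (auto simp: zeros_def HR_def)
  define A where "A = linearization g (x, lam)"
  have A_lin: "A u = lin x lam u" if "u \<in> H" for u unfolding A_def by (rule linearization_g[OF xH xN that])
  have A: "linear A" "\<And>u. u \<in> H \<Longrightarrow> A u \<in> H"
    unfolding A_def by (rule linear_linearization[OF g_smooth_on xH], rule linearization_in_H[OF g_smooth xH])
  define S' where "S' = others - S"
  have cS: "card S = l" using S(2) excess_eq_0_iff by simp
  have cS': "card S' = l" unfolding S'_def using card_Diff_subset[OF _ S(1)] card_others cS by simp
  have ne: "S \<noteq> {}" "S' \<noteq> {}" using cS cS' l_pos by auto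
  define V where "V R = {u :: real ^ 'k. (\<forall>j. j \<notin> R \<longrightarrow> u $ j = 0) \<and> (\<Sum>j\<in>UNIV. u $ j) = 0}" for R
  have subV: "subspace (V R)" for R
    by (auto simp: V_def subspace_def sum.distrib simp flip: sum_distrib_left)
  have dimV: "dim (V S) = l - 1" "dim (V S') = l - 1"
    unfolding V_def dim_supported_sum_zero[OF ne(1)] dim_supported_sum_zero[OF ne(2)] cS cS' by simp_all
  have VH: "V R \<subseteq> H" for R by (auto simp: V_def H_def)
  have x0: "x $ i0 - lam / 2 = - (kk * lam / 2)" by (simp add: s(2) sol_def S(2) kk_def field_simps)
  have xj: "x $ j - lam / 2 = sgn_of S j * s" if "j \<noteq> i0" for j using that by (simp add: s(2) sol_def)
  have i0S: "i0 \<notin> S" "i0 \<notin> S'" using S(1) by (auto simp: S'_def)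
  have eigV: "A u = (- 2 * s) *\<^sub>R u" if u: "u \<in> V S" for u
  proof -
    have uH: "u \<in> H" using u by (rule subsetD[OF VH])
    have "(x $ i - lam / 2) * u $ i = s * u $ i" for i
      using u xj[of i] i0S by (cases "i \<in> S") (auto simp: V_def sgn_of_def)
    from lin_constant_diag[OF uH this] show ?thesis unfolding A_lin[OF uH] by simp
  qed
  have eigV': "A u = (2 * s) *\<^sub>R u" if u: "u \<in> V S'" for u
  proof -
    have uH: "u \<in> H" using u by (rule subsetD[OF VH])
    have "(x $ i - lam / 2) * u $ i = (- s) * u $ i" for i
      using u xj[of i] i0S by (cases "i \<in> S'") (auto simp: V_def S'_def sgn_of_def)
    from lin_constant_diag[OF uH this] show ?thesis unfolding A_lin[OF uH] by simp
  qed
  \<comment> \<open>The plane of vectors that are constant on \<open>S\<close> and on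
    \<open>S'\<close>: \<open>f1\<close> is the sign vector and \<open>f2\<close> equals the
    perturbation direction.\<close>
  define f1 :: "real ^ 'k" where "f1 = (\<chi> j. if j = i0 then 0 else sgn_of S j)"
  define f2 :: "real ^ 'k" where "f2 = (\<chi> j. if j = i0 then - 2 * real l else 1)"
  define \<delta> where "\<delta> = - (kk * lam / 2)"
  have fH: "f1 \<in> H" "f2 \<in> H"
    using card_others by (simp_all add: H_def sum_UNIV_others f1_def f2_def sum_sgn_of[OF S(1)] S(2))
  have f11: "f1 \<bullet> f1 = 2 * real l" and f12: "f1 \<bullet> f2 = 0" and f22: "f2 \<bullet> f2 = 2 * real l * kk"
  proof -
    have "(\<Sum>j\<in>others. f1 $ j * f1 $ j) = (\<Sum>j\<in>others. 1)"
      by (rule sum.cong) (auto simp: f1_def sgn_of_square)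
    then show "f1 \<bullet> f1 = 2 * real l" using card_others by (simp add: inner_vec_def sum_UNIV_others f1_def)
    have "(\<Sum>j\<in>others. f1 $ j * f2 $ j) = (\<Sum>j\<in>others. sgn_of S j)"
      by (rule sum.cong) (auto simp: f1_def f2_def)
    then show "f1 \<bullet> f2 = 0" by (simp add: inner_vec_def sum_UNIV_others f1_def sum_sgn_of[OF S(1)] S(2))
    have "(\<Sum>j\<in>others. f2 $ j * f2 $ j) = (\<Sum>j\<in>others. 1)"
      by (rule sum.cong) (auto simp: f2_def)
    then show "f2 \<bullet> f2 = 2 * real l * kk"
      using card_others by (simp add: inner_vec_def sum_UNIV_others f2_def kk_def algebra_simps)
  qed
  have Af1: "A f1 = (- 2 * s / kk) *\<^sub>R f2"
  proof -
    have d: "(\<chi> i. (x $ i - lam / 2) * f1 $ i) = (\<chi> i. if i = i0 then 0 else s)"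
      using xj by (auto simp: vec_eq_iff f1_def sgn_of_square)
    have "(\<Sum>j\<in>UNIV. (\<chi> i. if i = i0 then 0 else s) $ j) = 2 * real l * s"
      using card_others by (simp add: sum_UNIV_others)
    then have "proj_H (\<chi> i. if i = i0 then 0 else s) = (s / kk) *\<^sub>R f2"
      using kk_pos by (simp add: proj_H_def f2_def vec_eq_iff field_simps) (simp add: kk_def algebra_simps)
    then show ?thesis unfolding A_lin[OF fH(1)] lin_eq_proj_H[OF fH(1)] d by simp
  qed
  have Af2: "A f2 = (- 2 * s) *\<^sub>R f1 + (- 4 * real l * \<delta> / kk) *\<^sub>R f2"
  proof -
    let ?d = "(\<chi> i. if i = i0 then - 2 * real l * \<delta> else sgn_of S i * s) :: real ^ 'k"
    have d: "(\<chi> i. (x $ i - lam / 2) * f2 $ i) = ?d"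
      using xj x0 by (auto simp: vec_eq_iff f2_def \<delta>_def)
    have "(\<Sum>j\<in>UNIV. ?d $ j) = - 2 * real l * \<delta>"
      using S(2) by (simp add: sum_UNIV_others sum_sgn_of[OF S(1)] flip: sum_distrib_right)
    then have "proj_H ?d = s *\<^sub>R f1 + (2 * real l * \<delta> / kk) *\<^sub>R f2"
      using kk_pos by (simp add: proj_H_def f1_def f2_def vec_eq_iff field_simps) (simp add: kk_def algebra_simps)
    then show ?thesis unfolding A_lin[OF fH(2)] lin_eq_proj_H[OF fH(2)] d by (simp add: scaleR_add_right)
  qed
  \<comment> \<open>In the basis \<open>f1\<close>, \<open>f2\<close> the eigenvector equation for
    \<open>w \<mu>\<close> reduces to the quadratic \<mu>^2 + 2b\<mu> - 4s^2/k = 0.\<close>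
  define w where "w \<mu> = (- 2 * s) *\<^sub>R f1 + \<mu> *\<^sub>R f2" for \<mu> :: real
  define b where "b = 2 * real l * \<delta> / kk"
  define \<mu>1 where "\<mu>1 = - b - sqrt (b\<^sup>2 + 4 * s\<^sup>2 / kk)"
  define \<mu>2 where "\<mu>2 = - b + sqrt (b\<^sup>2 + 4 * s\<^sup>2 / kk)"
  have pos: "4 * s\<^sup>2 / kk > 0" using s(1) kk_pos by simp
  then have sq: "sqrt (b\<^sup>2 + 4 * s\<^sup>2 / kk) > \<bar>b\<bar>"
    by (metis less_add_same_cancel1 real_sqrt_abs real_sqrt_less_iff)
  then have mu: "\<mu>1 < 0" "\<mu>2 > 0" by (auto simp: \<mu>1_def \<mu>2_def)
  have sqr: "(sqrt (b\<^sup>2 + 4 * s\<^sup>2 / kk))\<^sup>2 = b\<^sup>2 + 4 * s\<^sup>2 / kk" using pos by simp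
  have root: "\<mu>1\<^sup>2 = 4 * s\<^sup>2 / kk - 2 * b * \<mu>1" "\<mu>2\<^sup>2 = 4 * s\<^sup>2 / kk - 2 * b * \<mu>2"
    using sqr unfolding \<mu>1_def \<mu>2_def by (simp_all add: power2_eq_square algebra_simps)
  \<comment> \<open>The negative product gives one eigenvalue of each sign, and it also yields the
    orthogonality of the two eigenvectors.\<close>
  have prod: "\<mu>1 * \<mu>2 = - (4 * s\<^sup>2 / kk)"
    using sqr unfolding \<mu>1_def \<mu>2_def by (simp add: power2_eq_square algebra_simps)
  have wH: "w \<mu> \<in> H" for \<mu>
    unfolding w_def by (intro subspace_add[OF subspace_H] subspace_scale[OF subspace_H] fH)
  have Aw: "A (w \<mu>) = \<mu> *\<^sub>R w \<mu>" if "\<mu>\<^sup>2 = 4 * s\<^sup>2 / kk - 2 * b * \<mu>" for \<mu>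
  proof -
    have "A (w \<mu>) = (- 2 * s) *\<^sub>R ((- 2 * s / kk) *\<^sub>R f2) + \<mu> *\<^sub>R ((- 2 * s) *\<^sub>R f1 + (- 4 * real l * \<delta> / kk) *\<^sub>R f2)"
      unfolding w_def linear_add[OF A(1)] linear_scale[OF A(1)] Af1 Af2 ..
    also have "\<dots> = (\<mu> * (- 2 * s)) *\<^sub>R f1 + (4 * s\<^sup>2 / kk - 2 * b * \<mu>) *\<^sub>R f2"
      by (simp add: vec_eq_iff b_def power2_eq_square algebra_simps)
    also have "\<dots> = \<mu> *\<^sub>R w \<mu>" unfolding that[symmetric] by (simp add: w_def scaleR_diff_right power2_eq_square)
    finally show ?thesis .
  qed
  have w0: "w \<mu> \<noteq> 0" for \<mu>
  proof
    assume *: "w \<mu> = 0"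
    have "w \<mu> \<bullet> f1 = (- 2 * s) * (2 * real l)"
      unfolding w_def inner_add_left inner_scaleR_left inner_commute[of f2 f1] f11 f12 by simp
    then show False using * s(1) l_pos by simp
  qed
  have ww: "w \<mu>1 \<bullet> w \<mu>2 = 0"
  proof -
    have "w \<mu>1 \<bullet> w \<mu>2 = 4 * s\<^sup>2 * (2 * real l) + (\<mu>1 * \<mu>2) * (2 * real l * kk)"
      unfolding w_def inner_add_left inner_add_right inner_scaleR_left inner_scaleR_right
        inner_commute[of f2 f1] f11 f12 f22 by (simp add: power2_eq_square)
    then show ?thesis using prod kk_pos by simp
  qed
  have VV': "u \<bullet> v = 0" if "u \<in> V S" "v \<in> V S'" for u v
    unfolding inner_vec_def using that by (intro sum.neutral) (auto simp: V_def S'_def)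
  \<comment> \<open>\<open>w \<mu>\<close> is constant on the support of \<open>u\<close>, and the
    coordinates of \<open>u\<close> sum to zero.\<close>
  have Vw: "u \<bullet> w \<mu> = 0" if u: "u \<in> V S \<or> u \<in> V S'" for u \<mu>
  proof -
    obtain c where c: "\<And>j. u $ j * (w \<mu>) $ j = c * u $ j"
    proof (cases "u \<in> V S")
      case True
      then have "u $ j * (w \<mu>) $ j = (- 2 * s + \<mu>) * u $ j" for j
        using i0S by (cases "j \<in> S") (auto simp: V_def w_def f1_def f2_def sgn_of_def)
      then show ?thesis using that by blast
    next
      case False
      then have "u $ j * (w \<mu>) $ j = (2 * s + \<mu>) * u $ j" for j
        using i0S u by (cases "j \<in> S'") (auto simp: V_def w_def f1_def f2_def sgn_of_def S'_def)
      then show ?thesis using that by blast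
    qed
    have "u \<bullet> w \<mu> = c * (\<Sum>j\<in>UNIV. u $ j)" by (simp add: inner_vec_def c sum_distrib_left)
    then show ?thesis using u by (auto simp: V_def)
  qed
  obtain P where P: "P \<subseteq> V S" "pairwise orthogonal P" "\<And>x. x \<in> P \<Longrightarrow> norm x = 1" "independent P" "card P = l - 1"
    using orthonormal_basis_subspace[OF subV] dimV(1) by metis
  obtain M where M: "M \<subseteq> V S'" "pairwise orthogonal M" "\<And>x. x \<in> M \<Longrightarrow> norm x = 1" "independent M" "card M = l - 1"
    using orthonormal_basis_subspace[OF subV] dimV(2) by metis
  have fin: "finite P" "finite M" using P(4) M(4) independent_imp_finite by auto
  let ?B = "insert (w \<mu>1) (insert (w \<mu>2) (P \<union> M))"
  have nz: "0 \<notin> ?B" using w0 P(3) M(3) by fastforce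
  have self: "u = 0" if "u \<bullet> u = 0" for u :: "real ^ 'k" using that by simp
  have ww12: "w \<mu>1 \<noteq> w \<mu>2" using ww w0 self by metis
  have wPM: "w \<mu> \<notin> P \<union> M" for \<mu> using Vw[of "w \<mu>" \<mu>] P(1) M(1) w0 self by blast
  have PM: "P \<inter> M = {}" using VV' P(1) M(1) nz self by blast
  have PP: "u \<bullet> v = 0" if "u \<in> P" "v \<in> P" "u \<noteq> v" for u v
    using P(2) that by (simp add: pairwise_def orthogonal_def)
  have MM: "u \<bullet> v = 0" if "u \<in> M" "v \<in> M" "u \<noteq> v" for u v
    using M(2) that by (simp add: pairwise_def orthogonal_def)
  have PM0: "u \<bullet> v = 0" if "u \<in> P" "v \<in> M" for u v
    using VV' P(1) M(1) that by blast
  have MP0: "v \<bullet> u = 0" if "u \<in> P" "v \<in> M" for u v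
    using PM0[OF that] by (simp add: inner_commute)
  have PMw: "u \<bullet> w \<mu> = 0" if "u \<in> P \<or> u \<in> M" for u \<mu>
    using Vw P(1) M(1) that by blast
  have wPM0: "w \<mu> \<bullet> u = 0" if "u \<in> P \<or> u \<in> M" for u \<mu>
    using PMw[OF that] by (simp add: inner_commute)
  have ww': "w \<mu>2 \<bullet> w \<mu>1 = 0" using ww by (simp add: inner_commute)
  have orth: "pairwise orthogonal ?B"
  proof -
    have "orthogonal u v" if "u \<in> ?B" "v \<in> ?B" "u \<noteq> v" for u v
    proof -
      have "u \<bullet> v = 0"
        using that by (elim insertE UnE) (simp_all add: PP MM PM0 MP0 PMw wPM0 ww ww')
      then show ?thesis by (simp add: orthogonal_def)
    qed
    then show ?thesis by (simp add: pairwise_def)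
  qed
  have card: "card ?B = dim (H :: (real ^ 'k) set)"
  proof -
    have "card ?B = Suc (Suc (card (P \<union> M)))" using fin wPM ww12 by simp
    also have "card (P \<union> M) = (l - 1) + (l - 1)" using card_Un_disjoint[OF fin PM] P(5) M(5) by simp
    finally show ?thesis using l_pos card_k by (simp add: dim_H)
  qed
  define e where "e u = (if u = w \<mu>1 then \<mu>1 else if u = w \<mu>2 then \<mu>2 else if u \<in> P then - 2 * s else 2 * s)" for u
  have ev: "A u = e u *\<^sub>R u" if "u \<in> ?B" for u
    using that Aw root eigV eigV' P(1) M(1) by (auto simp: e_def subset_iff)
  have "{u \<in> ?B. e u < 0} = insert (w \<mu>1) P"
    using mu s(1) ww12 wPM PM by (auto simp: e_def)
  then have "card {u \<in> ?B. e u < 0} = l" using fin wPM P(5) l_pos by simp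
  moreover have "?B \<subseteq> H" using wH P(1) M(1) VH by blast
  ultimately show ?thesis
    using index_eq_card_negative[OF A _ _ nz orth card ev] fin unfolding index_def A_def by simp
qed

end

section \<open>The branches ending at the folds\<close>

context perturbed_family
begin

lemma fold_non_hyperbolic:
  assumes S: "S \<subseteq> others" "excess S \<noteq> 0"
  shows "fold_pt S \<notin> hyperbolic_zeros g"
proof -
  obtain x lam where p: "fold_pt S = (x, lam)" by (cases "fold_pt S")
  have x: "x \<in> H" "(x, lam) \<in> N" using fold_pt_zero(1)[OF S] zeros_N p by (auto simp: zeros_def HR_def)
  have "linearization g (x, lam) (ker_vec S) = 0"
    using fold_kernel(1)[OF S] linearization_g[OF x ker_vec_in_H[OF S(1)]] by (simp add: p)
  then have "0 \<in> eigenvalues (linearization g (x, lam))"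
    unfolding eigenvalue_0_iff[OF linear_linearization[OF g_smooth_on x(1)]]
    using ker_vec_in_H[OF S(1)] ker_vec_nonzero by blast
  then show ?thesis unfolding p by (force simp: hyperbolic_zeros_def)
qed

lemma fold_saddle_node: "S \<subseteq> others \<Longrightarrow> excess S \<noteq> 0 \<Longrightarrow> saddle_node g (fold_pt S)"
  using g_saddle_nodes(1) fold_non_hyperbolic fold_pt_zero(1)
  by (auto simp: only_saddle_nodes_def saddle_nodes_def)

definition half_branch_pt :: "'k set \<Rightarrow> real \<Rightarrow> real \<Rightarrow> (real ^ 'k) \<times> real" where
  "half_branch_pt S \<sigma> lam = (sol S (branch_s S \<sigma> lam) lam, lam)"

text \<open>The real \<open>sqrt\<close> is continuous on the whole line, negative arguments
  included, so each sheet extends continuously past the fold; only the part with nonnegative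
  discriminant consists of zeros.\<close>

lemma continuous_half_branch_pt: "continuous_on UNIV (half_branch_pt S \<sigma>)"
proof -
  have "continuous_on UNIV (disc S)"
    unfolding disc_def[abs_def] by (intro continuous_intros theta_cont)
  then have b: "continuous_on UNIV (branch_s S \<sigma>)"
    unfolding branch_s_def[abs_def] divide_inverse by (intro continuous_intros)
  have "continuous_on UNIV (\<lambda>lam. sol S (branch_s S \<sigma> lam) lam $ j)" for j
    by (cases "j = i0") (simp_all add: sol_def, (intro continuous_intros b; simp)+)
  then have "continuous_on UNIV (\<lambda>lam. \<chi> j. sol S (branch_s S \<sigma> lam) lam $ j)"
    by (rule continuous_on_vec_lambda)
  then show ?thesis unfolding half_branch_pt_def[abs_def] by (intro continuous_intros) simp
qed

text \<open>Where \<theta> is constant the discriminant is k^2 times the difference of \<lambda>^2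
  and the squared fold parameter; beyond that range it is positive by the bound on \<theta>.\<close>

lemma disc_sign:
  assumes S: "S \<subseteq> others" "excess S \<noteq> 0"
  shows "\<bar>lam\<bar> > \<bar>fold_lam S\<bar> \<Longrightarrow> disc S lam > 0" "disc S lam \<ge> 0 \<Longrightarrow> \<bar>lam\<bar> \<ge> \<bar>fold_lam S\<bar>"
    "disc S (fold_lam S) = 0"
proof -
  have d: "disc S lam = kk\<^sup>2 * (lam\<^sup>2 - (fold_lam S)\<^sup>2)" if "lam\<^sup>2 < a" for lam
  proof -
    have "disc S lam = kk\<^sup>2 * lam\<^sup>2 - kk * (4 * ((excess S)\<^sup>2 - 1) * \<eta>)"
      using theta_eq[OF that] by (simp add: disc_def)
    then show ?thesis
      unfolding fold_lam_square[OF S(2), symmetric] by (simp add: power2_eq_square algebra_simps)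
  qed
  note small = fold_lam_small[OF S]
  show "disc S (fold_lam S) = 0" using d[OF small] by simp
  show "disc S lam > 0" if "\<bar>lam\<bar> > \<bar>fold_lam S\<bar>"
  proof (cases "lam\<^sup>2 < a")
    case True
    have "(fold_lam S)\<^sup>2 < lam\<^sup>2" using power_strict_mono[OF that, of 2] by simp
    then show ?thesis using d[OF True] kk_pos by simp
  next
    case False
    then show ?thesis using disc_pos_large[OF S] by simp
  qed
  show "\<bar>lam\<bar> \<ge> \<bar>fold_lam S\<bar>" if "disc S lam \<ge> 0"
  proof (cases "lam\<^sup>2 < a")
    case True
    have "lam\<^sup>2 - (fold_lam S)\<^sup>2 \<ge> 0" using that d[OF True] kk_pos by (simp add: zero_le_mult_iff)
    then show ?thesis by (simp add: abs_le_square_iff)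
  next
    case False
    then show ?thesis using small by (simp add: abs_le_square_iff)
  qed
qed

lemma half_branch_fold:
  assumes S: "S \<subseteq> others" "excess S \<noteq> 0"
  shows "half_branch_pt S \<sigma> (fold_lam S) = fold_pt S"
proof -
  have M: "(excess S)\<^sup>2 - 1 > 0" using excess_square[OF S(2)] by simp
  have "(2 * ((excess S)\<^sup>2 - 1) * fold_s S + kk * excess S * fold_lam S)\<^sup>2 = 0"
    using fold_sol_eq[OF S] unfolding sol_eq_iff_disc[OF S(2)] disc_sign(3)[OF S] .
  then have "fold_s S = - (kk * excess S * fold_lam S) / (2 * ((excess S)\<^sup>2 - 1))"
    using M by (simp add: field_simps)
  then show ?thesis by (simp add: half_branch_pt_def fold_pt_def branch_s_def disc_sign(3)[OF S])
qed

text \<open>The hyperbolic zeros in an unbalanced orthant form two sheets, told apart by the sign of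
  the root of the discriminant. Each sheet is the continuous image of a half-line and is separated
  by open sets from all other hyperbolic zeros, hence is a whole component; its finite end is the
  fold.\<close>

lemma unbalanced_branch:
  assumes B: "B \<in> branches g" and p: "p \<in> B" "p \<in> orthant S" and S: "S \<subseteq> others" "excess S \<noteq> 0"
  shows "curve_starts_or_ends_at B (fold_pt S)"
proof -
  define \<kappa> :: real where "\<kappa> = (if excess S > 0 then -1 else 1)"
  have \<kappa>: "\<kappa> * \<kappa> = 1" "\<bar>\<kappa>\<bar> = 1" "\<And>lam. excess S * lam < 0 \<longleftrightarrow> \<kappa> * lam > 0"
    using S(2) by (auto simp: \<kappa>_def mult_less_0_iff)
  have \<kappa>abs: "\<kappa> * lam = \<bar>lam\<bar>" if "excess S * lam < 0" for lam
    using \<kappa>(2) \<kappa>(3)[of lam] that by (metis abs_mult abs_of_pos mult_1)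
  have \<kappa>\<kappa>: "\<kappa> * (\<kappa> * t) = t" for t using \<kappa>(1) by (simp flip: mult.assoc)
  have M: "(excess S)\<^sup>2 - 1 > 0" using excess_square[OF S(2)] by simp
  have neg_fold: "excess S * fold_lam S < 0"
    using sol_eq_sign[OF fold_sol_eq[OF S] fold_s_facts(1)[OF S(2)] S(2)] .
  let ?L = "\<bar>fold_lam S\<bar>"
  have Bc: "connected B" "B \<subseteq> hyperbolic_zeros g"
    using B in_components_connected in_components_subset unfolding branches_def by blast+
  have "others \<noteq> {}" using card_others l_pos by (metis card.empty mult_eq_0_iff not_one_le_zero zero_neq_numeral)
  then obtain j0 where j0: "j0 \<noteq> i0" by blast
  \<comment> \<open>A continuous function on the whole space that recovers the signed root 2(m^2 -
    1)s + km\<lambda>; the coordinate \<open>j0\<close> serves to read off \<open>s\<close>.\<close>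
  define q where "q p = 2 * ((excess S)\<^sup>2 - 1) * (sgn_of S j0 * (fst p $ j0 - snd p / 2)) + kk * excess S * snd p"
    for p :: "(real ^ 'k) \<times> real"
  have q_sol: "q (sol S s lam, lam) = 2 * ((excess S)\<^sup>2 - 1) * s + kk * excess S * lam" for s lam
    using j0 by (simp add: q_def sol_def)
  have char: "\<exists>lam. r = half_branch_pt S (sgn (q r)) lam \<and> \<kappa> * lam > ?L \<and> q r \<noteq> 0"
    if r: "r \<in> hyperbolic_zeros g" "r \<in> orthant S" for r
  proof -
    obtain x lam where xl: "r = (x, lam)" by (cases r)
    have z: "(x, lam) \<in> zeros g" using r(1) by (simp add: hyperbolic_zeros_def xl)
    obtain s where s: "s > 0" "x = sol S s lam" "sol_eq S s lam" using zeros_orthantE[OF z r(2)[unfolded xl] S(1)] .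
    have neg: "excess S * lam < 0" by (rule sol_eq_sign[OF s(3,1) S(2)])
    have q: "q r = 2 * ((excess S)\<^sup>2 - 1) * s + kk * excess S * lam" by (simp add: xl s(2) q_sol)
    have q2: "(q r)\<^sup>2 = disc S lam" using s(3) unfolding q sol_eq_iff_disc[OF S(2)] .
    then have "disc S lam \<ge> 0" by (metis zero_le_power2)
    then have "\<bar>lam\<bar> \<ge> ?L" using disc_sign(2)[OF S] by blast
    \<comment> \<open>With equality the discriminant vanishes, so the two roots coincide and the
      point is the non-hyperbolic fold.\<close>
    moreover have "\<bar>lam\<bar> \<noteq> ?L"
    proof
      assume eq: "\<bar>lam\<bar> = ?L"
      then have "\<kappa> * lam = \<kappa> * fold_lam S" using \<kappa>abs neg neg_fold by simp
      then have lf: "lam = fold_lam S" using \<kappa>\<kappa> by metis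
      have "(q r)\<^sup>2 = 0" using q2 lf disc_sign(3)[OF S] by simp
      moreover have "(q (fold_pt S))\<^sup>2 = 0"
        using fold_sol_eq[OF S] unfolding fold_pt_def q_sol sol_eq_iff_disc[OF S(2)] disc_sign(3)[OF S] .
      ultimately have "q r = q (fold_pt S)" by simp
      then have "s = fold_s S" using M by (simp add: q fold_pt_def q_sol lf)
      then have "r = fold_pt S" by (simp add: xl s(2) lf fold_pt_def)
      then show False using fold_non_hyperbolic[OF S] r(1) by simp
    qed
    ultimately have gt: "\<bar>lam\<bar> > ?L" by simp
    have q0: "q r \<noteq> 0" using q2 disc_sign(1)[OF S gt] by auto
    have "sgn (q r) * sqrt (disc S lam) = q r"
      unfolding q2[symmetric] by (simp add: sgn_mult_abs)
    then have "branch_s S (sgn (q r)) lam = s"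
      using M by (simp add: branch_s_def q)
    then show ?thesis
      using xl s(2) gt \<kappa>abs[OF neg] q0 by (intro exI[of _ lam]) (simp add: half_branch_pt_def)
  qed
  define \<sigma> where "\<sigma> = sgn (q p)"
  have p_hyp: "p \<in> hyperbolic_zeros g" using p(1) Bc(2) by blast
  have \<sigma>: "\<sigma> = 1 \<or> \<sigma> = -1" using char[OF p_hyp p(2)] by (auto simp: \<sigma>_def sgn_real_def)
  have conv: "half_branch_pt S \<sigma> lam \<in> hyperbolic_zeros g \<and> half_branch_pt S \<sigma> lam \<in> orthant S \<and>
      \<sigma> * q (half_branch_pt S \<sigma> lam) > 0" if lam: "\<kappa> * lam > ?L" for lam
  proof -
    have kl: "\<kappa> * lam > 0" using lam by linarith
    then have neg: "excess S * lam < 0" using \<kappa>(3) by simp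
    have al: "\<bar>lam\<bar> > ?L" using lam \<kappa>abs[OF neg] by simp
    note D = disc_sign(1)[OF S al]
    note b = branch_s_sol[OF S(2) neg less_imp_le[OF D] \<sigma>]
    have z: "half_branch_pt S \<sigma> lam \<in> zeros g" unfolding half_branch_pt_def by (rule sol_zero[OF S(1) b(2)])
    have or: "half_branch_pt S \<sigma> lam \<in> orthant S"
      unfolding half_branch_pt_def sol_in_orthant by (rule b(1))
    have "half_branch_pt S \<sigma> lam \<noteq> fold_pt S" using al by (auto simp: half_branch_pt_def fold_pt_def)
    then have "half_branch_pt S \<sigma> lam \<in> hyperbolic_zeros g" using g_non_hyperbolic[OF z _ S(1) or] by blast
    moreover have "q (half_branch_pt S \<sigma> lam) = \<sigma> * sqrt (disc S lam)"
      unfolding half_branch_pt_def q_sol by (rule b(3))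
    then have "\<sigma> * q (half_branch_pt S \<sigma> lam) > 0" using \<sigma> D by auto
    ultimately show ?thesis using or by blast
  qed
  let ?I = "{lam. \<kappa> * lam > ?L}"
  let ?\<Gamma> = "half_branch_pt S \<sigma>"
  have B_eq: "B = ?\<Gamma> ` ?I"
  proof
    have "connected ?I"
    proof (cases "\<kappa> = 1")
      case True
      then have "?I = {?L<..}" by auto
      then show ?thesis by simp
    next
      case False
      then have "?I = {..< - ?L}" by (auto simp: \<kappa>_def split: if_splits)
      then show ?thesis by simp
    qed
    then have "connected (?\<Gamma> ` ?I)"
      by (intro connected_continuous_image continuous_on_subset[OF continuous_half_branch_pt]) auto
    moreover have "?\<Gamma> ` ?I \<subseteq> hyperbolic_zeros g" using conv by blast
    moreover have "B \<inter> ?\<Gamma> ` ?I \<noteq> {}" using char[OF p_hyp p(2)] p(1) unfolding \<sigma>_def by blast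
    ultimately show "?\<Gamma> ` ?I \<subseteq> B" using components_maximal B unfolding branches_def by blast
    \<comment> \<open>Two disjoint open sets covering the hyperbolic zeros: the sheet of
      \<open>p\<close>, and the opposite sheet together with all other orthants.\<close>
    define O1 where "O1 = orthant S \<inter> {r. 0 < \<sigma> * q r}"
    define O2 where "O2 = (orthant S \<inter> {r. \<sigma> * q r < 0}) \<union> (\<Union>S'\<in>Pow others - {S}. orthant S')"
    have "open {r. 0 < \<sigma> * q r}" "open {r. \<sigma> * q r < 0}"
      unfolding q_def by (intro open_Collect_less continuous_intros; simp)+
    then have op: "open O1" "open O2" unfolding O1_def O2_def using open_orthant by auto
    have "r \<notin> O2" if "r \<in> O1" for r
    proof
      assume "r \<in> O2"
      with that obtain S' where "S' \<subseteq> others" "S' \<noteq> S" "r \<in> orthant S'" by (auto simp: O1_def O2_def)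
      then show False using orthant_disjoint[OF S(1), of S' r] that by (auto simp: O1_def)
    qed
    then have "O1 \<inter> O2 \<inter> B = {}" by blast
    moreover have "B \<subseteq> O1 \<union> O2"
    proof
      fix r assume "r \<in> B"
      then have r: "r \<in> hyperbolic_zeros g" using Bc(2) by blast
      then have "(fst r, snd r) \<in> zeros g" by (simp add: hyperbolic_zeros_def)
      from zerosE[OF this] obtain S' where S': "S' \<subseteq> others" "r \<in> orthant S'" by (metis prod.collapse)
      show "r \<in> O1 \<union> O2"
      proof (cases "S' = S")
        case True
        then have "q r \<noteq> 0" using char[OF r] S' by blast
        then have "\<sigma> * q r > 0 \<or> \<sigma> * q r < 0" using \<sigma> by (auto simp: neq_iff)
        then show ?thesis using S' True unfolding O1_def O2_def by blast
      next
        case False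
        then show ?thesis using S' unfolding O2_def by blast
      qed
    qed
    ultimately have "O1 \<inter> B = {} \<or> O2 \<inter> B = {}" by (metis connectedD[OF Bc(1) op])
    moreover have "p \<in> O1"
      using p(2) char[OF p_hyp p(2)] by (auto simp: O1_def \<sigma>_def sgn_real_def)
    ultimately have B1: "B \<subseteq> O1" using p(1) \<open>B \<subseteq> O1 \<union> O2\<close> by blast
    show "B \<subseteq> ?\<Gamma> ` ?I"
    proof
      fix r assume r: "r \<in> B"
      then have r1: "r \<in> orthant S" "\<sigma> * q r > 0" "r \<in> hyperbolic_zeros g" using B1 Bc(2) by (auto simp: O1_def)
      then obtain lam where lam: "r = half_branch_pt S (sgn (q r)) lam" "\<kappa> * lam > ?L" using char by blast
      have "sgn (q r) = \<sigma>" using r1(2) \<sigma> by (auto simp: sgn_real_def)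
      then show "r \<in> ?\<Gamma> ` ?I" using lam by auto
    qed
  qed
  \<comment> \<open>Maps (0, 1) onto the half-line beyond the fold parameter, with t = 0 at the fold
    itself.\<close>
  define \<nu> where "\<nu> t = \<kappa> * (?L + t / (1 - t))" for t :: real
  have \<kappa>\<nu>: "\<kappa> * \<nu> t = ?L + t / (1 - t)" for t unfolding \<nu>_def by (rule \<kappa>\<kappa>)
  have cont_\<nu>: "continuous_on {..<1} \<nu>" unfolding \<nu>_def by (intro continuous_intros) auto
  have im: "\<nu> ` {0<..<1} = ?I"
  proof (intro equalityI subsetI)
    fix lam assume "lam \<in> \<nu> ` {0<..<1}"
    then show "lam \<in> ?I" using \<kappa>\<nu> by auto
  next
    fix lam assume lam: "lam \<in> ?I"
    define u where "u = \<kappa> * lam - ?L"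
    have u: "u > 0" using lam by (simp add: u_def)
    then have "u / (1 + u) / (1 - u / (1 + u)) = u" by (simp add: field_simps)
    then have "\<kappa> * \<nu> (u / (1 + u)) = \<kappa> * lam" unfolding \<kappa>\<nu> by (simp add: u_def)
    then have "\<nu> (u / (1 + u)) = lam" using \<kappa>\<kappa> by metis
    moreover have "u / (1 + u) \<in> {0<..<1}" using u by simp
    ultimately show "lam \<in> \<nu> ` {0<..<1}" by blast
  qed
  have inj: "inj_on \<nu> {0<..<1}"
  proof (rule inj_onI)
    fix t t' assume *: "t \<in> {0<..<1::real}" "t' \<in> {0<..<1}" "\<nu> t = \<nu> t'"
    then have "t / (1 - t) = t' / (1 - t')" using \<kappa>\<nu>[of t] \<kappa>\<nu>[of t'] by simp
    then show "t = t'" using * by (simp add: field_simps)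
  qed
  \<comment> \<open>Continuity is taken up to and across t = 0, which turns the one-sided limit into
    the value at the fold.\<close>
  have "continuous_on {..<1} (?\<Gamma> \<circ> \<nu>)"
    by (intro continuous_on_compose cont_\<nu> continuous_on_subset[OF continuous_half_branch_pt]) auto
  then have cont: "continuous_on {0<..<1} (?\<Gamma> \<circ> \<nu>)" and c0: "isCont (?\<Gamma> \<circ> \<nu>) 0"
    by (auto intro: continuous_on_subset simp: continuous_on_eq_continuous_at o_def)
  have "((?\<Gamma> \<circ> \<nu>) \<longlongrightarrow> (?\<Gamma> \<circ> \<nu>) 0) (at_right 0)"
    by (rule tendsto_within_subset[OF c0[unfolded isCont_def]]) simp
  moreover have "\<nu> 0 = fold_lam S" using \<kappa>abs[OF neg_fold] \<kappa>\<kappa>[of "fold_lam S"] by (simp add: \<nu>_def)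
  ultimately have lim: "((?\<Gamma> \<circ> \<nu>) \<longlongrightarrow> fold_pt S) (at_right 0)" using half_branch_fold[OF S] by simp
  have "inj ?\<Gamma>" by (auto simp: inj_on_def half_branch_pt_def)
  then have "inj_on (?\<Gamma> \<circ> \<nu>) {0<..<1}" using inj by (intro comp_inj_on) (auto intro: inj_on_subset)
  moreover have "(?\<Gamma> \<circ> \<nu>) ` {0<..<1} = B" by (simp only: image_comp[symmetric] im B_eq)
  ultimately show ?thesis unfolding curve_starts_or_ends_at_def using cont lim by blast
qed

text \<open>Zeros in balanced orthants have index \<open>l\<close>, so a different index at one
  point already places the branch in an unbalanced orthant.\<close>

lemma branch_index:
  assumes B: "B \<in> branches g" "p \<in> B" "index g p \<noteq> l"
  obtains S where "S \<subseteq> others" "excess S \<noteq> 0" "curve_starts_or_ends_at B (fold_pt S)"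
proof -
  obtain x lam where p: "p = (x, lam)" by (cases p)
  have "p \<in> hyperbolic_zeros g" using B(1,2) in_components_subset unfolding branches_def by blast
  then have z: "(x, lam) \<in> zeros g" by (simp add: p hyperbolic_zeros_def)
  obtain S where S: "S \<subseteq> others" "(x, lam) \<in> orthant S" using zerosE[OF z] by metis
  have m: "excess S \<noteq> 0" using balanced_index[OF z S(2,1)] B(3) p by blast
  show thesis using that[OF S(1) m unbalanced_branch[OF B(1,2) _ S(1) m]] S(2) p by blast
qed

lemma crossing_index:
  assumes "crossing_curve g \<gamma>"
  shows "index g (\<gamma> t) = l"
proof -
  obtain S where S: "S \<subseteq> others" "excess S = 0" "range \<gamma> = zeros g \<inter> orthant S"
    using crossing_curve_range[OF _ g_close g_structured assms] by auto
  have "\<gamma> t \<in> zeros g \<inter> orthant S" using S(3) by blast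
  then show ?thesis using balanced_index[of "fst (\<gamma> t)" "snd (\<gamma> t)" S] S by simp
qed

end

section \<open>The main theorem\<close>

lemma pert_dir_permute:
  assumes "bij \<sigma>" "\<sigma> i0 = i0"
  shows "permute_coords \<sigma> (pert_dir i0) = pert_dir i0"
proof -
  have "inv \<sigma> i = i0 \<longleftrightarrow> i = i0" for i using assms by (metis bij_inv_eq_iff)
  then show ?thesis by (simp add: permute_coords_def pert_dir_def vec_eq_iff)
qed

lemma sum_permute:
  fixes x :: "real ^ 'k::finite"
  assumes "bij \<sigma>"
  shows "(\<Sum>j\<in>UNIV. f (x $ inv \<sigma> j)) = (\<Sum>j\<in>UNIV. f (x $ j))"
  using sum.reindex_bij_betw[of "inv \<sigma>" UNIV UNIV "\<lambda>j. f (x $ j)"] bij_imp_bij_inv[OF assms] by simp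

lemma norm_eps1:
  assumes "CARD('k) \<ge> 2"
  shows "norm (eps1 (i0 :: 'k::finite)) = 1" "eps1 i0 \<in> (H :: (real ^ 'k) set)"
proof -
  let ?k = "real CARD('k)"
  let ?v = "(\<chi> i. if i = i0 then ?k - 1 else - 1) :: real ^ 'k"
  have k: "?k * (?k - 1) > 0" using assms by simp
  have card: "real (card (UNIV - {i0})) = ?k - 1" using assms by (simp add: card_Diff_subset of_nat_diff)
  have sum: "(\<Sum>i\<in>UNIV. f (?v $ i)) = f (?k - 1) + (?k - 1) * f (- 1)" for f :: "real \<Rightarrow> real"
  proof -
    have "(\<Sum>i\<in>UNIV. f (?v $ i)) = f (?k - 1) + (\<Sum>i\<in>UNIV - {i0}. f (?v $ i))"
      by (subst sum.remove[of _ i0]) auto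
    also have "(\<Sum>i\<in>UNIV - {i0}. f (?v $ i)) = (\<Sum>i\<in>UNIV - {i0}. f (- 1))" by (rule sum.cong) auto
    finally show ?thesis unfolding sum_constant card .
  qed
  have "?v \<bullet> ?v = ?k * (?k - 1)"
    using sum[of "\<lambda>t. t * t"] unfolding inner_vec_def inner_real_def by (simp add: algebra_simps)
  then have "norm ?v = sqrt (?k * (?k - 1))" by (simp only: norm_eq_sqrt_inner)
  then show "norm (eps1 i0) = 1" using k assms by (simp add: eps1_def)
  have "?v \<in> H" using sum[of "\<lambda>t. t"] by (simp add: H_def)
  then show "eps1 i0 \<in> H" unfolding eps1_def by (rule subspace_scale[OF subspace_H])
qed

text \<open>Depending on \<open>x\<close> only through |x|^2, the cutoff is invariant under
  permutations of the coordinates. With c = \<eta>0 it equals 1 for |x|^2 <= 2\<eta>0 and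
  \<lambda>^2 <= b/2, and it vanishes for |x|^2 >= 4\<eta>0, the square of \<delta>1.\<close>

definition cutoff_pert :: "'k \<Rightarrow> real \<Rightarrow> real \<Rightarrow> (real ^ 'k) \<times> real \<Rightarrow> real ^ 'k" where
  "cutoff_pert i0 b c = (\<lambda>(x, lam). (bump (b / 2) b (lam\<^sup>2) * bump (2 * c) (4 * c) (x \<bullet> x)) *\<^sub>R pert_dir i0)"

lemma smooth_fns_coordinate:
  "(\<lambda>p. fst p $ i) \<in> (smooth_fns :: ((real ^ 'k::finite) \<times> real \<Rightarrow> real) set)"
  "(\<lambda>p. snd p) \<in> (smooth_fns :: ((real ^ 'k::finite) \<times> real \<Rightarrow> real) set)"
proof -
  have 1: "(\<lambda>p. fst p $ i) = (\<lambda>p :: (real ^ 'k) \<times> real. p \<bullet> (axis i 1, 0))"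
    and 2: "(\<lambda>p. snd p) = (\<lambda>p :: (real ^ 'k) \<times> real. p \<bullet> (0, 1))"
    by (auto simp: inner_prod_def inner_axis)
  show "(\<lambda>p. fst p $ i) \<in> (smooth_fns :: ((real ^ 'k) \<times> real \<Rightarrow> real) set)"
    unfolding 1 by (rule smooth_fns.inner)
  show "(\<lambda>p. snd p) \<in> (smooth_fns :: ((real ^ 'k) \<times> real \<Rightarrow> real) set)"
    unfolding 2 by (rule smooth_fns.inner)
qed

lemma smooth_fns_square_norm:
  "(\<lambda>p. fst p \<bullet> fst p) \<in> (smooth_fns :: ((real ^ 'k::finite) \<times> real \<Rightarrow> real) set)"
  unfolding inner_vec_def inner_real_def
  by (intro smooth_fns_sum smooth_fns.mult smooth_fns_coordinate) simp

lemma cutoff_pert_smooth: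
  assumes "b > 0" "c > 0"
  shows "smooth_on_subspace HR (cutoff_pert i0 b c)" "\<And>i. (\<lambda>p. cutoff_pert i0 b c p $ i) \<in> smooth_fns"
proof -
  show *: "(\<lambda>p. cutoff_pert i0 b c p $ i) \<in> smooth_fns" for i
    unfolding cutoff_pert_def case_prod_beta vector_scaleR_component real_scaleR_def power2_eq_square
    using assms by (intro smooth_fns.mult bump_smooth_fns smooth_fns.const smooth_fns_coordinate smooth_fns_square_norm) auto
  show "smooth_on_subspace HR (cutoff_pert i0 b c)"
    by (rule smooth_on_subspace_smooth_fns[OF subspace_HR *])
qed

lemma f_std_smooth_fns: "(\<lambda>p. f_std p $ i) \<in> smooth_fns"
proof -
  have "(\<lambda>p. f_std p $ i) = (\<lambda>p. snd p * fst p $ i -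
      (fst p $ i * fst p $ i - (1 / real CARD('a)) * (fst p \<bullet> fst p)))"
    for i :: "'a::finite"
    by (auto simp: f_std_def Q_def inner_vec_def power2_eq_square)
  then show ?thesis
    by (simp only:) (intro smooth_fns_diff smooth_fns.mult smooth_fns.const smooth_fns_coordinate smooth_fns_square_norm)
qed

theorem theorem4p4:
  fixes i0 :: "'k::finite" and l :: nat and \<eta>0 \<rho> \<delta>1 \<delta>2 :: real
    and W :: "((real ^ 'k) \<times> real) set"
  assumes k: "CARD('k) = 2 * l + 1" "CARD('k) \<ge> 3"
    and \<eta>0: "\<eta>0 > 0"
    and \<rho>: "\<rho> = 4 * sqrt \<eta>0"
    and \<delta>1: "\<delta>1 = \<rho> / 2"
    and \<delta>2: "\<delta>2 = sqrt (real CARD('k) / 3) * \<rho>"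
    and W: "W = W_box i0 \<delta>1 \<delta>2 \<rho>"
  shows "\<exists>C>0. \<exists>\<eta>1\<in>{0<..\<eta>0}. \<forall>\<eta>\<in>{0<..\<eta>1}.
    \<exists>g :: (real ^ 'k) \<times> real \<Rightarrow> real ^ 'k.
      smooth_family g \<and> stabilizer_equivariant i0 g \<and>
      (\<forall>p\<in>HR - W. g p = f_std p) \<and>
      C2_norm W (\<lambda>p. g p - f_std p) < C * \<eta> \<and>
      (only_saddle_nodes g \<and> C2_stable g) \<and>
      (finite (saddle_nodes g) \<and> card (saddle_nodes g) = 2 ^ (2 * l) - ((2 * l) choose l) \<and>
       (\<forall>B\<in>branches g. (\<exists>p\<in>B. index g p \<noteq> l) \<longrightarrow>
          (\<exists>q\<in>W. saddle_node g q \<and> curve_starts_or_ends_at B q))) \<and>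
      (finite (crossing_sets g) \<and> card (crossing_sets g) = (2 * l) choose l \<and>
       (\<forall>\<gamma>. crossing_curve g \<gamma> \<longrightarrow> (\<forall>t. index g (\<gamma> t) = l)))"
proof -
  interpret odd_index i0 l using k by unfold_locales auto
  note k3 = k(2)
  have kk3: "kk \<ge> 3" using k by (simp add: kk_def)
  \<comment> \<open>Chosen so that the \<lambda> part of the norm bound for zeros with \<lambda>^2
    <= b is at most \<eta>0/2.\<close>
  define b where "b = \<eta>0 / (kk * (1 + kk\<^sup>2))"
  \<comment> \<open>Gives 4k\<eta> <= b/4 < b/2, as the fold estimate with a = b/2 requires, and
    makes the \<eta> part of the norm bound at most \<eta>0/8.\<close>
  define \<eta>1 where "\<eta>1 = b / (16 * kk)"
  have kk1: "kk * (1 + kk\<^sup>2) \<ge> 1"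
    using mult_mono[of 1 kk 1 "1 + kk\<^sup>2"] kk3 by simp
  have b: "b > 0" "b \<le> \<eta>0"
    using \<eta>0 kk1 by (auto simp: b_def divide_le_eq intro: mult_right_le_one_le)
  have eta1: "\<eta>1 > 0" "\<eta>1 \<le> \<eta>0"
  proof -
    show "\<eta>1 > 0" using b kk3 by (simp add: \<eta>1_def)
    have "\<eta>1 \<le> b / 1" unfolding \<eta>1_def using b kk3 by (intro divide_left_mono) auto
    then show "\<eta>1 \<le> \<eta>0" using b by simp
  qed
  have \<rho>2: "\<rho>\<^sup>2 = 16 * \<eta>0" and \<rho>pos: "\<rho> > 0" using \<eta>0 by (simp_all add: \<rho> power_mult_distrib)
  \<comment> \<open>Uniform in \<open>t\<close>, so that it applies both to \<theta> \<lambda> and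
    to the smaller effective size after the cutoff in space.\<close>
  have zero_bound: "x \<bullet> x < 2 * \<eta>0"
    if x: "x \<in> H" "pert i0 t x lam = 0" and t: "0 \<le> t" "t \<le> \<eta>1" and lam: "lam\<^sup>2 \<le> b" for x t lam
  proof -
    obtain S s where S: "S \<subseteq> others" "s \<ge> 0" "x = sol S s lam" "(kk * lam / 2 + excess S * s)\<^sup>2 = s\<^sup>2 - kk * t"
      using pert_zeroD[OF x t(1)] .
    have "(norm x)\<^sup>2 \<le> 2 * kk * (lam\<^sup>2 * (1 + kk\<^sup>2) / 4 + kk * t)"
      unfolding S(3) by (rule norm_sol_bound[OF S(1,2) t(1) S(4)])
    also have "\<dots> \<le> 2 * kk * (b * (1 + kk\<^sup>2) / 4 + kk * \<eta>1)"
      using kk_pos lam t by (intro mult_left_mono add_mono divide_right_mono mult_right_mono) auto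
    also have "\<dots> = (kk * (1 + kk\<^sup>2) * b) / 2 + kk * b / 8"
      using kk_pos by (simp add: \<eta>1_def field_simps)
    also have "\<dots> \<le> \<eta>0 / 2 + \<eta>0 / 8"
    proof -
      have "kk * (1 + kk\<^sup>2) \<noteq> 0" using kk1 by linarith
      then have "kk * (1 + kk\<^sup>2) * b = \<eta>0"
        unfolding b_def by (metis times_divide_eq_right nonzero_mult_div_cancel_left)
      moreover have "kk * b \<le> kk * (1 + kk\<^sup>2) * b" using kk_pos b by (intro mult_right_mono) auto
      ultimately show ?thesis by simp
    qed
    finally show ?thesis using \<eta>0 by (simp add: power2_norm_eq_inner)
  qed
  \<comment> \<open>The ball |x|^2 <= 4\<eta>0 has radius \<delta>1, and \<delta>1 < \<rho> <=
    \<delta>2 because k >= 3; so both components of \<open>x\<close> fit. The parameter fits because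
    b <= \<eta>0 <= \<rho>^2.\<close>
  have W_I: "(x, lam) \<in> W" if x: "x \<in> H" "x \<bullet> x \<le> 4 * \<eta>0" "lam\<^sup>2 \<le> b" for x lam
  proof -
    note e = norm_eps1[of i0]
    have e1: "norm (eps1 i0) = 1" "eps1 i0 \<in> H" using e k3 by auto
    have ee: "eps1 i0 \<bullet> eps1 i0 = 1" using e1(1) by (simp add: norm_eq_1)
    define t where "t = x \<bullet> eps1 i0"
    define y where "y = x - t *\<^sub>R eps1 i0"
    have "(norm x)\<^sup>2 \<le> (\<rho> / 2)\<^sup>2" using x(2) \<rho>2 by (simp add: power2_norm_eq_inner power_divide)
    then have nx: "norm x \<le> \<rho> / 2" by (rule power2_le_imp_le) (use \<rho>pos in simp)
    have t: "\<bar>t\<bar> \<le> \<rho> / 2" using Cauchy_Schwarz_ineq2[of x "eps1 i0"] e1(1) nx by (simp add: t_def)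
    have ye: "y \<bullet> eps1 i0 = 0" by (simp add: y_def t_def inner_diff_left ee)
    have "y \<bullet> y = x \<bullet> x - t * t"
      by (simp add: y_def t_def inner_diff_left inner_diff_right ee inner_commute)
    then have "(norm y)\<^sup>2 \<le> (norm x)\<^sup>2" by (simp add: power2_norm_eq_inner)
    then have "norm y \<le> norm x" by (rule power2_le_imp_le) simp
    also have "\<dots> \<le> \<delta>2"
    proof -
      have "sqrt (real CARD('k) / 3) \<ge> 1" using kk3 by simp
      then have "\<delta>2 \<ge> 1 * \<rho>" unfolding \<delta>2 using \<rho>pos by (intro mult_right_mono) auto
      then show ?thesis using nx \<rho>pos by linarith
    qed
    finally have ny: "norm y \<le> \<delta>2" .
    have yH: "y \<in> H" unfolding y_def by (intro subspace_diff[OF subspace_H] subspace_scale[OF subspace_H] x e1)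
    have "lam\<^sup>2 \<le> \<rho>\<^sup>2" using x(3) b \<rho>2 \<eta>0 by linarith
    then have "\<bar>lam\<bar> \<le> \<rho>" using \<rho>pos by (metis abs_le_square_iff abs_of_pos)
    then show ?thesis
      unfolding W W_box_def using t ye ny yH
      by (intro CollectI exI[of _ t] exI[of _ y] exI[of _ lam]) (auto simp: y_def \<delta>1 abs_le_iff)
  qed
  let ?B = "cutoff_pert i0 b \<eta>0 :: (real ^ 'k) \<times> real \<Rightarrow> real ^ 'k"
  note B_smooth = cutoff_pert_smooth[OF b(1) \<eta>0, of i0]
  have bumps: "0 \<le> bump (b / 2) b r" "bump (b / 2) b r \<le> 1" "0 \<le> bump (2 * \<eta>0) (4 * \<eta>0) r"
    "bump (2 * \<eta>0) (4 * \<eta>0) r \<le> 1" for r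
    using b \<eta>0 by (auto intro: bump_bounds)
  \<comment> \<open>A compact box containing \<open>W\<close>, on which the derivatives of the
    cutoff field are bounded.\<close>
  define R where "R = \<delta>1 + \<delta>2"
  let ?K = "(cball 0 R \<inter> H) \<times> {-\<rho>..\<rho>} :: ((real ^ 'k) \<times> real) set"
  have K: "compact ?K" "?K \<subseteq> HR"
    by (intro compact_Times compact_Int_closed closed_H compact_cball compact_Icc) (auto simp: HR_def)
  have WK: "W \<subseteq> ?K"
  proof
    fix p assume "p \<in> W"
    then obtain t y lam where p: "p = (t *\<^sub>R eps1 i0 + y, lam)" "t \<in> {-\<delta>1..\<delta>1}" "y \<in> H" "norm y \<le> \<delta>2" "lam \<in> {-\<rho>..\<rho>}"
      unfolding W W_box_def by blast
    have e1: "norm (eps1 i0) = 1" "eps1 i0 \<in> H" using norm_eps1[of i0] k3 by auto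
    have "norm (t *\<^sub>R eps1 i0 + y) \<le> \<bar>t\<bar> * 1 + norm y"
      using norm_triangle_ineq[of "t *\<^sub>R eps1 i0" y] e1(1) by simp
    then have "norm (t *\<^sub>R eps1 i0 + y) \<le> R" using p(2,4) unfolding R_def by auto
    moreover have "t *\<^sub>R eps1 i0 + y \<in> H"
      by (intro subspace_add[OF subspace_H] subspace_scale[OF subspace_H] e1 p)
    ultimately show "p \<in> ?K" using p by simp
  qed
  obtain M where M: "\<And>p vs. p \<in> ?K \<Longrightarrow> vs \<in> lists HR \<Longrightarrow> length vs \<le> 2 \<Longrightarrow>
    (\<And>v. v \<in> set vs \<Longrightarrow> norm v \<le> 1) \<Longrightarrow> norm (deriv_on HR ?B vs p) \<le> M"
    using deriv_on_bounded[OF subspace_HR B_smooth(1) K] by metis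
  have H0: "(0 :: real ^ 'k) \<in> H" by (rule subspace_0[OF subspace_H])
  have W_ne: "W \<noteq> {}" using W_I[OF H0, of 0] \<eta>0 b by auto
  show ?thesis
  \<comment> \<open>\<open>M\<close> bounds the derivatives of the cutoff field before it is
    multiplied by \<eta>, so the constant is fixed before \<eta>; adding 1 makes the inequality
    strict.\<close>
  proof (intro exI[of _ "\<bar>M\<bar> + 1"] conjI bexI[of _ \<eta>1] ballI)
    show "\<bar>M\<bar> + 1 > 0" by linarith
    show "\<eta>1 \<in> {0<..\<eta>0}" using eta1 by simp
    fix \<eta> assume "\<eta> \<in> {0<..\<eta>1}"
    then have \<eta>: "\<eta> > 0" "\<eta> \<le> \<eta>1" by auto
    define g where "g p = f_std p + \<eta> *\<^sub>R ?B p" for p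
    define \<theta> where "\<theta> lam = \<eta> * bump (b / 2) b (lam\<^sup>2)" for lam
    \<comment> \<open>Either the cutoff in space is 1, or the cutoff in \<lambda> has switched the
      perturbation off and the one in space has no effect.\<close>
    define N :: "((real ^ 'k) \<times> real) set" where "N = {p. fst p \<bullet> fst p < 2 * \<eta>0} \<union> {p. b < (snd p)\<^sup>2}"
    have g_pert: "g (x, lam) = pert i0 (\<theta> lam * bump (2 * \<eta>0) (4 * \<eta>0) (x \<bullet> x)) x lam" for x lam
      by (simp add: g_def f_std_def cutoff_pert_def pert_def \<theta>_def mult.assoc)
    have theta: "0 \<le> \<theta> lam" "\<theta> lam \<le> \<eta>" for lam
      using bumps(1,2) \<eta> by (auto simp: \<theta>_def intro: mult_left_le)
    have theta0: "\<theta> lam = 0" if "lam\<^sup>2 > b" for lam using that by (simp add: \<theta>_def bump_eq_0)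
    have g_smooth: "smooth_family g"
      unfolding smooth_family_def
    proof
      have "(\<lambda>p. g p $ i) \<in> smooth_fns" for i
        unfolding g_def vector_add_component vector_scaleR_component real_scaleR_def
        by (intro smooth_fns.add smooth_fns.mult smooth_fns.const f_std_smooth_fns B_smooth)
      then show "smooth_on_subspace HR g" by (rule smooth_on_subspace_smooth_fns[OF subspace_HR])
      show "g ` HR \<subseteq> H" using pert_in_H by (auto simp: g_pert HR_def)
    qed
    interpret perturbed_family i0 l \<eta> "b / 2" \<theta> g N
    proof unfold_locales
      show "\<eta> > 0" by (rule \<eta>)
      show "smooth_family g" by (rule g_smooth)
      have "(\<lambda>t::real. bump (b / 2) b (t * t)) \<in> smooth_fns"
        using b smooth_fns.inner[of "1::real"] by (intro bump_smooth_fns smooth_fns.mult) auto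
      then show "continuous_on UNIV \<theta>"
        unfolding \<theta>_def[abs_def] power2_eq_square by (intro continuous_intros smooth_fns_continuous)
      show "0 \<le> \<theta> t" "\<theta> t \<le> \<eta>" for t by (rule theta)+
      show "\<theta> t = \<eta>" if "t\<^sup>2 < b / 2" for t
        using that b by (simp add: \<theta>_def bump_eq_1)
      have "4 * kk * \<eta> \<le> 4 * kk * \<eta>1" using \<eta> kk_pos by (intro mult_left_mono) auto
      also have "\<dots> = b / 4" using kk_pos by (simp add: \<eta>1_def)
      also have "\<dots> < b / 2" using b by simp
      finally show "4 * kk * \<eta> < b / 2" .
      show "open N" unfolding N_def by (intro open_Un open_Collect_less continuous_intros)
      show "g (x, lam) = pert i0 (\<theta> lam) x lam" if "x \<in> H" "(x, lam) \<in> N" for x lam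
      proof (cases "lam\<^sup>2 > b")
        case True
        then show ?thesis using theta0 by (simp add: g_pert)
      next
        case False
        then have "x \<bullet> x < 2 * \<eta>0" using that(2) by (simp add: N_def)
        then show ?thesis using \<eta>0 by (simp add: g_pert bump_eq_1)
      qed
      \<comment> \<open>Stated for a general size \<open>t\<close>: at a zero of \<open>g\<close>
        the spatial cutoff factor is not yet known to be 1, so the size there is only known to be
        between 0 and \<eta>.\<close>
      have in_N: "(x, lam) \<in> N" if "x \<in> H" "pert i0 t x lam = 0" "0 \<le> t" "t \<le> \<eta>" for x lam t
      proof (cases "lam\<^sup>2 > b")
        case True
        then show ?thesis by (simp add: N_def)
      next
        case False
        then have "x \<bullet> x < 2 * \<eta>0" using that \<eta> by (intro zero_bound[of x t lam]) auto
        then show ?thesis by (simp add: N_def)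
      qed
      show "(x, lam) \<in> N" if "x \<in> H" "pert i0 (\<theta> lam) x lam = 0" for x lam
        by (rule in_N[OF that theta])
      show "zeros g \<subseteq> N"
      proof
        fix p assume "p \<in> zeros g"
        then obtain x lam where p: "p = (x, lam)" "x \<in> H" "g (x, lam) = 0"
          by (cases p) (auto simp: zeros_def HR_def)
        have "0 \<le> \<theta> lam * bump (2 * \<eta>0) (4 * \<eta>0) (x \<bullet> x)" using theta(1) bumps(3) by simp
        moreover have "\<theta> lam * bump (2 * \<eta>0) (4 * \<eta>0) (x \<bullet> x) \<le> \<eta>"
          using mult_mono[OF theta(2) bumps(4) _ bumps(3)] \<eta> by simp
        ultimately show "p \<in> N" unfolding p(1) using p(2,3) g_pert by (intro in_N) auto
      qed
    qed
    have equivariant: "stabilizer_equivariant i0 g"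
      unfolding stabilizer_equivariant_def
    proof (intro allI ballI impI, elim conjE)
      fix \<sigma> :: "'k \<Rightarrow> 'k" and x :: "real ^ 'k" and lam assume \<sigma>: "bij \<sigma>" "\<sigma> i0 = i0"
      have n: "permute_coords \<sigma> x \<bullet> permute_coords \<sigma> x = x \<bullet> x"
        using sum_permute[OF \<sigma>(1), of "\<lambda>t. t * t" x] by (simp add: permute_coords_def inner_vec_def)
      have q: "Q (permute_coords \<sigma> x) = permute_coords \<sigma> (Q x)"
        using sum_permute[OF \<sigma>(1), of "\<lambda>t. t\<^sup>2" x] by (simp add: Q_def permute_coords_def vec_eq_iff)
      have e: "pert_dir i0 = permute_coords \<sigma> (pert_dir i0 :: real ^ 'k)" using pert_dir_permute[OF \<sigma>] by simp
      have "pert i0 t (permute_coords \<sigma> x) lam = permute_coords \<sigma> (pert i0 t x lam)" for t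
        unfolding pert_def q by (subst e) (simp add: permute_coords_def vec_eq_iff)
      then show "g (permute_coords \<sigma> x, lam) = permute_coords \<sigma> (g (x, lam))" by (simp add: g_pert n)
    qed
    have off_W: "g p = f_std p" if p: "p \<in> HR - W" for p
    proof -
      obtain x lam where xl: "p = (x, lam)" by (cases p)
      have "\<not> (x \<bullet> x \<le> 4 * \<eta>0 \<and> lam\<^sup>2 \<le> b)" using W_I[of x lam] p by (auto simp: xl HR_def)
      then have "?B p = 0" by (auto simp: xl cutoff_pert_def bump_eq_0 not_le less_imp_le)
      then show ?thesis by (simp add: g_def)
    qed
    have "C2_norm W (\<lambda>p. g p - f_std p) \<le> \<eta> * M"
    proof (rule C2_norm_le[OF W_ne])
      fix p and vs :: "((real ^ 'k) \<times> real) list"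
      assume p: "p \<in> W" "vs \<in> lists HR" "length vs \<le> 2" "\<And>v. v \<in> set vs \<Longrightarrow> norm v \<le> 1"
      have pK: "p \<in> ?K" using p(1) WK by blast
      have "deriv_on HR (\<lambda>p. g p - f_std p) vs p = \<eta> *\<^sub>R deriv_on HR ?B vs p"
        using deriv_on_scaleR[OF subspace_HR B_smooth(1) p(2), of p \<eta>] pK K(2) by (auto simp: g_def)
      moreover have "norm (deriv_on HR ?B vs p) \<le> M" by (rule M[OF pK p(2-4)])
      ultimately show "norm (deriv_on HR (\<lambda>p. g p - f_std p) vs p) \<le> \<eta> * M" using \<eta> by simp
    qed
    also have "\<dots> < (\<bar>M\<bar> + 1) * \<eta>"
    proof -
      have "\<eta> * M < \<eta> * (\<bar>M\<bar> + 1)" using \<eta> by (intro mult_strict_left_mono) auto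
      then show ?thesis by (simp add: mult.commute)
    qed
    finally have C2: "C2_norm W (\<lambda>p. g p - f_std p) < (\<bar>M\<bar> + 1) * \<eta>" .
    \<comment> \<open>Folds have \<lambda>^2 < b/2, and there every zero satisfies |x|^2 < 2\<eta>0,
      well inside the region covered by \<open>W\<close>.\<close>
    have fold_W: "fold_pt S \<in> W" if S: "S \<subseteq> others" "excess S \<noteq> 0" for S
    proof -
      obtain x lam where p: "fold_pt S = (x, lam)" by (cases "fold_pt S")
      have lam: "lam\<^sup>2 \<le> b" using fold_lam_small[OF S] p b by (auto simp: fold_pt_def)
      have z: "x \<in> H" "pert i0 (\<theta> lam) x lam = 0" using fold_pt_zero(1)[OF S] zeros_iff p by auto
      have "x \<bullet> x < 2 * \<eta>0" using zero_bound[OF z _ _ lam] theta[of lam] \<eta> by auto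
      then show ?thesis unfolding p using z(1) lam \<eta>0 by (intro W_I) auto
    qed
    have br: "\<exists>q\<in>W. saddle_node g q \<and> curve_starts_or_ends_at B q"
      if "B \<in> branches g" "\<exists>p\<in>B. index g p \<noteq> l" for B
      using branch_index[OF that(1)] that(2) fold_W fold_saddle_node by metis
    show "\<exists>g :: (real ^ 'k) \<times> real \<Rightarrow> real ^ 'k.
      smooth_family g \<and> stabilizer_equivariant i0 g \<and>
      (\<forall>p\<in>HR - W. g p = f_std p) \<and>
      C2_norm W (\<lambda>p. g p - f_std p) < (\<bar>M\<bar> + 1) * \<eta> \<and>
      (only_saddle_nodes g \<and> C2_stable g) \<and>
      (finite (saddle_nodes g) \<and> card (saddle_nodes g) = 2 ^ (2 * l) - ((2 * l) choose l) \<and>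
       (\<forall>B\<in>branches g. (\<exists>p\<in>B. index g p \<noteq> l) \<longrightarrow>
          (\<exists>q\<in>W. saddle_node g q \<and> curve_starts_or_ends_at B q))) \<and>
      (finite (crossing_sets g) \<and> card (crossing_sets g) = (2 * l) choose l \<and>
       (\<forall>\<gamma>. crossing_curve g \<gamma> \<longrightarrow> (\<forall>t. index g (\<gamma> t) = l)))"
      using g_smooth equivariant off_W C2 g_saddle_nodes g_stable g_crossing_sets br crossing_index
      by (intro exI[of _ g]) blast
  qed
qed

end
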